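(* Let $n\ge 3$ and let $\Omega\subset\mathbb R^n$ be a bounded smooth domain which is star-shaped with respect to the origin. Let $p\in(1,n)$, $p^*=\frac{np}{n-p}$, $q\in(p-1,p^*-1)$, and let $a,f,h$ be smooth functions on $\overline\Omega$. Suppose that on $\Omega$ $$a\ge 0,\quad \partial_r a\ge 0,\quad \partial_r f\le 0,\quad h\le 0,\quad \partial_r h\le 0,$$ and that at least one of these inequalities is strict (i.e. holds as a strict inequality throughout $\Omega\setminus\{0\}$). Then the problem $$\Delta_p u+a|u|^{p-2}u=f|u|^{p^*-2}u+h|u|^{q-1}u\ \text{ in }\Omega,\qquad u=0\ \text{ on }\partial\Omega,$$ has no nodal solution.
   Context: $\Delta_p u=-\mathrm{div}(|\nabla u|^{p-2}\nabla u)$. $r=|x|$ and $\partial_r$ is the radial derivative, $r\,\partial_r a=\langle x,\nabla a\rangle$. A solution is a function $u\in W^{1,p}_0(\Omega)$ (completion of $C_o^\infty(\Omega)$ for $\|\nabla u\|_p+\|u\|_p$) satisfying the equation in the sense of distributions; it is nodal if it changes sign. *)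

theory Defs
  imports "HOL-Analysis.Analysis"
begin

text \<open>
  \<open>Ck_on k S f\<close> and \<open>smooth_on S f\<close> are meant for open \<open>S\<close>.  Asking for every direction \<open>v\<close>
  amounts to asking for all partial derivatives.
\<close>

primrec Ck_on ::
  "nat \<Rightarrow> 'a::real_normed_vector set \<Rightarrow> ('a \<Rightarrow> 'b::real_normed_vector) \<Rightarrow> bool" where
  "Ck_on 0 S f \<longleftrightarrow> continuous_on S f"
| "Ck_on (Suc k) S f \<longleftrightarrow>
     (\<forall>x\<in>S. f differentiable (at x)) \<and>
     (\<forall>v. Ck_on k S (\<lambda>x. frechet_derivative f (at x) v))"

definition smooth_on :: "'a::real_normed_vector set \<Rightarrow> ('a \<Rightarrow> 'b::real_normed_vector) \<Rightarrow> bool" where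
  "smooth_on S f \<longleftrightarrow> (\<forall>k. Ck_on k S f)"

text \<open>Smoothness up to the boundary, i.e. on a set that need not be open.\<close>

definition smooth_up_to :: "'a::real_normed_vector set \<Rightarrow> ('a \<Rightarrow> 'b::real_normed_vector) \<Rightarrow> bool" where
  "smooth_up_to K f \<longleftrightarrow>
     (\<exists>U g. open U \<and> K \<subseteq> U \<and> smooth_on U g \<and> (\<forall>x\<in>K. g x = f x))"

definition grad :: "(real^'n \<Rightarrow> real) \<Rightarrow> real^'n \<Rightarrow> real^'n" where
  "grad f x = (\<chi> i. frechet_derivative f (at x) (axis i 1))"

text \<open>At the origin, where the radial derivative is undefined, the value is \<open>0 / 0 = 0\<close>.\<close>

definition radial_deriv :: "(real^'n \<Rightarrow> real) \<Rightarrow> real^'n \<Rightarrow> real" where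
  "radial_deriv f x = (x \<bullet> grad f x) / norm x"

text \<open>
  The boundary is described by local defining functions: near each boundary point the domain
  is the sublevel set of a smooth function without critical points, hence lies on one side of
  the smooth hypersurface \<open>\<rho> = 0\<close>.
\<close>

definition smooth_boundary :: "(real^'n) set \<Rightarrow> bool" where
  "smooth_boundary \<Omega> \<longleftrightarrow>
     (\<forall>z\<in>frontier \<Omega>. \<exists>U \<rho>. open U \<and> z \<in> U \<and> smooth_on U \<rho> \<and>
        (\<forall>x\<in>U. grad \<rho> x \<noteq> 0) \<and> \<Omega> \<inter> U = {x \<in> U. \<rho> x < (0::real)})"

definition smooth_domain :: "(real^'n) set \<Rightarrow> bool" where
  "smooth_domain \<Omega> \<longleftrightarrow> \<Omega> \<noteq> {} \<and> open \<Omega> \<and> connected \<Omega> \<and> smooth_boundary \<Omega>"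

definition star_shaped_wrt :: "'a::real_vector \<Rightarrow> 'a set \<Rightarrow> bool" where
  "star_shaped_wrt c S \<longleftrightarrow> c \<in> S \<and> (\<forall>x\<in>S. closed_segment c x \<subseteq> S)"

definition test_function :: "(real^'n) set \<Rightarrow> (real^'n \<Rightarrow> real) \<Rightarrow> bool" where
  "test_function \<Omega> \<phi> \<longleftrightarrow>
     smooth_on UNIV \<phi> \<and> compact (closure {x. \<phi> x \<noteq> 0}) \<and> closure {x. \<phi> x \<noteq> 0} \<subseteq> \<Omega>"

definition Lp_function ::
  "(real^'n) set \<Rightarrow> real \<Rightarrow> (real^'n \<Rightarrow> 'b::euclidean_space) \<Rightarrow> bool" where
  "Lp_function \<Omega> p v \<longleftrightarrow>
     v \<in> borel_measurable (lebesgue_on \<Omega>) \<and>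
     integrable (lebesgue_on \<Omega>) (\<lambda>x. norm (v x) powr p)"

definition Lp_norm ::
  "(real^'n) set \<Rightarrow> real \<Rightarrow> (real^'n \<Rightarrow> 'b::euclidean_space) \<Rightarrow> real" where
  "Lp_norm \<Omega> p v = (\<integral>x. norm (v x) powr p \<partial>lebesgue_on \<Omega>) powr (1 / p)"

definition locally_integrable ::
  "(real^'n) set \<Rightarrow> (real^'n \<Rightarrow> 'b::euclidean_space) \<Rightarrow> bool" where
  "locally_integrable \<Omega> v \<longleftrightarrow> (\<forall>K. compact K \<and> K \<subseteq> \<Omega> \<longrightarrow> integrable (lebesgue_on K) v)"

definition has_weak_gradient ::
  "(real^'n) set \<Rightarrow> (real^'n \<Rightarrow> real) \<Rightarrow> (real^'n \<Rightarrow> real^'n) \<Rightarrow> bool" where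
  "has_weak_gradient \<Omega> u G \<longleftrightarrow>
     locally_integrable \<Omega> u \<and> locally_integrable \<Omega> G \<and>
     (\<forall>\<phi>. test_function \<Omega> \<phi> \<longrightarrow>
        (\<integral>x. u x *\<^sub>R grad \<phi> x \<partial>lebesgue_on \<Omega>) = - (\<integral>x. \<phi> x *\<^sub>R G x \<partial>lebesgue_on \<Omega>))"

text \<open>
  The completion of the test functions for the norm \<open>\<parallel>\<nabla>u\<parallel>\<^sub>p + \<parallel>u\<parallel>\<^sub>p\<close>, realised as a set of
  functions (a class modulo null sets being represented by any of its members).
\<close>

definition sobolev_W0 :: "(real^'n) set \<Rightarrow> real \<Rightarrow> (real^'n \<Rightarrow> real) set" where
  "sobolev_W0 \<Omega> p = {u. Lp_function \<Omega> p u \<and>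
     (\<exists>G. has_weak_gradient \<Omega> u G \<and> Lp_function \<Omega> p G \<and>
        (\<exists>\<phi>. (\<forall>k. test_function \<Omega> (\<phi> k)) \<and>
           (\<lambda>k::nat. Lp_norm \<Omega> p (\<lambda>x. grad (\<phi> k) x - G x) +
                     Lp_norm \<Omega> p (\<lambda>x. \<phi> k x - u x)) \<longlonglongrightarrow> 0))}"

definition crit_exp :: "nat \<Rightarrow> real \<Rightarrow> real" where
  "crit_exp n p = real n * p / (real n - p)"

text \<open>
  \<open>is_solution\<close>: \<open>u \<in> W\<^sub>0\<close> (this includes the boundary condition) solves
  \<open>- div (|\<nabla>u|\<^bsup>p-2\<^esup> \<nabla>u) + a |u|\<^bsup>p-2\<^esup> u = f |u|\<^bsup>p*-2\<^esup> u + h |u|\<^bsup>q-1\<^esup> u\<close> in the sense of distributions;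
  \<open>G\<close> is \<open>\<nabla>u\<close>, which is unique up to null sets.  For bounded \<open>\<Omega>\<close>, \<open>1 < p < n\<close>,
  \<open>0 < q < p* - 1\<close> and bounded measurable \<open>a, f, h\<close>, every term is integrable by the Sobolev inequality.
  Since \<open>0 powr s = 0\<close>, the terms \<open>|t|\<^bsup>s\<^esup> t\<close> vanish at \<open>t = 0\<close> also for \<open>s \<le> 0\<close>, as they should.
\<close>

definition is_solution ::
  "(real^'n) set \<Rightarrow> real \<Rightarrow> real \<Rightarrow> (real^'n \<Rightarrow> real) \<Rightarrow> (real^'n \<Rightarrow> real) \<Rightarrow> (real^'n \<Rightarrow> real)
    \<Rightarrow> (real^'n \<Rightarrow> real) \<Rightarrow> bool" where
  "is_solution \<Omega> p q a f h u \<longleftrightarrow>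
     u \<in> sobolev_W0 \<Omega> p \<and>
     (\<exists>G. has_weak_gradient \<Omega> u G \<and>
       (\<forall>\<phi>. test_function \<Omega> \<phi> \<longrightarrow>
         (\<integral>x. (norm (G x) powr (p - 2) *\<^sub>R G x) \<bullet> grad \<phi> x
              + a x * \<bar>u x\<bar> powr (p - 2) * u x * \<phi> x \<partial>lebesgue_on \<Omega>)
       = (\<integral>x. (f x * \<bar>u x\<bar> powr (crit_exp CARD('n) p - 2) * u x
              + h x * \<bar>u x\<bar> powr (q - 1) * u x) * \<phi> x \<partial>lebesgue_on \<Omega>)))"

text \<open>Change of sign is understood modulo null sets, as \<open>u\<close> represents a class.\<close>

definition changes_sign :: "(real^'n) set \<Rightarrow> (real^'n \<Rightarrow> real) \<Rightarrow> bool" where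
  "changes_sign \<Omega> u \<longleftrightarrow>
     \<not> (AE x in lebesgue_on \<Omega>. u x \<ge> 0) \<and> \<not> (AE x in lebesgue_on \<Omega>. u x \<le> 0)"

end

theory Submission
  imports Defs
begin

text \<open>
  No regularity theory for \<open>\<Delta>\<^sub>p\<close> is needed: only an inequality of the Pohozaev type is used, and it
  holds for weak solutions.  For \<open>c > 1\<close> the dilation \<open>u\<^sub>c(x) = u(c x)\<close> vanishes outside
  \<open>\<Omega> / c \<subseteq> \<Omega>\<close>, so \<open>u\<^sub>c - u\<close> is an admissible test function.  Convexity bounds the left-hand side of the
  equation by \<open>(\<integral>|\<nabla>u\<^sub>c|\<^sup>p - \<integral>|\<nabla>u|\<^sup>p) / p = (c\<^bsup>p-n\<^esup> - 1) / p * \<integral>|\<nabla>u|\<^sup>p\<close> from above, and, thanks to the signs of \<open>a\<close>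
  and \<open>h\<close>, their terms by differences of integrals of \<open>a |u|\<^sup>p\<close> and \<open>h |u|\<^bsup>q+1\<^esup>\<close> in the other direction.  Where
  \<open>f > 0\<close>, convexity fails by at most a multiple of \<open>(|u| + |u\<^sub>c|)\<^bsup>p*-1-\<delta>\<^esup> |u\<^sub>c - u|\<^bsup>1+\<delta>\<^esup>\<close>, whose integral is
  \<open>o(c - 1)\<close> because \<open>\<parallel>u\<^sub>c - u\<parallel>\<^sub>p = O(c - 1)\<close> and \<open>u\<close> belongs to every \<open>L\<^sup>r\<close>; the latter is the argument of
  Brezis and Kato.  Dividing by \<open>c - 1\<close> and letting \<open>c \<longlongrightarrow> 1\<close> yields a sum of nonnegative terms that is at most
  \<open>0\<close>, so each term vanishes, and the one with the strict inequality forces \<open>u = 0\<close>.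
\<close>

section \<open>The Sobolev inequality\<close>

text \<open>Only \<open>c > 1\<close> is available, since for \<open>c < 1\<close> the support could
  leave \<Omega>; hence an inequality comes out and not an identity. What is lost is the boundary
  term of the classical identity, which has a favourable sign on a star-shaped domain. The remainder
  must beat \<open>c - 1\<close>: Hoelder turns the rate \<open>c - 1\<close> in \<open>L^p\<close>
  into \<open>(c - 1) powr (1 + \<delta>)\<close>, where \<open>\<delta> > 0\<close> is possible
  because \<open>p > 1\<close>, at the price of a power of \<open>u\<close> that may exceed the
  critical one. The critical exponent enters when the equation is also tested with \<open>u\<close>
  itself: the integral of \<open>f |u|^p*\<close> then cancels from the limit, and
  \<open>\<kappa> * H - A\<close> remains, where \<open>H\<close> and \<open>A\<close> are the
  integrals of \<open>h |u|^(q+1)\<close> and \<open>a |u|^p\<close>, so that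
  \<open>H \<le> 0 \<le> A\<close>, and \<open>\<kappa> > 0\<close> expresses that
  \<open>q + 1\<close> is subcritical. On the other side stand the increments of the weights along
  rays, all nonnegative. The powers of \<open>u\<close> in the Brezis-Kato argument are cut off
  smoothly, with bounded derivative, so that composition maps test functions to test
  functions.\<close>

text \<open>Powers of extended nonnegative reals allow Hoelder and Sobolev to be stated without
  integrability hypotheses. The values at \<open>0\<close> and \<open>top\<close> are those of a
  positive exponent, the case that occurs below.\<close>

definition epow :: "ennreal \<Rightarrow> real \<Rightarrow> ennreal" where
  "epow x r = (if x = top then top else ennreal (enn2real x powr r))"

lemma epow_ennreal: "0 \<le> a \<Longrightarrow> epow (ennreal a) r = ennreal (a powr r)"
  by (simp add: epow_def)

lemma epow_top [simp]: "epow top r = top"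
  by (simp add: epow_def)

lemma epow_0 [simp]: "epow 0 r = 0"
  by (simp add: epow_def)

lemma epow_one [simp]: "epow x 1 = x"
  by (cases x) (auto simp: epow_ennreal)

lemma epow_1 [simp]: "epow 1 r = 1"
  using epow_ennreal[of 1 r] by simp

lemma epow_eq_0_iff [simp]: "epow x r = 0 \<longleftrightarrow> x = 0"
  by (cases x) (auto simp: epow_ennreal ennreal_eq_0_iff)

lemma epow_eq_top_iff [simp]: "epow x r = top \<longleftrightarrow> x = top"
  by (cases x) (auto simp: epow_ennreal)

lemma epow_less_top_iff [simp]: "epow x r < top \<longleftrightarrow> x < top"
  by (simp flip: less_top)

lemma epow_measurable [measurable]:
  "f \<in> borel_measurable M \<Longrightarrow> (\<lambda>x. epow (f x) r) \<in> borel_measurable M"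
proof -
  assume f: "f \<in> borel_measurable M"
  have "(\<lambda>x. epow x r) \<in> borel_measurable borel"
    unfolding epow_def by (intro measurable_If) auto
  from measurable_compose[OF f this] show ?thesis .
qed

lemma epow_mono: "0 \<le> r \<Longrightarrow> x \<le> y \<Longrightarrow> epow x r \<le> epow y r"
  by (cases x; cases y) (auto simp: epow_ennreal top_unique intro!: ennreal_leI powr_mono2)

lemma epow_mult: "0 < r \<Longrightarrow> epow (x * y) r = epow x r * epow y r"
proof (cases "x = top \<or> y = top")
  case True
  then show ?thesis
    by (auto simp: ennreal_top_mult ennreal_mult_top)
next
  case False
  then show ?thesis
    by (cases x; cases y) (auto simp: epow_ennreal powr_mult simp flip: ennreal_mult)
qed

lemma epow_add: "0 < r \<Longrightarrow> 0 < s \<Longrightarrow> epow x (r + s) = epow x r * epow x s"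
  by (cases x) (auto simp: epow_ennreal powr_add ennreal_top_mult simp flip: ennreal_mult)

lemma epow_epow: "epow (epow x r) s = epow x (r * s)"
  by (cases x) (auto simp: epow_ennreal powr_powr)

lemma prod_epow_const: "finite I \<Longrightarrow> 0 < r \<Longrightarrow> I \<noteq> {} \<Longrightarrow> (\<Prod>i\<in>I. epow x r) = epow x (real (card I) * r)"
proof (induction I rule: finite_induct)
  case (insert i I)
  show ?case
  proof (cases "I = {}")
    case False
    then have "real (card I) * r > 0" using insert by (simp add: card_gt_0_iff)
    then show ?thesis using insert False
      by (auto simp: algebra_simps epow_add)
  qed simp
qed auto

section \<open>Hoelder inequalities and the Loomis-Whitney inequality\<close>

text \<open>Once every factor is divided by its integral, the arithmetic-geometric mean inequality
  bounds the product by an average whose integral is 1. Zero and infinite integrals are treated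
  apart because they do not permit this normalisation.\<close>

lemma nn_integral_epow_prod_le:
  fixes f :: "'i \<Rightarrow> 'a \<Rightarrow> ennreal"
  assumes I: "finite I" "I \<noteq> {}" and [measurable]: "\<And>i. i \<in> I \<Longrightarrow> f i \<in> borel_measurable M"
  shows "(\<integral>\<^sup>+x. (\<Prod>i\<in>I. epow (f i x) (1 / card I)) \<partial>M) \<le> (\<Prod>i\<in>I. epow (\<integral>\<^sup>+x. f i x \<partial>M) (1 / card I))"
proof -
  define N where "N = card I"
  have N: "real N > 0" using I by (simp add: N_def card_gt_0_iff)
  define X where "X i = (\<integral>\<^sup>+x. f i x \<partial>M)" for i
  consider (zero) i where "i \<in> I" "X i = 0" | (top) i where "i \<in> I" "X i = top" "\<forall>i\<in>I. X i \<noteq> 0"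
    | (fin) "\<forall>i\<in>I. X i \<noteq> 0 \<and> X i \<noteq> top" by blast
  then show ?thesis
  proof cases
    case zero
    then have "AE x in M. f i x = 0"
      using nn_integral_0_iff_AE[of "f i" M] by (auto simp: X_def)
    then have "AE x in M. (\<Prod>i\<in>I. epow (f i x) (1 / card I)) = 0"
      by eventually_elim (use zero I in \<open>auto intro!: prod_zero bexI[of _ i]\<close>)
    then have "(\<integral>\<^sup>+x. (\<Prod>i\<in>I. epow (f i x) (1 / card I)) \<partial>M) = (\<integral>\<^sup>+x. 0 \<partial>M)"
      by (rule nn_integral_cong_AE)
    then show ?thesis by simp
  next
    case top
    then have "(\<Prod>i\<in>I. epow (X i) (1 / card I)) = top"
      using I by (subst ennreal_prod_eq_top) auto
    then show ?thesis by (simp add: X_def)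
  next
    case fin
    define c where "c i = enn2real (X i)" for i
    have c: "c i > 0" "X i = ennreal (c i)" if "i \<in> I" for i
      using fin that by (cases "X i"; auto simp: c_def order_less_le)+
    have le: "(\<Prod>i\<in>I. epow (f i x) (1 / N)) \<le> (\<Prod>i\<in>I. epow (X i) (1 / N)) * (\<Sum>i\<in>I. f i x * ennreal (1 / (c i * N)))" for x
    proof (cases "\<exists>i\<in>I. f i x = top")
      case True
      then obtain i where i: "i \<in> I" "f i x = top" by auto
      have "c i * N > 0" using c i N by auto
      then have "(\<Sum>i\<in>I. f i x * ennreal (1 / (c i * N))) = top"
        using I i by (subst ennreal_sum_eq_top) (auto simp: ennreal_top_mult ennreal_eq_0_iff not_le intro!: bexI[of _ i])
      moreover have "(\<Prod>i\<in>I. epow (X i) (1 / N)) \<noteq> 0" using fin I by auto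
      ultimately have "(\<Prod>i\<in>I. epow (X i) (1 / N)) * (\<Sum>i\<in>I. f i x * ennreal (1 / (c i * N))) = top"
        by (subst ennreal_mult_eq_top_iff) auto
      then show ?thesis by simp
    next
      case False
      define a where "a i = enn2real (f i x)" for i
      have a: "a i \<ge> 0" "f i x = ennreal (a i)" if "i \<in> I" for i
        using False that by (cases "f i x"; auto simp: a_def)+
      have "(\<Prod>i\<in>I. a i powr (1 / N)) = (\<Prod>i\<in>I. c i powr (1 / N)) * (\<Prod>i\<in>I. (a i / c i) powr (1 / N))"
        unfolding prod.distrib[symmetric] using a c by (intro prod.cong refl) (simp add: powr_divide less_imp_le less_imp_neq[THEN not_sym])
      also have "(\<Prod>i\<in>I. (a i / c i) powr (1 / N)) = (\<Prod>i\<in>I. a i / c i) powr (1 / N)"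
        using a c by (simp add: prod_powr_distrib less_imp_le)
      also have "\<dots> \<le> (\<Sum>i\<in>I. a i / c i / N)"
        unfolding N_def using I a c by (intro arith_geom_mean) (auto simp: less_imp_le)
      finally have *: "(\<Prod>i\<in>I. a i powr (1 / N)) \<le> (\<Prod>i\<in>I. c i powr (1 / N)) * (\<Sum>i\<in>I. a i * (1 / (c i * N)))"
        using c by (simp add: mult_left_mono prod_nonneg)
      have "(\<Prod>i\<in>I. epow (f i x) (1 / N)) = ennreal (\<Prod>i\<in>I. a i powr (1 / N))"
        using a by (simp add: epow_ennreal prod_ennreal)
      also have "\<dots> \<le> ennreal ((\<Prod>i\<in>I. c i powr (1 / N)) * (\<Sum>i\<in>I. a i * (1 / (c i * N))))"
        using * by (rule ennreal_leI)
      also have "\<dots> = (\<Prod>i\<in>I. ennreal (c i powr (1 / N))) * (\<Sum>i\<in>I. ennreal (a i * (1 / (c i * N))))"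
        using a c N by (simp add: ennreal_mult prod_nonneg sum_nonneg prod_ennreal sum_ennreal less_imp_le)
      also have "\<dots> = (\<Prod>i\<in>I. epow (X i) (1 / N)) * (\<Sum>i\<in>I. f i x * ennreal (1 / (c i * N)))"
        using a c N by (intro arg_cong2[where f="(*)"] prod.cong sum.cong refl) (auto simp: epow_ennreal less_imp_le ennreal_mult simp del: times_divide_eq_right)
      finally show ?thesis .
    qed
    have "(\<integral>\<^sup>+x. (\<Prod>i\<in>I. epow (f i x) (1 / N)) \<partial>M) \<le>
        (\<integral>\<^sup>+x. (\<Prod>i\<in>I. epow (X i) (1 / N)) * (\<Sum>i\<in>I. f i x * ennreal (1 / (c i * N))) \<partial>M)"
      by (intro nn_integral_mono le)
    also have "\<dots> = (\<Prod>i\<in>I. epow (X i) (1 / N)) * (\<Sum>i\<in>I. X i * ennreal (1 / (c i * N)))"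
      by (simp add: nn_integral_cmult nn_integral_sum nn_integral_multc X_def)
    also have "(\<Sum>i\<in>I. X i * ennreal (1 / (c i * N))) = (\<Sum>i\<in>I. ennreal (1 / N))"
    proof (intro sum.cong refl)
      fix i assume "i \<in> I"
      then have "c i * (1 / (c i * N)) = 1 / N" "X i = ennreal (c i)" "c i \<ge> 0" using c[of i] by auto
      then show "X i * ennreal (1 / (c i * N)) = ennreal (1 / N)"
        by (metis ennreal_mult')
    qed
    also have "\<dots> = 1"
    proof -
      have "(\<Sum>i\<in>I. ennreal (1 / N)) = ennreal (\<Sum>i\<in>I. 1 / N)" by (rule sum_ennreal) simp
      then show ?thesis using N by (simp add: N_def)
    qed
    finally show ?thesis by (simp add: N_def X_def)
  qed
qed

lemma nn_integral_Holder:
  assumes [measurable]: "f \<in> borel_measurable M" "g \<in> borel_measurable M"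
    and ab: "0 < \<alpha>" "0 < \<beta>" "\<alpha> + \<beta> = 1"
  shows "(\<integral>\<^sup>+x. epow (f x) \<alpha> * epow (g x) \<beta> \<partial>M) \<le> epow (\<integral>\<^sup>+x. f x \<partial>M) \<alpha> * epow (\<integral>\<^sup>+x. g x \<partial>M) \<beta>"
proof -
  define X where "X = (\<integral>\<^sup>+x. f x \<partial>M)"
  define Y where "Y = (\<integral>\<^sup>+x. g x \<partial>M)"
  consider (zero) "X = 0 \<or> Y = 0" | (top) "X \<noteq> 0" "Y \<noteq> 0" "X = top \<or> Y = top"
    | (fin) "X \<noteq> 0" "Y \<noteq> 0" "X \<noteq> top" "Y \<noteq> top" by blast
  then show ?thesis
  proof cases
    case zero
    then have "AE x in M. f x = 0 \<or> g x = 0"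
      using nn_integral_0_iff_AE[of f M] nn_integral_0_iff_AE[of g M] by (auto simp: X_def Y_def)
    then have "AE x in M. epow (f x) \<alpha> * epow (g x) \<beta> = 0"
      by eventually_elim auto
    then have "(\<integral>\<^sup>+x. epow (f x) \<alpha> * epow (g x) \<beta> \<partial>M) = (\<integral>\<^sup>+x. 0 \<partial>M)"
      by (rule nn_integral_cong_AE)
    then show ?thesis by simp
  next
    case top
    then show ?thesis
      unfolding X_def[symmetric] Y_def[symmetric] by (auto simp: ennreal_top_mult ennreal_mult_top)
  next
    case fin
    define a where "a = enn2real X"
    define b where "b = enn2real Y"
    have a: "a > 0" "X = ennreal a" and b: "b > 0" "Y = ennreal b"
      using fin by (cases X; cases Y; auto simp: a_def b_def order_less_le)+
    have le: "epow (f x) \<alpha> * epow (g x) \<beta> \<le> epow X \<alpha> * epow Y \<beta> * (f x * ennreal (\<alpha> / a) + g x * ennreal (\<beta> / b))" for x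
    proof (cases "f x = 0 \<or> g x = 0")
      case False
      show ?thesis
      proof (cases "f x = top \<or> g x = top")
        case True
        moreover have "\<alpha> / a > 0" "\<beta> / b > 0" using ab a b by auto
        ultimately have "f x * ennreal (\<alpha> / a) + g x * ennreal (\<beta> / b) = top"
          by (auto simp: ennreal_top_mult ennreal_mult_top ennreal_eq_0_iff)
        moreover have "epow X \<alpha> * epow Y \<beta> \<noteq> 0" using fin by auto
        ultimately have "epow X \<alpha> * epow Y \<beta> * (f x * ennreal (\<alpha> / a) + g x * ennreal (\<beta> / b)) = top"
          by (subst ennreal_mult_eq_top_iff) auto
        then show ?thesis by simp
      next
        case F: False
        define u where "u = enn2real (f x)"
        define v where "v = enn2real (g x)"
        have u: "u > 0" "f x = ennreal u" and v: "v > 0" "g x = ennreal v"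
          using F False by (cases "f x"; cases "g x"; auto simp: u_def v_def order_less_le)+
        have "u powr \<alpha> * v powr \<beta> = a powr \<alpha> * b powr \<beta> * ((u / a) powr \<alpha> * (v / b) powr \<beta>)"
          using a b u v by (simp add: powr_divide)
        also have "\<dots> \<le> a powr \<alpha> * b powr \<beta> * (\<alpha> * (u / a) + \<beta> * (v / b))"
          using a b u v ab by (intro mult_left_mono Youngs_inequality_0) auto
        finally have "ennreal (u powr \<alpha> * v powr \<beta>) \<le> ennreal (a powr \<alpha> * b powr \<beta> * (u * (\<alpha> / a) + v * (\<beta> / b)))"
          by (intro ennreal_leI) (simp add: mult.commute)
        moreover have "f x * ennreal (\<alpha> / a) + g x * ennreal (\<beta> / b) = ennreal (u * (\<alpha> / a) + v * (\<beta> / b))"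
          using a b u v ab by (simp add: ennreal_mult del: times_divide_eq_right)
        ultimately show ?thesis
          using a b u v ab by (simp add: epow_ennreal ennreal_mult del: times_divide_eq_right)
      qed
    qed auto
    have "(\<integral>\<^sup>+x. epow (f x) \<alpha> * epow (g x) \<beta> \<partial>M) \<le> (\<integral>\<^sup>+x. epow X \<alpha> * epow Y \<beta> * (f x * ennreal (\<alpha> / a) + g x * ennreal (\<beta> / b)) \<partial>M)"
      by (intro nn_integral_mono le)
    also have "\<dots> = epow X \<alpha> * epow Y \<beta> * (X * ennreal (\<alpha> / a) + Y * ennreal (\<beta> / b))"
      by (simp add: nn_integral_cmult nn_integral_add nn_integral_multc X_def Y_def)
    also have "X * ennreal (\<alpha> / a) + Y * ennreal (\<beta> / b) = 1"
      using a b ab by (auto simp: less_imp_le simp flip: ennreal_mult ennreal_plus)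
    finally show ?thesis by (simp add: X_def Y_def)
  qed
qed


text \<open>Loomis--Whitney, integrating out one coordinate of \<open>J\<close> at a time: the factor that does not
  depend on the new coordinate comes out of the integral, Hoelder treats the \<open>N\<close> others.\<close>

lemma Loomis_Whitney_partial:
  fixes F :: "'i \<Rightarrow> ('i \<Rightarrow> real) \<Rightarrow> ennreal"
  assumes "finite J" "J \<subseteq> K" "finite K" "card K = Suc N" "N > 0"
    and "\<And>i. i \<in> K \<Longrightarrow> F i \<in> borel_measurable (Pi\<^sub>M J (\<lambda>_. lborel))"
    and "\<And>i x t. i \<in> J \<Longrightarrow> F i (x(i := t)) = F i x"
  shows "(\<integral>\<^sup>+x. (\<Prod>i\<in>K. epow (F i x) (1 / N)) \<partial>Pi\<^sub>M J (\<lambda>_. lborel))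
    \<le> (\<Prod>i\<in>K. epow (\<integral>\<^sup>+x. F i x \<partial>Pi\<^sub>M (J - {i}) (\<lambda>_. lborel)) (1 / N))"
  using assms(1,2,6,7)
proof (induction J arbitrary: F rule: finite_induct)
  case empty
  show ?case by (simp add: nn_integral_count_space_finite PiM_empty)
next
  case (insert j J)
  interpret product_sigma_finite "\<lambda>_::'i. lborel :: real measure" by standard
  let ?M = "\<lambda>J. Pi\<^sub>M J (\<lambda>_::'i. lborel :: real measure)"
  note meas = insert.prems(2)
  have jK: "j \<in> K" and JK: "J \<subseteq> K" using insert.prems by auto
  have upd: "(\<lambda>x. x(j := t)) \<in> ?M J \<rightarrow>\<^sub>M ?M (insert j J)" for t
    by (rule measurable_fun_upd[where J=J]) auto
  have meas1: "(\<lambda>x. F i (x(j := t))) \<in> borel_measurable (?M J)" if "i \<in> K" for i t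
    using measurable_compose[OF upd meas[OF that]] .
  have Fj: "F j (x(j := t)) = F j x" for x t by (rule insert.prems(3)) simp
  define c where "c = (\<integral>\<^sup>+x. F j x \<partial>?M J)"
  define H where "H i t = (\<integral>\<^sup>+x. F i (x(j := t)) \<partial>?M (J - {i}))" for i t
  have upd2: "(\<lambda>(t, x). x(j := t)) \<in> lborel \<Otimes>\<^sub>M ?M (J - {i}) \<rightarrow>\<^sub>M ?M (insert j (J - {i}))" for i
    unfolding split_beta'
    by (rule measurable_fun_upd[where J="J - {i}"]) (auto simp: measurable_snd measurable_fst)
  \<comment> \<open>For \<open>i\<close> in \<open>J\<close>, \<open>F i\<close> does not depend on
    coordinate \<open>i\<close>; freezing that coordinate at 0 exhibits \<open>F i\<close> as
    measurable in the remaining ones.\<close>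
  have restr: "F i \<in> borel_measurable (?M (insert j (J - {i})))" if "i \<in> K" "i \<noteq> j" for i
  proof (cases "i \<in> J")
    case True
    have *: "(\<lambda>x. x(i := 0)) \<in> ?M (insert j (J - {i})) \<rightarrow>\<^sub>M ?M (insert j J)"
      by (rule measurable_fun_upd[where J="insert j (J - {i})"]) (use True in auto)
    have "(\<lambda>x. F i (x(i := 0))) = F i" using True by (intro ext insert.prems(3)) auto
    then show ?thesis using measurable_compose[OF * meas[OF that(1)]] by metis
  next
    case False
    then show ?thesis using meas that by simp
  qed
  have Hm: "H i \<in> borel_measurable lborel" if "i \<in> K" "i \<noteq> j" for i
  proof -
    interpret S: sigma_finite_measure "?M (J - {i})" by (rule sigma_finite) (use insert in auto)
    show ?thesis unfolding H_def
      using measurable_compose[OF upd2 restr[OF that]]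
      by (intro S.borel_measurable_nn_integral) (simp add: split_beta')
  qed
  have Hint: "(\<integral>\<^sup>+t. H i t \<partial>lborel) = (\<integral>\<^sup>+x. F i x \<partial>?M (insert j J - {i}))" if "i \<in> K" "i \<noteq> j" for i
  proof -
    have "insert j J - {i} = insert j (J - {i})" using that by auto
    then show ?thesis unfolding H_def
      using restr[OF that] insert by (simp add: product_nn_integral_insert_rev)
  qed
  have "(\<integral>\<^sup>+x. (\<Prod>i\<in>K. epow (F i x) (1 / N)) \<partial>?M (insert j J)) =
      (\<integral>\<^sup>+t. (\<integral>\<^sup>+x. (\<Prod>i\<in>K. epow (F i (x(j := t))) (1 / N)) \<partial>?M J) \<partial>lborel)"
    by (rule product_nn_integral_insert_rev) (use insert meas in auto)
  also have "\<dots> \<le> (\<integral>\<^sup>+t. (\<Prod>i\<in>K. epow (\<integral>\<^sup>+x. F i (x(j := t)) \<partial>?M (J - {i})) (1 / N)) \<partial>lborel)"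
  proof (intro nn_integral_mono insert.IH)
    fix i x t s assume "i \<in> J"
    then have "i \<noteq> j" using insert by auto
    then show "F i ((x(i := s))(j := t)) = F i (x(j := t))"
      using insert.prems(3)[of i "x(j := t)" s] \<open>i \<in> J\<close> by (metis fun_upd_twist insertI2)
  next
    fix i t assume "i \<in> K"
    then show "(\<lambda>x. F i (x(j := t))) \<in> borel_measurable (?M J)" by (rule meas1)
  qed (use JK in auto)
  also have "\<dots> = (\<integral>\<^sup>+t. epow c (1 / N) * (\<Prod>i\<in>K - {j}. epow (H i t) (1 / N)) \<partial>lborel)"
    using \<open>finite K\<close> jK insert.hyps
    by (intro nn_integral_cong) (simp add: prod.remove[of K j] Fj c_def H_def)
  also have "\<dots> = epow c (1 / N) * (\<integral>\<^sup>+t. (\<Prod>i\<in>K - {j}. epow (H i t) (1 / N)) \<partial>lborel)"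
    using Hm by (intro nn_integral_cmult borel_measurable_prod_ennreal epow_measurable) auto
  also have "\<dots> \<le> epow c (1 / N) * (\<Prod>i\<in>K - {j}. epow (\<integral>\<^sup>+t. H i t \<partial>lborel) (1 / N))"
  proof (rule mult_left_mono)
    have N: "card (K - {j}) = N" using jK assms by simp
    then have "K - {j} \<noteq> {}" using \<open>N > 0\<close> by (metis card.empty less_irrefl)
    then show "(\<integral>\<^sup>+t. (\<Prod>i\<in>K - {j}. epow (H i t) (1 / N)) \<partial>lborel)
        \<le> (\<Prod>i\<in>K - {j}. epow (\<integral>\<^sup>+t. H i t \<partial>lborel) (1 / N))"
      using nn_integral_epow_prod_le[of "K - {j}" H lborel] Hm \<open>finite K\<close> N by auto
  qed auto
  also have "\<dots> = (\<Prod>i\<in>K. epow (\<integral>\<^sup>+x. F i x \<partial>?M (insert j J - {i})) (1 / N))"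
    using \<open>finite K\<close> jK insert.hyps by (simp add: prod.remove[of K j] Hint c_def)
  finally show ?case .
qed

section \<open>From line integrals to the Sobolev inequality\<close>

lemma lborel_nn_integral_translate:
  fixes f :: "'a::euclidean_space \<Rightarrow> ennreal"
  assumes [measurable]: "f \<in> borel_measurable borel"
  shows "(\<integral>\<^sup>+x. f (a + x) \<partial>lborel) = (\<integral>\<^sup>+x. f x \<partial>lborel)"
proof -
  have "(\<integral>\<^sup>+x. f x \<partial>lborel) = (\<integral>\<^sup>+x. f x \<partial>distr lborel borel ((+) a))"
    by (simp add: lborel_distr_plus)
  then show ?thesis by (simp add: nn_integral_distr)
qed

text \<open>\<open>F b\<close> integrates \<open>D b\<close> over the whole line in direction
  \<open>b\<close>: it dominates \<open>V\<close> and is independent of that coordinate, which is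
  the situation of Loomis-Whitney. \<open>T\<close> translates between points and their coordinate
  functions.\<close>

lemma Gagliardo_Nirenberg_aux:
  fixes V :: "'a::euclidean_space \<Rightarrow> ennreal" and D :: "'a \<Rightarrow> 'a \<Rightarrow> ennreal"
  assumes V[measurable]: "V \<in> borel_measurable borel"
    and D[measurable]: "\<And>b. b \<in> Basis \<Longrightarrow> D b \<in> borel_measurable borel"
    and dim: "DIM('a) \<ge> 2"
    and le: "\<And>x b. b \<in> Basis \<Longrightarrow> V x \<le> (\<integral>\<^sup>+t. D b (x + t *\<^sub>R b) \<partial>lborel)"
  shows "(\<integral>\<^sup>+x. epow (V x) (DIM('a) / real (DIM('a) - 1)) \<partial>lborel)
    \<le> (\<Prod>b\<in>Basis. epow (\<integral>\<^sup>+x. D b x \<partial>lborel) (1 / real (DIM('a) - 1)))"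
proof -
  interpret product_sigma_finite "\<lambda>_::'a. lborel :: real measure" by standard
  define N where "N = DIM('a) - 1"
  have N: "N > 0" "DIM('a) = Suc N" using dim by (auto simp: N_def)
  define M where "M J = Pi\<^sub>M J (\<lambda>_::'a. lborel :: real measure)" for J
  define T :: "('a \<Rightarrow> real) \<Rightarrow> 'a" where "T f = (\<Sum>b\<in>Basis. f b *\<^sub>R b)" for f
  have T[measurable]: "T \<in> M Basis \<rightarrow>\<^sub>M borel"
    unfolding T_def M_def by measurable
  have lb: "lborel = distr (M Basis) borel T"
    unfolding M_def T_def by (rule lborel_eq)
  define F where "F b f = (\<integral>\<^sup>+s. D b (T (f(b := s))) \<partial>lborel)" for b f
  have Tupd: "T (f(b := s)) = T f + (s - f b) *\<^sub>R b" if "b \<in> Basis" for f b s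
  proof -
    have "T (f(b := s)) = s *\<^sub>R b + (\<Sum>b\<in>Basis - {b}. f b *\<^sub>R b)"
      using that by (simp add: T_def sum.remove[of Basis b])
    also have "\<dots> = T f + (s - f b) *\<^sub>R b"
      using that by (simp add: T_def sum.remove[of Basis b] algebra_simps)
    finally show ?thesis .
  qed
  have Dm: "(\<lambda>s. D b (y + (s - r) *\<^sub>R b)) \<in> borel_measurable borel" if "b \<in> Basis" for b y and r :: real
    using that by measurable
  have VF: "V (T f) \<le> F b f" if b: "b \<in> Basis" for b f
  proof -
    have "F b f = (\<integral>\<^sup>+s. D b (T f + (s - f b) *\<^sub>R b) \<partial>lborel)"
      by (simp add: F_def Tupd b)
    also have "\<dots> = (\<integral>\<^sup>+t. D b (T f + t *\<^sub>R b) \<partial>lborel)"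
      using lborel_nn_integral_translate[OF Dm[OF b, of "T f" "f b"], of "f b"] by simp
    finally show ?thesis using le[OF b] by simp
  qed
  have Findep: "F b (f(b := s)) = F b f" for b f s
    by (simp add: F_def)
  have Fm: "F b \<in> borel_measurable (M Basis)" if b: "b \<in> Basis" for b
  proof -
    have *: "(\<lambda>(f, s). f(b := s)) \<in> M Basis \<Otimes>\<^sub>M lborel \<rightarrow>\<^sub>M M Basis"
      unfolding split_beta' M_def
      by (rule measurable_fun_upd[where J="Basis"]) (use b in \<open>auto simp: measurable_snd measurable_fst\<close>)
    have "(\<lambda>(f, s). D b (T (f(b := s)))) \<in> borel_measurable (M Basis \<Otimes>\<^sub>M lborel)"
      using measurable_compose[OF * measurable_compose[OF T D[OF b]]] by (simp add: split_beta')
    then show ?thesis unfolding F_def by (rule lborel.borel_measurable_nn_integral)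
  qed
  have Fint: "(\<integral>\<^sup>+f. F b f \<partial>M (Basis - {b})) = (\<integral>\<^sup>+x. D b x \<partial>lborel)" if b: "b \<in> Basis" for b
  proof -
    have "(\<integral>\<^sup>+x. D b x \<partial>lborel) = (\<integral>\<^sup>+f. D b (T f) \<partial>M Basis)"
      using b by (simp add: lb nn_integral_distr)
    also have "Basis = insert b (Basis - {b})" using b by auto
    also have "(\<integral>\<^sup>+f. D b (T f) \<partial>M (insert b (Basis - {b}))) = (\<integral>\<^sup>+f. F b f \<partial>M (Basis - {b}))"
      unfolding M_def F_def
      by (rule product_nn_integral_insert) (use b measurable_compose[OF T D[OF b]] in \<open>auto simp: M_def insert_absorb\<close>)
    finally show ?thesis by simp
  qed
  have "(\<integral>\<^sup>+x. epow (V x) (DIM('a) / N) \<partial>lborel) = (\<integral>\<^sup>+f. epow (V (T f)) (DIM('a) / N) \<partial>M Basis)"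
    by (simp add: lb nn_integral_distr)
  \<comment> \<open>One factor with exponent \<open>1 / N\<close> for each of the
    \<open>N + 1\<close> directions.\<close>
  also have "\<dots> = (\<integral>\<^sup>+f. (\<Prod>b\<in>(Basis::'a set). epow (V (T f)) (1 / N)) \<partial>M Basis)"
    using N by (subst prod_epow_const) auto
  also have "\<dots> \<le> (\<integral>\<^sup>+f. (\<Prod>b\<in>Basis. epow (F b f) (1 / N)) \<partial>M Basis)"
    by (intro nn_integral_mono prod_mono_ennreal epow_mono VF) auto
  also have "\<dots> \<le> (\<Prod>b\<in>Basis. epow (\<integral>\<^sup>+f. F b f \<partial>M (Basis - {b})) (1 / N))"
    unfolding M_def
    by (rule Loomis_Whitney_partial) (use N Fm Findep in \<open>auto simp: M_def\<close>)
  also have "\<dots> = (\<Prod>b\<in>Basis. epow (\<integral>\<^sup>+x. D b x \<partial>lborel) (1 / N))"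
    by (intro prod.cong refl) (simp add: Fint)
  finally show ?thesis unfolding N_def .
qed

text \<open>The odd extension of the power function. The nonlinearities of the equation are of this
  form, and \<open>r * spow (r - 1)\<close> is the derivative of the \<open>r\<close>-th power of
  the absolute value.\<close>

definition spow :: "real \<Rightarrow> real \<Rightarrow> real" where
  "spow r s = \<bar>s\<bar> powr (r - 1) * s"

lemma abs_spow: "\<bar>spow r s\<bar> = \<bar>s\<bar> powr r"
  by (cases "s = 0") (auto simp: spow_def abs_mult powr_diff)

lemma spow_mult_self: "spow r s * s = \<bar>s\<bar> powr (r + 1)"
proof -
  have "s * s = \<bar>s\<bar> powr 2" by (simp add: power2_eq_square)
  then have "spow r s * s = \<bar>s\<bar> powr (r - 1) * \<bar>s\<bar> powr 2"
    by (simp only: spow_def mult.assoc)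
  also have "\<dots> = \<bar>s\<bar> powr (r + 1)"
    using powr_add[of "\<bar>s\<bar>" "r - 1" 2] by (simp add: algebra_simps)
  finally show ?thesis .
qed

lemma spow_eq_if: "spow r s = (if 0 \<le> s then s powr r else - ((- s) powr r))"
  using powr_mult_base[of "\<bar>s\<bar>" "r - 1"] by (auto simp: spow_def abs_if mult.commute)

lemma continuous_on_spow: "0 < r \<Longrightarrow> continuous_on UNIV (spow r)"
proof -
  assume r: "0 < r"
  have "continuous_on ({0..} \<union> {..0}) (\<lambda>s::real. if 0 \<le> s then s powr r else - ((- s) powr r))"
  proof (intro continuous_on_cases)
    show "continuous_on {0..} (\<lambda>s::real. s powr r)"
      by (intro continuous_on_powr' continuous_intros) (use r in auto)
    show "continuous_on {..0} (\<lambda>s::real. - ((- s) powr r))"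
      by (intro continuous_on_powr' continuous_intros) (use r in auto)
  qed auto
  also have "{0..} \<union> {..0} = (UNIV::real set)" by auto
  finally show ?thesis by (simp add: spow_eq_if[abs_def])
qed

lemma borel_measurable_spow [measurable]: "spow r \<in> borel_measurable borel"
  unfolding spow_def[abs_def] by measurable

lemma DERIV_abs_powr:
  assumes "1 < r"
  shows "((\<lambda>s. \<bar>s\<bar> powr r) has_real_derivative r * spow (r - 1) s) (at s)"
proof -
  consider "s > 0" | "s < 0" | "s = 0" by linarith
  then show ?thesis
  proof cases
    case 1
    have "((\<lambda>s. s powr r) has_real_derivative r * spow (r - 1) s) (at s)"
      using 1 by (auto intro!: derivative_eq_intros simp: spow_eq_if)
    then show ?thesis
      by (rule DERIV_cong_ev[OF refl _ refl, THEN iffD1, rotated])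
        (use 1 in \<open>auto intro!: eventually_mono[OF eventually_nhds_in_open[of "{0<..}"]]\<close>)
  next
    case 2
    have "((\<lambda>s. (- s) powr r) has_real_derivative r * spow (r - 1) s) (at s)"
      using 2 by (auto intro!: derivative_eq_intros simp: spow_eq_if)
    then show ?thesis
      by (rule DERIV_cong_ev[OF refl _ refl, THEN iffD1, rotated])
        (use 2 in \<open>auto intro!: eventually_mono[OF eventually_nhds_in_open[of "{..<0}"]]\<close>)
  next
    case 3
    \<comment> \<open>At 0 the difference quotient of the power is \<open>spow (r - 1)\<close>
      itself, so its continuity there is all that is needed.\<close>
    have "(\<lambda>h::real. spow (r - 1) h) \<midarrow>0\<rightarrow> 0"
      using continuous_on_spow[of "r - 1"] assms
      by (auto simp: continuous_on_eq_continuous_at isCont_def spow_def dest!: spec[of _ 0])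
    moreover have "\<bar>h\<bar> powr r / h = spow (r - 1) h" for h :: real
    proof (cases "h = 0")
      case False
      have "\<bar>h\<bar> powr r = spow (r - 1) h * h" using spow_mult_self[of "r - 1" h] by simp
      then show ?thesis using False by simp
    qed (simp add: spow_def)
    ultimately have "(\<lambda>h. \<bar>h\<bar> powr r / h) \<midarrow>0\<rightarrow> 0" by simp
    then show ?thesis using 3 by (simp add: DERIV_def spow_def)
  qed
qed

lemma abs_le_nn_integral_DERIV:
  fixes g g' :: "real \<Rightarrow> real"
  assumes "\<And>t. (g has_real_derivative g' t) (at t)" "continuous_on UNIV g'" "g (- T) = 0" "T \<ge> 0"
  shows "ennreal \<bar>g 0\<bar> \<le> (\<integral>\<^sup>+t. ennreal \<bar>g' t\<bar> \<partial>lborel)"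
proof -
  have hb: "has_bochner_integral lborel (\<lambda>t. indicator {-T..0} t *\<^sub>R g' t) (g 0 - g (- T))"
    using assms by (intro has_bochner_integral_FTC_Icc)
      (auto simp: has_real_derivative_iff_has_vector_derivative[symmetric] intro: DERIV_subset continuous_on_subset)
  then have "g 0 = (\<integral>t. indicator {-T..0} t *\<^sub>R g' t \<partial>lborel)"
    using assms(3) by (simp add: has_bochner_integral_iff)
  then have "ennreal \<bar>g 0\<bar> \<le> (\<integral>\<^sup>+t. norm (indicator {-T..0} t *\<^sub>R g' t) \<partial>lborel)"
    using integral_norm_bound_ennreal hb by (metis has_bochner_integral_iff real_norm_def)
  also have "\<dots> \<le> (\<integral>\<^sup>+t. ennreal \<bar>g' t\<bar> \<partial>lborel)"
    by (intro nn_integral_mono) (auto simp: indicator_def)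
  finally show ?thesis .
qed

lemma nn_integral_compact_support_finite:
  fixes f :: "'a::euclidean_space \<Rightarrow> real"
  assumes "continuous_on UNIV f" "\<And>x. norm x \<ge> R \<Longrightarrow> f x = 0"
  shows "(\<integral>\<^sup>+x. ennreal (f x) \<partial>lborel) < \<infinity>"
proof -
  have "compact (f ` cball 0 R)"
    using assms(1) by (intro compact_continuous_image) (auto intro: continuous_on_subset)
  then obtain B where B: "\<And>x. x \<in> cball 0 R \<Longrightarrow> f x \<le> B"
    using compact_imp_bounded[of "f ` cball 0 R"] unfolding bounded_iff
    by (metis abs_le_D1 image_eqI real_norm_def)
  have "(\<integral>\<^sup>+x. ennreal (f x) \<partial>lborel) \<le> (\<integral>\<^sup>+x. ennreal B * indicator (cball (0::'a) R) x \<partial>lborel)"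
  proof (intro nn_integral_mono)
    fix x :: 'a show "ennreal (f x) \<le> ennreal B * indicator (cball 0 R) x"
      using B[of x] assms(2)[of x] by (cases "x \<in> cball 0 R") (auto intro: ennreal_leI)
  qed
  also have "\<dots> = ennreal B * emeasure lborel (cball (0::'a) R)"
    by (intro nn_integral_cmult_indicator) auto
  also have "\<dots> < \<infinity>"
    using emeasure_compact_finite[of "cball (0::'a) R"] by (auto simp: ennreal_mult_less_top)
  finally show ?thesis .
qed

text \<open>The bound by line integrals is applied to \<open>\<bar>v\<bar> powr \<gamma>\<close>.
  For this \<open>\<gamma>\<close> both \<open>\<gamma> * n / (n - 1)\<close> and
  \<open>(\<gamma> - 1) * p / (p - 1)\<close> equal the critical exponent, so Hoelder on the
  derivative returns the left-hand integral to a power below 1, which can be divided out.\<close>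

theorem Sobolev_inequality:
  fixes v :: "'a::euclidean_space \<Rightarrow> real" and G :: "'a \<Rightarrow> 'a" and p :: real
  defines "n \<equiv> real DIM('a)"
  defines "\<gamma> \<equiv> p * (n - 1) / (n - p)"
  assumes der: "\<And>x. (v has_derivative (\<lambda>h. G x \<bullet> h)) (at x)" and G: "continuous_on UNIV G"
    and supp: "\<And>x. norm x \<ge> R \<Longrightarrow> v x = 0"
    and p: "1 < p" "p < n"
  shows "(\<integral>\<^sup>+x. ennreal (\<bar>v x\<bar> powr (n * p / (n - p))) \<partial>lborel)
    \<le> epow (ennreal (\<gamma> powr p) * (\<integral>\<^sup>+x. ennreal (norm (G x) powr p) \<partial>lborel)) (n / (n - p))"
proof -
  have n: "n \<ge> 2" using p by (simp add: n_def)
  have np: "n - p > 0" using p by simp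
  have \<gamma>: "\<gamma> > 1" using p n np by (simp add: \<gamma>_def field_simps)
  define s where "s = n * p / (n - p)"
  have contv: "continuous_on UNIV v"
    using der by (meson continuous_at_imp_continuous_on has_derivative_continuous)
  have [measurable]: "v \<in> borel_measurable borel" "G \<in> borel_measurable borel"
    using contv G by (auto intro: borel_measurable_continuous_onI)
  define D where "D x = ennreal (\<gamma> * \<bar>v x\<bar> powr (\<gamma> - 1) * norm (G x))" for x
  have [measurable]: "D \<in> borel_measurable borel" unfolding D_def by measurable
  have line: "ennreal (\<bar>v x\<bar> powr \<gamma>) \<le> (\<integral>\<^sup>+t. D (x + t *\<^sub>R b) \<partial>lborel)" if b: "b \<in> Basis" for x b
  proof -
    define g where "g t = \<bar>v (x + t *\<^sub>R b)\<bar> powr \<gamma>" for t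
    define g' where "g' t = (\<gamma> * spow (\<gamma> - 1) (v (x + t *\<^sub>R b))) * (G (x + t *\<^sub>R b) \<bullet> b)" for t
    have dv: "((\<lambda>t. v (x + t *\<^sub>R b)) has_real_derivative (G (x + t *\<^sub>R b) \<bullet> b)) (at t)" for t
    proof -
      have "((\<lambda>t. x + t *\<^sub>R b) has_derivative (\<lambda>h. h *\<^sub>R b)) (at t)"
        by (auto intro!: derivative_eq_intros)
      from has_derivative_compose[OF this der]
      show ?thesis unfolding has_field_derivative_def
        by (rule has_derivative_eq_rhs) (auto simp: fun_eq_iff)
    qed
    have "(g has_real_derivative g' t) (at t)" for t
      unfolding g_def g'_def by (rule DERIV_chain2[OF DERIV_abs_powr[OF \<gamma>] dv])
    moreover have "continuous_on UNIV g'"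
      unfolding g'_def
      by (intro continuous_intros continuous_on_compose2[OF continuous_on_spow] continuous_on_compose2[OF contv]
          continuous_on_compose2[OF G]) (use \<gamma> in auto)
    \<comment> \<open>Far enough back along the line to be outside the support: the norm of that
      point is at least \<open>\<bar>R\<bar>\<close>.\<close>
    moreover have "g (- (norm x + \<bar>R\<bar>)) = 0"
    proof -
      have "norm (x + (- (norm x + \<bar>R\<bar>)) *\<^sub>R b) = norm ((norm x + \<bar>R\<bar>) *\<^sub>R b - x)"
        using norm_minus_commute[of x "(norm x + \<bar>R\<bar>) *\<^sub>R b"] by (simp only: scaleR_minus_left diff_conv_add_uminus)
      also have "\<dots> \<ge> norm ((norm x + \<bar>R\<bar>) *\<^sub>R b) - norm x"
        by (rule norm_triangle_ineq2)
      finally have "norm (x + (- (norm x + \<bar>R\<bar>)) *\<^sub>R b) \<ge> R" using b by simp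
      then show ?thesis using supp \<gamma> by (simp add: g_def)
    qed
    ultimately have "ennreal \<bar>g 0\<bar> \<le> (\<integral>\<^sup>+t. ennreal \<bar>g' t\<bar> \<partial>lborel)"
      by (intro abs_le_nn_integral_DERIV[where T="norm x + \<bar>R\<bar>"]) simp_all
    also have "\<dots> \<le> (\<integral>\<^sup>+t. D (x + t *\<^sub>R b) \<partial>lborel)"
      unfolding D_def g'_def
    proof (intro nn_integral_mono ennreal_leI)
      fix t
      have "\<bar>G (x + t *\<^sub>R b) \<bullet> b\<bar> \<le> norm (G (x + t *\<^sub>R b))" using b by (rule Basis_le_norm)
      then show "\<bar>\<gamma> * spow (\<gamma> - 1) (v (x + t *\<^sub>R b)) * (G (x + t *\<^sub>R b) \<bullet> b)\<bar>
          \<le> \<gamma> * \<bar>v (x + t *\<^sub>R b)\<bar> powr (\<gamma> - 1) * norm (G (x + t *\<^sub>R b))"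
        using \<gamma> by (simp add: abs_mult abs_spow mult_left_mono)
    qed
    finally show ?thesis by (simp add: g_def)
  qed
  define X where "X = (\<integral>\<^sup>+x. ennreal (\<bar>v x\<bar> powr s) \<partial>lborel)"
  define E where "E = (\<integral>\<^sup>+x. ennreal (norm (G x) powr p) \<partial>lborel)"
  have s0: "s > 0" using p n np by (simp add: s_def)
  \<comment> \<open>Finiteness comes from the compact support and is what permits division by a
    power of \<open>X\<close> at the end.\<close>
  have X: "X < top"
    unfolding X_def infinity_ennreal_def[symmetric]
    by (rule nn_integral_compact_support_finite[where R=R])
      (use contv s0 supp in \<open>auto intro!: continuous_on_powr' continuous_on_rabs continuous_on_const\<close>)
  have n1: "real (DIM('a) - 1) = n - 1" using n by (simp add: n_def)
  have \<gamma>n: "\<gamma> * (n / (n - 1)) = s" using n np by (simp add: \<gamma>_def s_def)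
  have "X = (\<integral>\<^sup>+x. epow (ennreal (\<bar>v x\<bar> powr \<gamma>)) (n / (n - 1)) \<partial>lborel)"
    unfolding X_def by (simp add: epow_ennreal powr_powr \<gamma>n del: times_divide_eq_right)
  also have "\<dots> \<le> (\<Prod>b\<in>(Basis::'a set). epow (\<integral>\<^sup>+x. D x \<partial>lborel) (1 / (n - 1)))"
    using Gagliardo_Nirenberg_aux[of "\<lambda>x. ennreal (\<bar>v x\<bar> powr \<gamma>)" "\<lambda>_. D"] line n
    unfolding n1 n_def[symmetric] by (auto simp: n_def)
  also have "\<dots> = epow (\<integral>\<^sup>+x. D x \<partial>lborel) (n / (n - 1))"
    using n by (subst prod_epow_const) (auto simp: n_def)
  finally have 1: "X \<le> epow (\<integral>\<^sup>+x. D x \<partial>lborel) (n / (n - 1))" .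
  have \<gamma>s: "\<gamma> - 1 = s * (1 - 1 / p)" using p np by (simp add: \<gamma>_def s_def field_simps)
  have "(\<integral>\<^sup>+x. D x \<partial>lborel) = ennreal \<gamma> * (\<integral>\<^sup>+x. epow (ennreal (\<bar>v x\<bar> powr s)) (1 - 1 / p) * epow (ennreal (norm (G x) powr p)) (1 / p) \<partial>lborel)"
    using \<gamma> p by (subst nn_integral_cmult[symmetric])
      (auto intro!: nn_integral_cong simp: D_def epow_ennreal powr_powr \<gamma>s ennreal_mult mult.assoc simp flip: \<gamma>s)
  also have "\<dots> \<le> ennreal \<gamma> * (epow X (1 - 1 / p) * epow E (1 / p))"
    unfolding X_def E_def using p by (intro mult_left_mono nn_integral_Holder) auto
  finally have 2: "(\<integral>\<^sup>+x. D x \<partial>lborel) \<le> ennreal \<gamma> * (epow X (1 - 1 / p) * epow E (1 / p))" .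
  have "X \<le> epow (ennreal \<gamma> * (epow X (1 - 1 / p) * epow E (1 / p))) (n / (n - 1))"
    using 1 epow_mono[OF _ 2, of "n / (n - 1)"] n by auto
  also have "\<dots> = epow X ((1 - 1 / p) * (n / (n - 1))) * epow (epow (ennreal (\<gamma> powr p) * E) (1 / p)) (n / (n - 1))"
    using n \<gamma> p by (simp add: epow_mult epow_epow epow_ennreal powr_powr mult_ac)
  finally have 3: "X \<le> epow X ((1 - 1 / p) * (n / (n - 1))) * epow (ennreal (\<gamma> powr p) * E) (1 / p * (n / (n - 1)))"
    by (simp only: epow_epow)
  have "X \<le> epow (ennreal (\<gamma> powr p) * E) (n / (n - p))"
  proof (cases "X = 0 \<or> ennreal (\<gamma> powr p) * E = top")
    case False
    define K where "K = enn2real (ennreal (\<gamma> powr p) * E)"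
    define x where "x = enn2real X"
    have K: "ennreal (\<gamma> powr p) * E = ennreal K" "K \<ge> 0"
      using False by (auto simp: K_def ennreal_enn2real less_top)
    have x: "X = ennreal x" "x > 0" using False X by (cases X; auto simp: x_def)+
    have "ennreal x \<le> ennreal (x powr ((1 - 1 / p) * (n / (n - 1))) * K powr (1 / p * (n / (n - 1))))"
      using 3 K x by (simp add: epow_ennreal ennreal_mult)
    then have "x \<le> x powr ((1 - 1 / p) * (n / (n - 1))) * K powr (1 / p * (n / (n - 1)))"
      using K x by (subst (asm) ennreal_le_iff) auto
    \<comment> \<open>The exponent of \<open>x\<close> on the right is below 1 because
      \<open>p < n\<close>; a positive power of \<open>x\<close> survives and is inverted.\<close>
    then have "x powr 1 / x powr ((1 - 1 / p) * (n / (n - 1))) \<le> K powr (1 / p * (n / (n - 1)))"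
      using x by (simp add: field_simps)
    then have "x powr (1 - (1 - 1 / p) * (n / (n - 1))) \<le> K powr (1 / p * (n / (n - 1)))"
      by (simp add: powr_diff)
    moreover have "1 - (1 - 1 / p) * (n / (n - 1)) = (n - p) / (p * (n - 1))"
      using n p by (simp add: field_simps)
    ultimately have "x powr ((n - p) / (p * (n - 1))) \<le> K powr (1 / p * (n / (n - 1)))" by simp
    then have "(x powr ((n - p) / (p * (n - 1)))) powr (p * (n - 1) / (n - p)) \<le> (K powr (1 / p * (n / (n - 1)))) powr (p * (n - 1) / (n - p))"
      using p n by (intro powr_mono2) auto
    then have "x \<le> K powr (n / (n - p))"
      using x p n by (simp add: powr_powr)
    then show ?thesis using K x by (simp add: epow_ennreal ennreal_leI)
  qed auto
  then show ?thesis by (simp add: X_def E_def s_def)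
qed

section \<open>Smooth functions and the uniqueness of weak gradients\<close>

lemma Ck_on_SucD: "Ck_on (Suc k) UNIV f \<Longrightarrow> Ck_on k UNIV f"
proof (induction k arbitrary: f)
  case 0
  then show ?case
    by (auto simp: continuous_at_imp_continuous_on differentiable_imp_continuous_within)
qed auto

text \<open>Trades \<open>frechet_derivative\<close> for an explicit derivative; the inductions on
  the order of differentiability below all go through it.\<close>

lemma Ck_on_Suc_derivative:
  assumes "\<And>x. (f has_derivative f' x) (at x)" "\<And>v. Ck_on k UNIV (\<lambda>x. f' x v)"
  shows "Ck_on (Suc k) UNIV f"
proof -
  have "frechet_derivative f (at x) = f' x" for x
    using frechet_derivative_at[OF assms(1)] by simp
  then show ?thesis using assms by (auto simp: differentiable_def)
qed

lemma Ck_on_has_derivative: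
  "Ck_on (Suc k) UNIV f \<Longrightarrow> (f has_derivative frechet_derivative f (at x)) (at x)"
  by (simp add: frechet_derivative_works)

lemma Ck_on_const: "Ck_on k UNIV (\<lambda>x. c)"
proof (induction k arbitrary: c)
  case (Suc k)
  show ?case by (rule Ck_on_Suc_derivative[where f'="\<lambda>_ _. 0"]) (use Suc in auto)
qed simp

lemma Ck_on_add:
  "Ck_on k UNIV f \<Longrightarrow> Ck_on k UNIV g \<Longrightarrow> Ck_on k UNIV (\<lambda>x. f x + g x)"
proof (induction k arbitrary: f g)
  case (Suc k)
  show ?case
    by (rule Ck_on_Suc_derivative[OF has_derivative_add[OF Suc.prems[THEN Ck_on_has_derivative]]])
      (use Suc in auto)
qed (auto intro: continuous_intros)

lemma Ck_on_mult:
  fixes f g :: "'a::real_normed_vector \<Rightarrow> real"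
  shows "Ck_on k UNIV f \<Longrightarrow> Ck_on k UNIV g \<Longrightarrow> Ck_on k UNIV (\<lambda>x. f x * g x)"
proof (induction k arbitrary: f g)
  case (Suc k)
  note fg = Suc.prems[THEN Ck_on_SucD]
  show ?case
    by (rule Ck_on_Suc_derivative[OF has_derivative_mult[OF Suc.prems[THEN Ck_on_has_derivative]]])
      (use Suc fg in \<open>auto intro!: Ck_on_add\<close>)
qed (auto intro: continuous_intros)

lemma Ck_on_diff:
  fixes f g :: "'a::real_normed_vector \<Rightarrow> real"
  assumes "Ck_on k UNIV f" "Ck_on k UNIV g" shows "Ck_on k UNIV (\<lambda>x. f x - g x)"
  using Ck_on_add[OF assms(1) Ck_on_mult[OF Ck_on_const[of k "- 1"] assms(2)]] by simp

lemma Ck_on_prod: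
  fixes f :: "'i \<Rightarrow> 'a::real_normed_vector \<Rightarrow> real"
  assumes "\<And>i. i \<in> I \<Longrightarrow> Ck_on k UNIV (f i)"
  shows "Ck_on k UNIV (\<lambda>x. \<Prod>i\<in>I. f i x)"
  using assms by (induction I rule: infinite_finite_induct) (auto intro: Ck_on_const Ck_on_mult)

lemma Ck_on_power:
  fixes f :: "'a::real_normed_vector \<Rightarrow> real"
  shows "Ck_on k UNIV f \<Longrightarrow> Ck_on k UNIV (\<lambda>x. f x ^ m)"
  by (induction m) (auto intro: Ck_on_const Ck_on_mult)

text \<open>The derivative of the inverse involves only the derivative of \<open>f\<close> and the
  inverse itself, which the induction hypothesis covers one order lower.\<close>

lemma Ck_on_inverse:
  fixes f :: "'a::real_normed_vector \<Rightarrow> real"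
  assumes nz: "\<And>x. f x \<noteq> 0"
  shows "Ck_on k UNIV f \<Longrightarrow> Ck_on k UNIV (\<lambda>x. inverse (f x))"
proof (induction k)
  case (Suc k)
  have f: "Ck_on k UNIV (\<lambda>x. inverse (f x))" using Suc Ck_on_SucD by blast
  have "((\<lambda>x. inverse (f x)) has_derivative
      (\<lambda>h. (- 1) * (inverse (f x) * frechet_derivative f (at x) h * inverse (f x)))) (at x)" for x
    using Deriv.has_derivative_inverse[OF nz Ck_on_has_derivative[OF Suc.prems]] by simp
  then show ?case
    by (rule Ck_on_Suc_derivative) (intro Ck_on_mult Ck_on_const f, use Suc.prems in simp)
qed (auto intro: continuous_intros simp: nz)

lemma Ck_on_divide:
  fixes f g :: "'a::real_normed_vector \<Rightarrow> real"
  assumes "Ck_on k UNIV f" "Ck_on k UNIV g" "\<And>x. g x \<noteq> 0"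
  shows "Ck_on k UNIV (\<lambda>x. f x / g x)"
  using Ck_on_mult[OF assms(1) Ck_on_inverse[OF assms(3,2)]] by (simp add: divide_inverse)

lemma Ck_on_inner:
  fixes b :: "'a::real_inner"
  shows "Ck_on k UNIV (\<lambda>x. (x - a) \<bullet> b)"
proof (cases k)
  case (Suc m)
  show ?thesis unfolding Suc
    by (rule Ck_on_Suc_derivative[where f'="\<lambda>x h. h \<bullet> b"]) (auto intro!: derivative_eq_intros Ck_on_const)
qed (auto intro!: continuous_intros)

lemma Ck_on_scale:
  fixes f :: "'a::real_normed_vector \<Rightarrow> real"
  shows "Ck_on k UNIV f \<Longrightarrow> Ck_on k UNIV (\<lambda>x. f (c *\<^sub>R x))"
proof (induction k arbitrary: f)
  case 0
  then show ?case by (auto intro!: continuous_on_compose2[of UNIV f] continuous_intros)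
next
  case (Suc k)
  have "((\<lambda>x. c *\<^sub>R x) has_derivative (\<lambda>h. c *\<^sub>R h)) (at x)" for x :: 'a
    by (auto intro!: derivative_eq_intros)
  from has_derivative_compose[OF this Ck_on_has_derivative[OF Suc.prems]]
  have "((\<lambda>x. f (c *\<^sub>R x)) has_derivative (\<lambda>h. frechet_derivative f (at (c *\<^sub>R x)) (c *\<^sub>R h))) (at x)" for x
    by simp
  then show ?case
    by (rule Ck_on_Suc_derivative) (use Suc in auto)
qed

text \<open>The derivative of \<open>exp_bump m\<close> is a combination of functions \<open>exp_bump k\<close>, which makes
  \<open>exp_bump 0\<close> smooth.\<close>

definition exp_bump :: "nat \<Rightarrow> real \<Rightarrow> real" where
  "exp_bump m t = (if 0 < t then inverse t ^ m * exp (- inverse t) else 0)"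

lemma exp_bump_tendsto_0: "(exp_bump m \<longlongrightarrow> 0) (at_right 0)"
proof -
  have "((\<lambda>y::real. y ^ m / exp y) \<longlongrightarrow> 0) at_top" by (rule tendsto_power_div_exp_0)
  then have "((\<lambda>t::real. inverse t ^ m / exp (inverse t)) \<longlongrightarrow> 0) (at_right 0)"
    by (rule filterlim_compose[OF _ filterlim_inverse_at_top_right])
  moreover have "\<forall>\<^sub>F t in at_right 0. inverse t ^ m / exp (inverse t) = exp_bump m t"
    by (auto simp: eventually_at_right_field exp_bump_def exp_minus divide_inverse intro!: exI[of _ 1])
  ultimately show ?thesis by (rule Lim_transform_eventually)
qed

lemma DERIV_exp_bump:
  "(exp_bump m has_real_derivative exp_bump (m + 2) t - real m * exp_bump (m + 1) t) (at t)"
proof -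
  consider "t > 0" | "t < 0" | "t = 0" by linarith
  then show ?thesis
  proof cases
    case 1
    have "((\<lambda>t. inverse t ^ m * exp (- inverse t)) has_real_derivative
        exp_bump (m + 2) t - real m * exp_bump (m + 1) t) (at t)"
    proof -
      have A: "(inverse has_real_derivative - (inverse t * inverse t)) (at t)"
        using 1 by (auto intro!: derivative_eq_intros)
      show ?thesis
        by (rule DERIV_cong[OF DERIV_mult[OF DERIV_power[OF A, of m] DERIV_fun_exp[OF DERIV_minus[OF A]]]])
          (use 1 in \<open>cases m; simp add: exp_bump_def algebra_simps\<close>)
    qed
    then show ?thesis
      by (rule has_field_derivative_transform_within_open[where S="{0<..}"])
        (use 1 in \<open>auto simp: exp_bump_def\<close>)
  next
    case 2
    have "((\<lambda>t. 0) has_real_derivative exp_bump (m + 2) t - real m * exp_bump (m + 1) t) (at t)"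
      using 2 by (simp add: exp_bump_def)
    then show ?thesis
      by (rule has_field_derivative_transform_within_open[where S="{..<0}"])
        (use 2 in \<open>auto simp: exp_bump_def\<close>)
  next
    case 3
    have "((\<lambda>h. exp_bump (Suc m) h) \<longlongrightarrow> 0) (at_left 0)"
      by (rule tendsto_eventually) (auto simp: eventually_at_left_field exp_bump_def intro!: exI[of _ "- 1"])
    then have "exp_bump (Suc m) \<midarrow>0\<rightarrow> 0"
      using exp_bump_tendsto_0[of "Suc m"] by (simp add: filterlim_at_split)
    \<comment> \<open>The difference quotient at 0 is the next member of the family, whose limit
      from the right is known.\<close>
    moreover have "exp_bump (Suc m) = (\<lambda>h. exp_bump m h / h)"
      by (auto simp: fun_eq_iff exp_bump_def divide_inverse)
    ultimately have "(\<lambda>h. exp_bump m h / h) \<midarrow>0\<rightarrow> 0" by (simp only:)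
    then show ?thesis unfolding 3 DERIV_def by (simp add: exp_bump_def)
  qed
qed

lemma Ck_on_exp_bump:
  fixes f :: "'a::real_normed_vector \<Rightarrow> real"
  shows "Ck_on k UNIV f \<Longrightarrow> Ck_on k UNIV (\<lambda>x. exp_bump m (f x))"
proof (induction k arbitrary: m)
  case 0
  have "continuous_on UNIV (exp_bump m)"
    by (meson DERIV_exp_bump DERIV_isCont continuous_at_imp_continuous_on)
  then show ?case using 0 by (auto intro: continuous_on_compose2)
next
  case (Suc k)
  have IH: "Ck_on k UNIV (\<lambda>x. exp_bump m (f x))" for m
    using Suc Ck_on_SucD by blast
  have "((\<lambda>x. exp_bump m (f x)) has_derivative
      (\<lambda>h. (exp_bump (m + 2) (f x) - real m * exp_bump (m + 1) (f x)) * frechet_derivative f (at x) h)) (at x)" for x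
    using has_derivative_compose[OF Ck_on_has_derivative[OF Suc.prems] DERIV_exp_bump[of m "f x", unfolded has_field_derivative_def]] by simp
  then show ?case
    by (rule Ck_on_Suc_derivative) (use Suc.prems IH in \<open>auto intro!: Ck_on_mult Ck_on_const Ck_on_diff\<close>)
qed

section \<open>Smooth approximation of boxes and the fundamental lemma\<close>

text \<open>A product over all faces of the box, each factor depending on the signed distance to one
  face. The inner product with \<open>- i\<close> measures the distance to an upper face in the form
  that \<open>Ck_on_inner\<close> expects.\<close>

definition box_bump :: "'a::euclidean_space \<Rightarrow> 'a \<Rightarrow> 'a \<Rightarrow> real" where
  "box_bump a b x = (\<Prod>i\<in>Basis. exp_bump 0 ((x - a) \<bullet> i) * exp_bump 0 ((x - b) \<bullet> - i))"

lemma Ck_on_box_bump: "Ck_on k UNIV (box_bump a b)"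
  unfolding box_bump_def[abs_def]
  by (intro Ck_on_prod Ck_on_mult Ck_on_exp_bump Ck_on_inner)

lemma box_bump_pos_iff: "box_bump a b x > 0 \<longleftrightarrow> x \<in> box a b"
  and box_bump_nonneg: "box_bump a b x \<ge> 0"
proof -
  have nn: "exp_bump 0 t \<ge> 0" and pos: "exp_bump 0 t > 0 \<longleftrightarrow> t > 0" for t
    by (auto simp: exp_bump_def)
  show nonneg: "box_bump a b x \<ge> 0"
    unfolding box_bump_def by (intro prod_nonneg mult_nonneg_nonneg nn ballI)
  have "box_bump a b x \<noteq> 0 \<longleftrightarrow> x \<in> box a b"
    by (auto simp: box_bump_def box_def exp_bump_def inner_diff_left)
  then show "box_bump a b x > 0 \<longleftrightarrow> x \<in> box a b" using nonneg by auto
qed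

text \<open>An explicit smooth substitute for the indicator of a box, replacing mollification: where
  the bump is positive the quotient tends to 1, elsewhere it is 0.\<close>

definition box_approx :: "'a::euclidean_space \<Rightarrow> 'a \<Rightarrow> nat \<Rightarrow> 'a \<Rightarrow> real" where
  "box_approx a b k x = box_bump a b x / (box_bump a b x + 1 / real (Suc k))"

lemma box_approx_tendsto: "(\<lambda>k. box_approx a b k x) \<longlonglongrightarrow> indicator (box a b) x"
proof (cases "x \<in> box a b")
  case True
  then have "box_bump a b x > 0" by (simp add: box_bump_pos_iff)
  then have "(\<lambda>k. box_bump a b x / (box_bump a b x + 1 / real (Suc k))) \<longlonglongrightarrow> box_bump a b x / (box_bump a b x + 0)"
    by (intro tendsto_intros LIMSEQ_Suc[OF lim_1_over_n]) auto
  then show ?thesis using True \<open>box_bump a b x > 0\<close> by (simp add: box_approx_def)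
next
  case False
  then have "box_bump a b x = 0" using box_bump_pos_iff[of a b x] box_bump_nonneg[of a b x] by auto
  then show ?thesis using False by (simp add: box_approx_def)
qed

lemma box_approx_bounds: "0 \<le> box_approx a b k x" "box_approx a b k x \<le> 1"
  "x \<notin> box a b \<Longrightarrow> box_approx a b k x = 0"
proof -
  have "0 \<le> box_bump a b x" "0 < 1 / real (Suc k)" using box_bump_nonneg by auto
  then show "0 \<le> box_approx a b k x" "box_approx a b k x \<le> 1"
    unfolding box_approx_def by (auto intro!: divide_nonneg_nonneg simp: divide_le_eq_1 add_nonneg_pos simp del: of_nat_Suc)
  show "x \<notin> box a b \<Longrightarrow> box_approx a b k x = 0"
    using box_bump_pos_iff[of a b x] box_bump_nonneg[of a b x] by (auto simp: box_approx_def)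
qed

lemma test_function_box_approx:
  assumes "cbox a b \<subseteq> \<Omega>"
  shows "test_function \<Omega> (box_approx a b k)"
proof -
  have "{x. box_approx a b k x \<noteq> 0} \<subseteq> cbox a b"
    using box_approx_bounds(3)[where a=a and b=b and k=k] box_subset_cbox by blast
  then have sub: "closure {x. box_approx a b k x \<noteq> 0} \<subseteq> cbox a b"
    by (rule closure_minimal[OF _ closed_cbox])
  then have "compact (closure {x. box_approx a b k x \<noteq> 0})"
    by (meson bounded_cbox bounded_subset closed_closure compact_eq_bounded_closed)
  moreover have "Ck_on j UNIV (box_approx a b k)" for j
    unfolding box_approx_def[abs_def]
  proof (rule Ck_on_divide[OF Ck_on_box_bump Ck_on_add[OF Ck_on_box_bump Ck_on_const]])
    fix x show "box_bump a b x + 1 / real (Suc k) \<noteq> 0"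
      using box_bump_nonneg[of a b x] by (simp add: add_nonneg_eq_0_iff)
  qed
  ultimately show ?thesis using sub assms unfolding test_function_def smooth_on_def by blast
qed

text \<open>Boxes are stable under intersection and generate the Borel sets, so a Dynkin argument
  carries the hypothesis to all of them. The whole space is not a box; \<open>total\<close> serves
  the passage to complements.\<close>

lemma AE_zero_if_box_integrals_zero:
  fixes g :: "'a::euclidean_space \<Rightarrow> 'b::{second_countable_topology, banach}"
  assumes g: "integrable lborel g"
    and box: "\<And>a b. (\<integral>x. indicator (box a b) x *\<^sub>R g x \<partial>lborel) = 0"
    and total: "(\<integral>x. g x \<partial>lborel) = 0"
  shows "AE x in lborel. g x = 0"
proof -
  have stable: "Int_stable (range (\<lambda>(a, b). box a b :: 'a set))"
    by (auto intro!: Int_stableI simp: box_Int_box) (metis (no_types) rangeI case_prod_conv)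
  have sub: "range (\<lambda>(a, b). box a b :: 'a set) \<subseteq> Pow UNIV" by simp
  have "(\<integral>x. indicator A x *\<^sub>R g x \<partial>lborel) = 0" if "A \<in> sigma_sets UNIV (range (\<lambda>(a, b). box a b))" for A
    using stable sub that
  proof (induction rule: sigma_sets_induct_disjoint)
    case (basic A)
    then show ?case using box by auto
  next
    case empty
    show ?case by simp
  next
    case (compl A)
    then have A: "A \<in> sets borel" by (simp add: borel_eq_box)
    have "(\<integral>x. indicator (UNIV - A) x *\<^sub>R g x \<partial>lborel) = (\<integral>x. g x - indicator A x *\<^sub>R g x \<partial>lborel)"
      by (intro Bochner_Integration.integral_cong) (auto simp: indicator_def)
    also have "\<dots> = 0"
      using compl total g A by (subst Bochner_Integration.integral_diff) (auto intro!: integrable_mult_indicator)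
    finally show ?case .
  next
    case (union A)
    then have A: "A i \<in> sets borel" for i by (auto simp: borel_eq_box)
    have "set_integrable lborel (\<Union> (range A)) g"
      unfolding set_integrable_def using A g by (intro integrable_mult_indicator) auto
    then have "(LINT x:(\<Union> (range A))|lborel. g x) = (\<Sum>i. (LINT x:(A i)|lborel. g x))"
      using union(1) A by (intro lebesgue_integral_countable_add) (auto simp: disjoint_family_on_def)
    then show ?case using union by (simp add: set_lebesgue_integral_def)
  qed
  then have "A \<in> sets lborel \<Longrightarrow> set_lebesgue_integral lborel A g = set_lebesgue_integral lborel A (\<lambda>_. 0)" for A
    by (simp add: set_lebesgue_integral_def borel_eq_box)
  then show ?thesis
    using g by (intro sigma_finite_measure.density_unique_banach[OF sigma_finite_lborel]) auto
qed

text \<open>Integrals over open boxes vanish by dominated convergence along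
  \<open>box_approx\<close>. Applied to all subboxes of a fixed box, this gives \<open>g = 0\<close>
  there, and countably many boxes cover \<Omega>.\<close>

lemma fundamental_lemma:
  fixes g :: "real^'n \<Rightarrow> 'b::euclidean_space"
  assumes \<Omega>: "open \<Omega>" and g[measurable]: "g \<in> borel_measurable borel"
    and loc: "\<And>a b. cbox a b \<subseteq> \<Omega> \<Longrightarrow> integrable lborel (\<lambda>x. indicator (cbox a b) x *\<^sub>R g x)"
    and zero: "\<And>\<phi>. test_function \<Omega> \<phi> \<Longrightarrow> (\<integral>x. \<phi> x *\<^sub>R g x \<partial>lborel) = 0"
  shows "AE x in lborel. x \<in> \<Omega> \<longrightarrow> g x = 0"
proof -
  have box0: "(\<integral>x. indicator (box a b) x *\<^sub>R g x \<partial>lborel) = 0" if ab: "cbox a b \<subseteq> \<Omega>" for a b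
  proof -
    have lim: "(\<lambda>k. \<integral>x. box_approx a b k x *\<^sub>R g x \<partial>lborel) \<longlonglongrightarrow> (\<integral>x. indicator (box a b) x *\<^sub>R g x \<partial>lborel)"
    proof (rule integral_dominated_convergence[where w="\<lambda>x. norm (indicator (cbox a b) x *\<^sub>R g x)"])
      show "AE x in lborel. (\<lambda>k. box_approx a b k x *\<^sub>R g x) \<longlonglongrightarrow> indicator (box a b) x *\<^sub>R g x"
        by (intro AE_I2 tendsto_intros box_approx_tendsto)
      have "norm (box_approx a b k x *\<^sub>R g x) \<le> norm (indicator (cbox a b) x *\<^sub>R g x)" for k and x :: "real^'n"
        using box_approx_bounds[where a=a and b=b and k=k and x=x] box_subset_cbox[of a b]
        by (cases "x \<in> box a b") (auto simp: mult_left_le_one_le)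
      then show "AE x in lborel. norm (box_approx a b k x *\<^sub>R g x) \<le> norm (indicator (cbox a b) x *\<^sub>R g x)" for k
        by simp
      show "(\<lambda>x. box_approx a b k x *\<^sub>R g x) \<in> borel_measurable lborel" for k
      proof -
        have "continuous_on UNIV (box_approx a b k)"
          using test_function_box_approx[of a b UNIV k] by (auto simp: test_function_def smooth_on_def dest!: spec[of _ 0])
        then have [measurable]: "box_approx a b k \<in> borel_measurable borel" by (rule borel_measurable_continuous_onI)
        show ?thesis by measurable
      qed
    qed (use integrable_norm[OF loc[OF ab]] in auto)
    moreover have "(\<integral>x. box_approx a b k x *\<^sub>R g x \<partial>lborel) = 0" for k
      using zero[OF test_function_box_approx[OF ab]] .
    ultimately show ?thesis by (simp add: LIMSEQ_const_iff)
  qed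
  have one: "AE x in lborel. x \<in> box c d \<longrightarrow> g x = 0" if cd: "cbox c d \<subseteq> \<Omega>" for c d
  proof -
    have "AE x in lborel. indicator (box c d) x *\<^sub>R g x = 0"
    proof (rule AE_zero_if_box_integrals_zero)
      have "integrable lborel (\<lambda>x. indicator (box c d) x *\<^sub>R (indicator (cbox c d) x *\<^sub>R g x))"
        by (intro integrable_mult_indicator loc cd) auto
      moreover have "(\<lambda>x. indicator (box c d) x *\<^sub>R (indicator (cbox c d) x *\<^sub>R g x)) = (\<lambda>x. indicator (box c d) x *\<^sub>R g x)"
        using box_subset_cbox[of c d] by (auto simp: indicator_def fun_eq_iff)
      ultimately show "integrable lborel (\<lambda>x. indicator (box c d) x *\<^sub>R g x)" by (simp only:)
      show "(\<integral>x. indicator (box c d) x *\<^sub>R g x \<partial>lborel) = 0" by (rule box0[OF cd])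
      fix a b
      obtain a' b' where ab': "box a b \<inter> box c d = box a' b'" using box_Int_box by blast
      have "(\<integral>x. indicator (box a' b') x *\<^sub>R g x \<partial>lborel) = 0"
      proof (cases "box a' b' = {}")
        case False
        \<comment> \<open>The intersection with \<open>box c d\<close> is a box whose closure stays
          in \<open>cbox c d\<close>, hence in \<Omega>, where integrals over boxes are already
          known to vanish.\<close>
        then have "cbox a' b' \<subseteq> cbox c d"
          using ab' closure_mono[of "box a' b'" "box c d"]
          by (metis closure_box closure_empty inf_le2 subset_empty closure_subset)
        then show ?thesis using cd by (intro box0) auto
      qed simp
      moreover have "(\<lambda>x. indicator (box a b) x *\<^sub>R indicator (box c d) x *\<^sub>R g x) = (\<lambda>x. indicator (box a' b') x *\<^sub>R g x)"
        using ab' by (auto simp: indicator_def fun_eq_iff)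
      ultimately show "(\<integral>x. indicator (box a b) x *\<^sub>R indicator (box c d) x *\<^sub>R g x \<partial>lborel) = 0"
        by (simp only:)
    qed
    then show ?thesis by eventually_elim (auto simp: indicator_def)
  qed
  \<comment> \<open>Closed boxes are the ones that cover \<Omega> countably; their faces form a null
    set.\<close>
  have oneC: "AE x in lborel. x \<in> cbox c d \<longrightarrow> g x = 0" if cd: "cbox c d \<subseteq> \<Omega>" for c d
  proof -
    have "emeasure lborel (cbox c d - box c d) = emeasure lborel (cbox c d) - emeasure lborel (box c d)"
      by (rule emeasure_Diff) (auto simp: emeasure_lborel_box_eq box_subset_cbox)
    then have "cbox c d - box c d \<in> null_sets lborel"
      by (intro null_setsI) (auto simp: emeasure_lborel_box_eq emeasure_lborel_cbox_eq)
    from AE_not_in[OF this] one[OF cd] show ?thesis by eventually_elim auto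
  qed
  obtain D where D: "countable D" "D \<subseteq> Pow \<Omega>" "\<And>X. X \<in> D \<Longrightarrow> \<exists>a b. X = cbox a b" "\<Union>D = \<Omega>"
    using open_countable_Union_open_cbox[OF \<Omega>] by blast
  have "AE x in lborel. \<forall>X\<in>D. x \<in> X \<longrightarrow> g x = 0"
  proof (subst AE_ball_countable[OF D(1)], intro ballI)
    fix X assume "X \<in> D"
    then obtain c d where "X = cbox c d" "cbox c d \<subseteq> \<Omega>" using D(2,3) by blast
    then show "AE x in lborel. x \<in> X \<longrightarrow> g x = 0" using oneC by simp
  qed
  then show ?thesis
    by eventually_elim (use D(4) in blast)
qed

section \<open>Sobolev functions\<close>

lemma epow_tendsto:
  assumes "(f \<longlongrightarrow> x) F" "x \<noteq> top" "0 < r"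
  shows "((\<lambda>k. epow (f k) r) \<longlongrightarrow> epow x r) F"
proof -
  have "((\<lambda>k. ennreal (enn2real (f k) powr r)) \<longlongrightarrow> ennreal (enn2real x powr r)) F"
    using assms by (intro tendsto_ennrealI tendsto_powr' tendsto_intros) (auto simp: tendsto_enn2real less_top)
  moreover have "\<forall>\<^sub>F k in F. ennreal (enn2real (f k) powr r) = epow (f k) r"
  proof -
    have "\<forall>\<^sub>F k in F. f k < top" using assms by (intro order_tendstoD) (auto simp: less_top)
    then show ?thesis by eventually_elim (auto simp: epow_def)
  qed
  ultimately have "((\<lambda>k. epow (f k) r) \<longlongrightarrow> ennreal (enn2real x powr r)) F"
    by (rule Lim_transform_eventually)
  then show ?thesis using assms by (simp add: epow_def)
qed

section \<open>Integrals of powers and convergence in mean\<close>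

text \<open>The \<open>L^p\<close> norm without the root and with values in \<open>ennreal\<close>:
  dilations and constant factors act by multiplication, and the triangle inequality holds up to the
  factor \<open>2 powr p\<close>.\<close>

definition pint :: "real \<Rightarrow> ('a::euclidean_space \<Rightarrow> 'b::real_normed_vector) \<Rightarrow> ennreal" where
  "pint p f = (\<integral>\<^sup>+x. ennreal (norm (f x) powr p) \<partial>lborel)"

lemma powr_triangle:
  fixes a b c :: "'b::real_normed_vector"
  assumes "0 < p" shows "norm (a - c) powr p \<le> 2 powr p * (norm (a - b) powr p + norm (b - c) powr p)"
proof -
  define m where "m = max (norm (a - b)) (norm (b - c))"
  have "norm (a - c) \<le> 2 * m"
    using norm_triangle_ineq[of "a - b" "b - c"] by (simp add: m_def max_def)
  then have "norm (a - c) powr p \<le> (2 * m) powr p" using assms by (intro powr_mono2) auto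
  also have "\<dots> = 2 powr p * m powr p" by (simp add: powr_mult m_def)
  also have "m powr p \<le> norm (a - b) powr p + norm (b - c) powr p" by (simp add: m_def max_def)
  finally show ?thesis by (simp add: mult_left_mono)
qed

lemma pint_triangle:
  fixes f g h :: "'a::euclidean_space \<Rightarrow> 'b::euclidean_space"
  assumes [measurable]: "f \<in> borel_measurable borel" "g \<in> borel_measurable borel" "h \<in> borel_measurable borel"
    and p: "0 < p"
  shows "pint p (\<lambda>x. f x - h x) \<le> ennreal (2 powr p) * (pint p (\<lambda>x. f x - g x) + pint p (\<lambda>x. g x - h x))"
proof -
  have "pint p (\<lambda>x. f x - h x) \<le> (\<integral>\<^sup>+x. ennreal (2 powr p) * (ennreal (norm (f x - g x) powr p) + ennreal (norm (g x - h x) powr p)) \<partial>lborel)"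
    unfolding pint_def
  proof (rule nn_integral_mono)
    fix x
    show "ennreal (norm (f x - h x) powr p) \<le> ennreal (2 powr p) * (ennreal (norm (f x - g x) powr p) + ennreal (norm (g x - h x) powr p))"
      using ennreal_leI[OF powr_triangle[OF p, of "f x" "h x" "g x"]] by (simp add: ennreal_mult)
  qed
  also have "\<dots> = ennreal (2 powr p) * (pint p (\<lambda>x. f x - g x) + pint p (\<lambda>x. g x - h x))"
    unfolding pint_def by (subst nn_integral_cmult) (auto simp: nn_integral_add)
  finally show ?thesis .
qed

lemma pint_minus_commute: "pint p (\<lambda>x. f x - g x) = pint p (\<lambda>x. g x - f x)"
  by (simp add: pint_def norm_minus_commute)

lemma ennreal_tendsto_0_le:
  fixes f g :: "nat \<Rightarrow> ennreal"
  assumes "g \<longlonglongrightarrow> 0" "\<And>k. f k \<le> g k" shows "f \<longlonglongrightarrow> 0"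
  using tendsto_sandwich[OF _ _ tendsto_const assms(1), of f] assms(2) by auto

lemma ennreal_tendsto_0_cmult:
  fixes g :: "nat \<Rightarrow> ennreal"
  assumes "g \<longlonglongrightarrow> 0" "c \<noteq> top" shows "(\<lambda>k. c * g k) \<longlonglongrightarrow> 0"
  using ennreal_tendsto_cmult[OF _ assms(1), of c] assms(2) by (simp add: less_top)

lemma pint_tendsto_triangle:
  fixes f g :: "nat \<Rightarrow> 'a::euclidean_space \<Rightarrow> 'b::euclidean_space"
  assumes [measurable]: "\<And>k. f k \<in> borel_measurable borel" "\<And>k. g k \<in> borel_measurable borel" "\<And>k. h k \<in> borel_measurable borel"
    and p: "0 < p" and "(\<lambda>k. pint p (\<lambda>x. f k x - g k x)) \<longlonglongrightarrow> 0" "(\<lambda>k. pint p (\<lambda>x. g k x - h k x)) \<longlonglongrightarrow> 0"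
  shows "(\<lambda>k. pint p (\<lambda>x. f k x - h k x)) \<longlonglongrightarrow> 0"
proof (rule ennreal_tendsto_0_le)
  show "(\<lambda>k. ennreal (2 powr p) * (pint p (\<lambda>x. f k x - g k x) + pint p (\<lambda>x. g k x - h k x))) \<longlonglongrightarrow> 0"
    using tendsto_add[OF assms(5,6)] by (intro ennreal_tendsto_0_cmult) auto
qed (rule pint_triangle[OF assms(1) assms(2) assms(3) p])

lemma pint_tendsto_imp_AE_subseq:
  fixes f :: "nat \<Rightarrow> 'a::euclidean_space \<Rightarrow> 'b::euclidean_space"
  assumes [measurable]: "\<And>k. f k \<in> borel_measurable borel" "g \<in> borel_measurable borel"
    and p: "0 < p" and lim: "(\<lambda>k. pint p (\<lambda>x. f k x - g x)) \<longlonglongrightarrow> 0"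
  obtains r :: "nat \<Rightarrow> nat" where "strict_mono r" "AE x in lborel. (\<lambda>k. f (r k) x) \<longlonglongrightarrow> g x"
proof -
  have "\<forall>\<^sub>F k in sequentially. pint p (\<lambda>x. f k x - g x) < 1"
    using order_tendstoD(2)[OF lim, of 1] by simp
  \<comment> \<open>Finitely many indices may have an infinite integral; the shift by
    \<open>N\<close> discards them, so that every \<open>w k\<close> is integrable.\<close>
  then obtain N where N: "\<And>k. k \<ge> N \<Longrightarrow> pint p (\<lambda>x. f k x - g x) < 1"
    by (auto simp: eventually_sequentially)
  define w where "w k x = norm (f (k + N) x - g x) powr p" for k x
  have fin: "pint p (\<lambda>x. f (k + N) x - g x) \<noteq> top" for k
    using N[of "k + N"] by auto
  have int: "integrable lborel (w k)" for k
    unfolding w_def using fin[of k] by (intro integrableI_nonneg) (auto simp: pint_def less_top)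
  have "(\<integral>x. norm (w k x) \<partial>lborel) = enn2real (pint p (\<lambda>x. f (k + N) x - g x))" for k
    unfolding w_def pint_def by (subst integral_eq_nn_integral) auto
  moreover have "(\<lambda>k. enn2real (pint p (\<lambda>x. f (k + N) x - g x))) \<longlonglongrightarrow> 0"
    using LIMSEQ_ignore_initial_segment[OF lim, of N] by (intro tendsto_enn2real) auto
  ultimately have "(\<lambda>k. \<integral>x. norm (w k x) \<partial>lborel) \<longlonglongrightarrow> 0" by simp
  from tendsto_L1_AE_subseq[OF int this] obtain r where r: "strict_mono r" "AE x in lborel. (\<lambda>k. w (r k) x) \<longlonglongrightarrow> 0"
    by auto
  have "strict_mono (\<lambda>k. r k + N)" using r(1) by (auto simp: strict_mono_def)
  moreover have "AE x in lborel. (\<lambda>k. f (r k + N) x) \<longlonglongrightarrow> g x"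
    using r(2)
  proof eventually_elim
    case (elim x)
    have "(\<lambda>k. w (r k) x powr (1 / p)) \<longlonglongrightarrow> 0 powr (1 / p)"
      using p by (intro tendsto_powr' elim tendsto_const) (auto simp: w_def)
    then have "(\<lambda>k. norm (f (r k + N) x - g x)) \<longlonglongrightarrow> 0"
      using p by (simp add: w_def powr_powr)
    then show ?case by (simp add: LIM_zero_iff tendsto_norm_zero_iff)
  qed
  ultimately show ?thesis by (rule that)
qed

section \<open>Gradients and test functions\<close>

lemma has_derivative_grad:
  assumes "f differentiable (at x)"
  shows "(f has_derivative (\<lambda>h. grad f x \<bullet> h)) (at x)"
proof -
  have d: "(f has_derivative frechet_derivative f (at x)) (at x)"
    using assms by (simp add: frechet_derivative_works)
  then interpret bounded_linear "frechet_derivative f (at x)" by (rule has_derivative_bounded_linear)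
  have "frechet_derivative f (at x) h = grad f x \<bullet> h" for h
  proof -
    have "frechet_derivative f (at x) h = frechet_derivative f (at x) (\<Sum>i\<in>UNIV. (h $ i) *\<^sub>R axis i 1)"
      by (simp add: basis_expansion scalar_mult_eq_scaleR[symmetric])
    also have "\<dots> = grad f x \<bullet> h"
      by (simp add: sum scaleR inner_vec_def grad_def mult.commute)
    finally show ?thesis .
  qed
  then have "frechet_derivative f (at x) = (\<lambda>h. grad f x \<bullet> h)" by (rule ext)
  then show ?thesis using d by simp
qed

lemma test_function_has_derivative:
  assumes "test_function \<Omega> \<phi>"
  shows "(\<phi> has_derivative (\<lambda>h. grad \<phi> x \<bullet> h)) (at x)"
proof (rule has_derivative_grad)
  have "Ck_on (Suc 0) UNIV \<phi>" using assms by (simp add: test_function_def smooth_on_def)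
  then show "\<phi> differentiable (at x)" by simp
qed

lemma grad_eqI:
  assumes "(f has_derivative (\<lambda>h. g \<bullet> h)) (at x)"
  shows "grad f x = g"
proof -
  have "frechet_derivative f (at x) = (\<lambda>h. g \<bullet> h)" using frechet_derivative_at[OF assms] by simp
  then show ?thesis by (simp add: grad_def vec_eq_iff inner_axis)
qed

lemma continuous_on_grad_test_function:
  assumes "test_function \<Omega> \<phi>" shows "continuous_on UNIV (grad \<phi>)"
proof -
  have "Ck_on (Suc 0) UNIV \<phi>" using assms by (simp add: test_function_def smooth_on_def)
  then show ?thesis unfolding grad_def by (auto intro!: continuous_on_vec_lambda)
qed

lemma continuous_on_test_function: "test_function \<Omega> \<phi> \<Longrightarrow> continuous_on UNIV \<phi>"
  unfolding test_function_def smooth_on_def by (metis Ck_on.simps(1))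

lemma test_function_measurable:
  assumes "test_function \<Omega> \<phi>"
  shows "\<phi> \<in> borel_measurable borel" "grad \<phi> \<in> borel_measurable borel"
  using continuous_on_test_function[OF assms] continuous_on_grad_test_function[OF assms]
  by (auto intro: borel_measurable_continuous_onI)

text \<open>A point outside \<Omega> has a neighbourhood that misses the support, so the gradient
  vanishes as well, boundary points included.\<close>

lemma test_function_eq_0:
  assumes "test_function \<Omega> \<phi>" "x \<notin> \<Omega>"
  shows "\<phi> x = 0" "grad \<phi> x = 0"
proof -
  define S where "S = - closure {x. \<phi> x \<noteq> 0}"
  have S: "open S" "x \<in> S" and z: "y \<in> S \<Longrightarrow> \<phi> y = 0" for y
    using assms closure_subset[of "{x. \<phi> x \<noteq> 0}"] by (auto simp: S_def test_function_def)
  show "\<phi> x = 0" using z S by auto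
  have "(\<phi> has_derivative (\<lambda>h. 0 \<bullet> h)) (at x)"
    by (rule has_derivative_transform_within_open[of "\<lambda>_. 0" _ _ _ S]) (use S z in auto)
  then show "grad \<phi> x = 0" by (rule grad_eqI)
qed

lemma test_functionI:
  assumes "\<And>k. Ck_on k UNIV \<psi>" "test_function \<Omega> \<phi>" "\<And>x. \<phi> x = 0 \<Longrightarrow> \<psi> x = 0"
  shows "test_function \<Omega> \<psi>"
proof -
  have "{x. \<psi> x \<noteq> 0} \<subseteq> {x. \<phi> x \<noteq> 0}" using assms(3) by auto
  then have "closure {x. \<psi> x \<noteq> 0} \<subseteq> closure {x. \<phi> x \<noteq> 0}" by (rule closure_mono)
  then show ?thesis using assms(1,2)
    unfolding test_function_def smooth_on_def
    by (meson bounded_subset closed_closure compact_eq_bounded_closed subset_trans)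
qed

lemma test_function_Ck_on: "test_function \<Omega> \<phi> \<Longrightarrow> Ck_on k UNIV \<phi>"
  by (simp add: test_function_def smooth_on_def)

lemma test_function_bounded_support:
  assumes "test_function \<Omega> \<phi>"
  obtains R where "\<And>x. norm x \<ge> R \<Longrightarrow> \<phi> x = 0"
proof -
  have "bounded (closure {x. \<phi> x \<noteq> 0})" using assms by (auto simp: test_function_def compact_imp_bounded)
  then obtain R where R: "\<And>x. x \<in> closure {x. \<phi> x \<noteq> 0} \<Longrightarrow> norm x \<le> R" by (auto simp: bounded_iff)
  show ?thesis
  proof (rule that[of "R + 1"])
    fix x :: "real^'a" assume "R + 1 \<le> norm x"
    then have "x \<notin> closure {x. \<phi> x \<noteq> 0}" using R[of x] by auto
    then show "\<phi> x = 0" using closure_subset[of "{x. \<phi> x \<noteq> 0}"] by auto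
  qed
qed

lemma test_function_diff:
  assumes "test_function \<Omega> \<phi>" "test_function \<Omega> \<psi>"
  shows "test_function \<Omega> (\<lambda>x. \<phi> x - \<psi> x)" "grad (\<lambda>x. \<phi> x - \<psi> x) x = grad \<phi> x - grad \<psi> x"
proof -
  have "closure {x. \<phi> x - \<psi> x \<noteq> 0} \<subseteq> closure ({x. \<phi> x \<noteq> 0} \<union> {x. \<psi> x \<noteq> 0})"
    by (rule closure_mono) auto
  also have "\<dots> = closure {x. \<phi> x \<noteq> 0} \<union> closure {x. \<psi> x \<noteq> 0}" by (rule closure_Un)
  finally have sub: "closure {x. \<phi> x - \<psi> x \<noteq> 0} \<subseteq> closure {x. \<phi> x \<noteq> 0} \<union> closure {x. \<psi> x \<noteq> 0}" .
  have "compact (closure {x. \<phi> x \<noteq> 0} \<union> closure {x. \<psi> x \<noteq> 0})"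
    using assms by (auto simp: test_function_def)
  then have "compact (closure {x. \<phi> x - \<psi> x \<noteq> 0})"
    using sub by (meson bounded_subset closed_closure compact_eq_bounded_closed)
  moreover have "Ck_on k UNIV (\<lambda>x. \<phi> x - \<psi> x)" for k
    using assms by (intro Ck_on_diff test_function_Ck_on)
  ultimately show "test_function \<Omega> (\<lambda>x. \<phi> x - \<psi> x)"
    using sub assms unfolding test_function_def smooth_on_def by blast
  show "grad (\<lambda>x. \<phi> x - \<psi> x) x = grad \<phi> x - grad \<psi> x"
    using has_derivative_diff[OF assms[THEN test_function_has_derivative]]
    by (intro grad_eqI) (simp add: inner_diff_left)
qed

lemma test_function_scale:
  fixes c :: real
  assumes \<phi>: "test_function \<Omega> \<phi>" and star: "star_shaped_wrt 0 \<Omega>" and c: "c \<ge> 1"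
  shows "test_function \<Omega> (\<lambda>x. \<phi> (c *\<^sub>R x))" "grad (\<lambda>x. \<phi> (c *\<^sub>R x)) x = c *\<^sub>R grad \<phi> (c *\<^sub>R x)"
proof -
  define K where "K = (\<lambda>x. (1 / c) *\<^sub>R x) ` closure {x. \<phi> x \<noteq> 0}"
  have "compact K" unfolding K_def using \<phi> by (intro compact_scaling) (simp add: test_function_def)
  have "x \<in> K" if "\<phi> (c *\<^sub>R x) \<noteq> 0" for x
    using that c closure_subset[of "{x. \<phi> x \<noteq> 0}"] by (auto simp: K_def intro!: image_eqI[of _ _ "c *\<^sub>R x"])
  then have sub: "closure {x. \<phi> (c *\<^sub>R x) \<noteq> 0} \<subseteq> K"
    using \<open>compact K\<close> by (intro closure_minimal compact_imp_closed) auto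
  have "K \<subseteq> \<Omega>"
  proof
    fix y assume "y \<in> K"
    then obtain x where x: "x \<in> closure {x. \<phi> x \<noteq> 0}" "y = (1 / c) *\<^sub>R x" by (auto simp: K_def)
    then have "x \<in> \<Omega>" using \<phi> by (auto simp: test_function_def)
    moreover have "y \<in> closed_segment 0 x"
      using x c by (auto simp: closed_segment_def intro!: exI[of _ "1 / c"])
    ultimately show "y \<in> \<Omega>" using star by (auto simp: star_shaped_wrt_def)
  qed
  moreover have "compact (closure {x. \<phi> (c *\<^sub>R x) \<noteq> 0})"
    using sub \<open>compact K\<close> by (meson bounded_subset closed_closure compact_eq_bounded_closed)
  moreover have "Ck_on k UNIV (\<lambda>x. \<phi> (c *\<^sub>R x))" for k
    using \<phi> by (intro Ck_on_scale test_function_Ck_on)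
  ultimately show "test_function \<Omega> (\<lambda>x. \<phi> (c *\<^sub>R x))"
    using sub unfolding test_function_def smooth_on_def by blast
  have "((\<lambda>x. c *\<^sub>R x) has_derivative (\<lambda>h. c *\<^sub>R h)) (at x)"
    by (auto intro!: derivative_eq_intros)
  from has_derivative_compose[OF this test_function_has_derivative[OF \<phi>]]
  show "grad (\<lambda>x. \<phi> (c *\<^sub>R x)) x = c *\<^sub>R grad \<phi> (c *\<^sub>R x)"
    by (intro grad_eqI) simp
qed

text \<open>\<open>sobolev_W0\<close> for Borel functions on the whole space, with \<open>G\<close> in the role of the gradient of \<open>u\<close>.\<close>

definition W0 :: "(real^'n) set \<Rightarrow> real \<Rightarrow> (real^'n \<Rightarrow> real) \<Rightarrow> (real^'n \<Rightarrow> real^'n) \<Rightarrow> bool" where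
  "W0 \<Omega> p u G \<longleftrightarrow> u \<in> borel_measurable borel \<and> G \<in> borel_measurable borel \<and>
     (\<exists>\<phi>. (\<forall>k. test_function \<Omega> (\<phi> k)) \<and>
        (\<lambda>k::nat. pint p (\<lambda>x. \<phi> k x - u x)) \<longlonglongrightarrow> 0 \<and>
        (\<lambda>k. pint p (\<lambda>x. grad (\<phi> k) x - G x)) \<longlonglongrightarrow> 0)"

lemma W0_measurable: "W0 \<Omega> p u G \<Longrightarrow> u \<in> borel_measurable borel" "W0 \<Omega> p u G \<Longrightarrow> G \<in> borel_measurable borel"
  by (auto simp: W0_def)

text \<open>Two successive subsequences add pointwise convergence to the convergence in mean;
  Fatou's lemma and nonlinear compositions rely on it.\<close>

lemma W0_sequence:
  assumes "W0 \<Omega> p u G" "0 < p"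
  obtains \<phi> where "\<And>k::nat. test_function \<Omega> (\<phi> k)"
    "(\<lambda>k. pint p (\<lambda>x. \<phi> k x - u x)) \<longlonglongrightarrow> 0" "(\<lambda>k. pint p (\<lambda>x. grad (\<phi> k) x - G x)) \<longlonglongrightarrow> 0"
    "AE x in lborel. (\<lambda>k. \<phi> k x) \<longlonglongrightarrow> u x" "AE x in lborel. (\<lambda>k. grad (\<phi> k) x) \<longlonglongrightarrow> G x"
proof -
  note [measurable] = W0_measurable[OF assms(1)]
  from assms(1) obtain \<phi> where \<phi>: "\<And>k::nat. test_function \<Omega> (\<phi> k)"
    "(\<lambda>k. pint p (\<lambda>x. \<phi> k x - u x)) \<longlonglongrightarrow> 0" "(\<lambda>k. pint p (\<lambda>x. grad (\<phi> k) x - G x)) \<longlonglongrightarrow> 0"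
    by (auto simp: W0_def)
  note [measurable] = test_function_measurable[OF \<phi>(1)]
  obtain r where r: "strict_mono r" "AE x in lborel. (\<lambda>k. \<phi> (r k) x) \<longlonglongrightarrow> u x"
    by (rule pint_tendsto_imp_AE_subseq[of \<phi> u p]) (use assms \<phi> in auto)
  have 3: "(\<lambda>k. pint p (\<lambda>x. grad (\<phi> (r k)) x - G x)) \<longlonglongrightarrow> 0"
    using LIMSEQ_subseq_LIMSEQ[OF \<phi>(3) r(1)] by (simp add: o_def)
  obtain r' where r': "strict_mono r'" "AE x in lborel. (\<lambda>k. grad (\<phi> (r (r' k))) x) \<longlonglongrightarrow> G x"
    by (rule pint_tendsto_imp_AE_subseq[of "\<lambda>k. grad (\<phi> (r k))" G p]) (use assms 3 in auto)
  show ?thesis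
  proof (rule that[of "\<lambda>k. \<phi> (r (r' k))"])
    have s: "strict_mono (r \<circ> r')" using r(1) r'(1) by (simp add: strict_mono_o)
    show "(\<lambda>k. pint p (\<lambda>x. \<phi> (r (r' k)) x - u x)) \<longlonglongrightarrow> 0"
      using LIMSEQ_subseq_LIMSEQ[OF \<phi>(2) s] by (simp add: o_def)
    show "(\<lambda>k. pint p (\<lambda>x. grad (\<phi> (r (r' k))) x - G x)) \<longlonglongrightarrow> 0"
      using LIMSEQ_subseq_LIMSEQ[OF \<phi>(3) s] by (simp add: o_def)
    show "AE x in lborel. (\<lambda>k. \<phi> (r (r' k)) x) \<longlonglongrightarrow> u x"
      using r(2)
    proof eventually_elim
      case (elim x)
      show ?case using LIMSEQ_subseq_LIMSEQ[OF elim r'(1)] by (simp add: o_def)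
    qed
  qed (use \<phi> r' in auto)
qed

lemma pint_test_function_finite:
  assumes "test_function \<Omega> \<phi>" "0 < p"
  shows "pint p \<phi> < top" "pint p (grad \<phi>) < top"
proof -
  obtain R where R: "\<And>x. norm x \<ge> R \<Longrightarrow> \<phi> x = 0" using test_function_bounded_support[OF assms(1)] by metis
  \<comment> \<open>Read as a test function on a ball, \<open>\<phi>\<close> has a gradient that
    vanishes outside the ball too.\<close>
  have "test_function (ball 0 (R + 1)) \<phi>"
  proof -
    have "{x. \<phi> x \<noteq> 0} \<subseteq> cball 0 R" using R by (auto simp: not_le[symmetric]) (meson linear)
    then have "closure {x. \<phi> x \<noteq> 0} \<subseteq> cball 0 R" by (rule closure_minimal) simp
    also have "\<dots> \<subseteq> ball 0 (R + 1)" by auto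
    finally show ?thesis using assms(1) by (simp add: test_function_def)
  qed
  then have R': "norm x \<ge> R + 1 \<Longrightarrow> grad \<phi> x = 0" "norm x \<ge> R + 1 \<Longrightarrow> \<phi> x = 0" for x
    using test_function_eq_0[of "ball 0 (R + 1)" \<phi> x] by auto
  have "(\<integral>\<^sup>+x. ennreal (norm (\<phi> x) powr p) \<partial>lborel) < \<infinity>" "(\<integral>\<^sup>+x. ennreal (norm (grad \<phi> x) powr p) \<partial>lborel) < \<infinity>"
    by (rule nn_integral_compact_support_finite[where R="R + 1"];
        use assms R' continuous_on_test_function[OF assms(1)] continuous_on_grad_test_function[OF assms(1)]
        in \<open>auto intro!: continuous_on_powr' continuous_on_norm continuous_on_rabs continuous_on_const\<close>)+
  then show "pint p \<phi> < top" "pint p (grad \<phi>) < top"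
    by (simp_all add: pint_def)
qed

lemma pint_finite_of_tendsto:
  fixes f :: "nat \<Rightarrow> 'a::euclidean_space \<Rightarrow> 'b::euclidean_space"
  assumes [measurable]: "\<And>k. f k \<in> borel_measurable borel" "g \<in> borel_measurable borel"
    and p: "0 < p" and lim: "(\<lambda>k. pint p (\<lambda>x. f k x - g x)) \<longlonglongrightarrow> 0" and fin: "\<And>k. pint p (f k) < top"
  shows "pint p g < top"
proof -
  have "\<forall>\<^sub>F k in sequentially. pint p (\<lambda>x. f k x - g x) < 1"
    using order_tendstoD(2)[OF lim, of 1] by simp
  then obtain k where k: "pint p (\<lambda>x. f k x - g x) < 1" by (auto simp: eventually_sequentially)
  have "pint p (\<lambda>x. g x - 0) \<le> ennreal (2 powr p) * (pint p (\<lambda>x. g x - f k x) + pint p (\<lambda>x. f k x - 0))"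
    by (rule pint_triangle) (use p in auto)
  also have "\<dots> < top"
    using fin[of k] k pint_minus_commute[of p "f k" g] by (auto simp: ennreal_mult_less_top intro: order_less_trans)
  finally show ?thesis by simp
qed

lemma W0_finite:
  assumes "W0 \<Omega> p u G" "0 < p"
  shows "pint p u < top" "pint p G < top"
proof -
  note [measurable] = W0_measurable[OF assms(1)]
  obtain \<phi> where \<phi>: "\<And>k::nat. test_function \<Omega> (\<phi> k)" "(\<lambda>k. pint p (\<lambda>x. \<phi> k x - u x)) \<longlonglongrightarrow> 0"
      "(\<lambda>k. pint p (\<lambda>x. grad (\<phi> k) x - G x)) \<longlonglongrightarrow> 0" "AE x in lborel. (\<lambda>k. \<phi> k x) \<longlonglongrightarrow> u x"
      "AE x in lborel. (\<lambda>k. grad (\<phi> k) x) \<longlonglongrightarrow> G x"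
    by (rule W0_sequence[OF assms]) (rule that)
  note [measurable] = test_function_measurable[OF \<phi>(1)]
  show "pint p u < top"
    by (rule pint_finite_of_tendsto[of \<phi>]) (use \<phi> assms pint_test_function_finite in auto)
  show "pint p G < top"
    by (rule pint_finite_of_tendsto[of "\<lambda>k. grad (\<phi> k)"]) (use \<phi> assms pint_test_function_finite(2)[OF \<phi>(1)] in auto)
qed

lemma W0_diff:
  assumes u: "W0 \<Omega> p u G" and v: "W0 \<Omega> p v H" and p: "0 < p"
  shows "W0 \<Omega> p (\<lambda>x. u x - v x) (\<lambda>x. G x - H x)"
proof -
  note [measurable] = W0_measurable[OF u] W0_measurable[OF v]
  obtain \<phi> where \<phi>: "\<And>k::nat. test_function \<Omega> (\<phi> k)"
    "(\<lambda>k. pint p (\<lambda>x. \<phi> k x - u x)) \<longlonglongrightarrow> 0" "(\<lambda>k. pint p (\<lambda>x. grad (\<phi> k) x - G x)) \<longlonglongrightarrow> 0"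
    using u by (auto simp: W0_def)
  obtain \<psi> where \<psi>: "\<And>k::nat. test_function \<Omega> (\<psi> k)"
    "(\<lambda>k. pint p (\<lambda>x. \<psi> k x - v x)) \<longlonglongrightarrow> 0" "(\<lambda>k. pint p (\<lambda>x. grad (\<psi> k) x - H x)) \<longlonglongrightarrow> 0"
    using v by (auto simp: W0_def)
  note [measurable] = test_function_measurable[OF \<phi>(1)] test_function_measurable[OF \<psi>(1)]
  have 1: "(\<lambda>k. pint p (\<lambda>x. (\<phi> k x - \<psi> k x) - (u x - v x))) \<longlonglongrightarrow> 0"
    by (rule pint_tendsto_triangle[where g="\<lambda>k x. u x - \<psi> k x"])
      (use p \<phi>(2) \<psi>(2) pint_minus_commute[of p v] in \<open>auto simp: algebra_simps\<close>)
  have 2: "(\<lambda>k. pint p (\<lambda>x. (grad (\<phi> k) x - grad (\<psi> k) x) - (G x - H x))) \<longlonglongrightarrow> 0"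
    by (rule pint_tendsto_triangle[where g="\<lambda>k x. G x - grad (\<psi> k) x"])
      (use p \<phi>(3) \<psi>(3) pint_minus_commute[of p H] in \<open>auto simp: algebra_simps\<close>)
  show ?thesis unfolding W0_def
    using 1 2 test_function_diff[OF \<phi>(1) \<psi>(1)]
    by (intro conjI exI[of _ "\<lambda>k x. \<phi> k x - \<psi> k x"]) auto
qed

section \<open>Dilations and the Sobolev inequality in \<open>W0\<close>\<close>

lemma lborel_nn_integral_scale:
  fixes f :: "'a::euclidean_space \<Rightarrow> ennreal"
  assumes [measurable]: "f \<in> borel_measurable borel" and c: "c > 0"
  shows "(\<integral>\<^sup>+x. f (c *\<^sub>R x) \<partial>lborel) = ennreal (c powr (- DIM('a))) * (\<integral>\<^sup>+x. f x \<partial>lborel)"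
proof -
  have "(\<integral>\<^sup>+x. f x \<partial>lborel) = ennreal (c ^ DIM('a)) * (\<integral>\<^sup>+x. f (c *\<^sub>R x) \<partial>lborel)"
    using c by (subst lborel_affine[of c 0]) (simp_all add: nn_integral_density nn_integral_distr nn_integral_cmult)
  moreover have "ennreal (c powr (- DIM('a))) * ennreal (c ^ DIM('a)) = 1"
    using c by (simp add: ennreal_mult[symmetric] powr_realpow[symmetric] powr_add[symmetric])
  ultimately show ?thesis by (simp add: mult.assoc[symmetric])
qed

lemma pint_scale:
  fixes f :: "'a::euclidean_space \<Rightarrow> 'b::euclidean_space"
  assumes [measurable]: "f \<in> borel_measurable borel" and c: "c > 0"
  shows "pint p (\<lambda>x. f (c *\<^sub>R x)) = ennreal (c powr (- DIM('a))) * pint p f"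
  unfolding pint_def by (rule lborel_nn_integral_scale) (use c in auto)

lemma pint_scaleR: "pint p (\<lambda>x. c *\<^sub>R f x) = ennreal (\<bar>c\<bar> powr p) * pint p f" if [measurable]: "f \<in> borel_measurable borel"
  for f :: "'a::euclidean_space \<Rightarrow> 'b::euclidean_space"
  unfolding pint_def by (subst nn_integral_cmult[symmetric]) (auto simp: powr_mult ennreal_mult)

text \<open>The approximants are dilated together with \<open>u\<close>: star-shapedness keeps their
  supports in \<Omega>, and the distances change only by constant factors.\<close>

lemma W0_scale:
  fixes c :: real
  assumes u: "W0 \<Omega> p u G" and p: "0 < p" and star: "star_shaped_wrt 0 \<Omega>" and c: "c \<ge> 1"
  shows "W0 \<Omega> p (\<lambda>x. u (c *\<^sub>R x)) (\<lambda>x. c *\<^sub>R G (c *\<^sub>R x))"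
proof -
  note [measurable] = W0_measurable[OF u]
  obtain \<phi> where \<phi>: "\<And>k::nat. test_function \<Omega> (\<phi> k)"
    "(\<lambda>k. pint p (\<lambda>x. \<phi> k x - u x)) \<longlonglongrightarrow> 0" "(\<lambda>k. pint p (\<lambda>x. grad (\<phi> k) x - G x)) \<longlonglongrightarrow> 0"
    using u by (auto simp: W0_def)
  note [measurable] = test_function_measurable[OF \<phi>(1)]
  have "pint p (\<lambda>x. \<phi> k (c *\<^sub>R x) - u (c *\<^sub>R x)) = ennreal (c powr - CARD('a)) * pint p (\<lambda>x. \<phi> k x - u x)" for k
    using pint_scale[of "\<lambda>x. \<phi> k x - u x" c p] c by simp
  then have 1: "(\<lambda>k. pint p (\<lambda>x. \<phi> k (c *\<^sub>R x) - u (c *\<^sub>R x))) \<longlonglongrightarrow> 0"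
    using ennreal_tendsto_0_cmult[OF \<phi>(2)] by simp
  have "pint p (\<lambda>x. c *\<^sub>R grad (\<phi> k) (c *\<^sub>R x) - c *\<^sub>R G (c *\<^sub>R x)) =
      ennreal (c powr p) * (ennreal (c powr - CARD('a)) * pint p (\<lambda>x. grad (\<phi> k) x - G x))" for k
    using pint_scale[of "\<lambda>x. grad (\<phi> k) x - G x" c p] pint_scaleR[of "\<lambda>x. grad (\<phi> k) (c *\<^sub>R x) - G (c *\<^sub>R x)" p c] c
    by (simp add: scaleR_diff_right)
  then have 2: "(\<lambda>k. pint p (\<lambda>x. c *\<^sub>R grad (\<phi> k) (c *\<^sub>R x) - c *\<^sub>R G (c *\<^sub>R x))) \<longlonglongrightarrow> 0"
    using ennreal_tendsto_0_cmult[OF ennreal_tendsto_0_cmult[OF \<phi>(3)]] by simp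
  show ?thesis unfolding W0_def
    using 1 2 test_function_scale[OF \<phi>(1) star c]
    by (intro conjI exI[of _ "\<lambda>k x. \<phi> k (c *\<^sub>R x)"]) auto
qed

text \<open>Fatou's lemma along the approximants; the extra factor \<open>2 powr p\<close> comes
  from comparing \<open>\<Gamma> k\<close> with \<open>H\<close>. Continuously differentiable
  approximants with bounded support suffice, so the lemma applies to test functions and also to real
  cut powers of them.\<close>

lemma Sobolev_limit:
  fixes v :: "real^'n \<Rightarrow> real" and H :: "real^'n \<Rightarrow> real^'n" and p :: real
  defines "n \<equiv> real CARD('n)"
  assumes der: "\<And>k::nat. \<And>x. (\<phi> k has_derivative (\<lambda>h. \<Gamma> k x \<bullet> h)) (at x)"
    and cont: "\<And>k. continuous_on UNIV (\<Gamma> k)"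
    and supp: "\<And>k x. norm x \<ge> R k \<Longrightarrow> \<phi> k x = 0"
    and [measurable]: "v \<in> borel_measurable borel" "H \<in> borel_measurable borel"
    and AE: "AE x in lborel. (\<lambda>k. \<phi> k x) \<longlonglongrightarrow> v x"
    and lim: "(\<lambda>k. pint p (\<lambda>x. \<Gamma> k x - H x)) \<longlonglongrightarrow> 0" and H: "pint p H < top"
    and p: "1 < p" "p < n"
  shows "pint (n * p / (n - p)) v \<le> epow (ennreal ((p * (n - 1) / (n - p)) powr p * 2 powr p) * pint p H) (n / (n - p))"
proof -
  define s where "s = n * p / (n - p)"
  define C where "C = (p * (n - 1) / (n - p)) powr p"
  have s: "s > 0" using p by (simp add: s_def)
  have cphi: "continuous_on UNIV (\<phi> k)" for k
    using der by (meson continuous_at_imp_continuous_on has_derivative_continuous)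
  have [measurable]: "\<phi> k \<in> borel_measurable borel" "\<Gamma> k \<in> borel_measurable borel" for k
    using cphi cont by (auto intro: borel_measurable_continuous_onI)
  have k: "pint s (\<phi> k) \<le> epow (ennreal (C * 2 powr p) * (pint p (\<lambda>x. \<Gamma> k x - H x) + pint p H)) (n / (n - p))" for k
  proof -
    have "pint s (\<phi> k) \<le> epow (ennreal C * pint p (\<Gamma> k)) (n / (n - p))"
      using Sobolev_inequality[OF der[of k] cont[of k] supp[of k] p(1)] p(2)
      by (simp add: pint_def s_def C_def n_def)
    also have "\<dots> \<le> epow (ennreal C * (ennreal (2 powr p) * (pint p (\<lambda>x. \<Gamma> k x - H x) + pint p (\<lambda>x. H x - 0)))) (n / (n - p))"
      using pint_triangle[of "\<Gamma> k" H "\<lambda>_. 0" p] p by (intro epow_mono mult_left_mono) auto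
    finally show ?thesis by (simp add: C_def ennreal_mult mult.assoc)
  qed
  have "pint s v \<le> liminf (\<lambda>k. pint s (\<phi> k))"
  proof -
    have "pint s v = (\<integral>\<^sup>+x. liminf (\<lambda>k. ennreal (norm (\<phi> k x) powr s)) \<partial>lborel)"
      unfolding pint_def
    proof (rule nn_integral_cong_AE)
      from AE show "AE x in lborel. ennreal (norm (v x) powr s) = liminf (\<lambda>k. ennreal (norm (\<phi> k x) powr s))"
      proof eventually_elim
        case (elim x)
        have "(\<lambda>k. ennreal (norm (\<phi> k x) powr s)) \<longlonglongrightarrow> ennreal (norm (v x) powr s)"
          using s by (intro tendsto_ennrealI tendsto_powr' tendsto_norm elim tendsto_const) auto
        then show ?case by (intro lim_imp_Liminf[symmetric]) auto
      qed
    qed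
    also have "\<dots> \<le> liminf (\<lambda>k. pint s (\<phi> k))"
      unfolding pint_def by (intro nn_integral_liminf) auto
    finally show ?thesis .
  qed
  also have "\<dots> \<le> liminf (\<lambda>k. epow (ennreal (C * 2 powr p) * (pint p (\<lambda>x. \<Gamma> k x - H x) + pint p H)) (n / (n - p)))"
    by (intro Liminf_mono always_eventually allI k)
  also have "\<dots> = epow (ennreal (C * 2 powr p) * (0 + pint p H)) (n / (n - p))"
  proof (rule lim_imp_Liminf)
    show "(\<lambda>k. epow (ennreal (C * 2 powr p) * (pint p (\<lambda>x. \<Gamma> k x - H x) + pint p H)) (n / (n - p)))
        \<longlonglongrightarrow> epow (ennreal (C * 2 powr p) * (0 + pint p H)) (n / (n - p))"
      using p H by (intro epow_tendsto ennreal_tendsto_cmult tendsto_add lim tendsto_const)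
        (auto simp: ennreal_mult_eq_top_iff)
  qed simp
  finally show ?thesis by (simp add: s_def C_def)
qed

text \<open>The second claim is the Sobolev bound for the difference of \<open>u\<close> and an
  approximant, which is itself a member of \<open>W0\<close>. It makes the critical power admissible
  in the passage from test functions to \<open>W0\<close>.\<close>

lemma W0_Sobolev:
  fixes u :: "real^'n \<Rightarrow> real" and p :: real
  defines "s \<equiv> crit_exp CARD('n) p"
  assumes u: "W0 \<Omega> p u G" and p: "1 < p" "p < real CARD('n)"
  shows "pint s u < top"
    and "(\<And>k::nat. test_function \<Omega> (\<phi> k)) \<Longrightarrow> (\<lambda>k. pint p (\<lambda>x. \<phi> k x - u x)) \<longlonglongrightarrow> 0 \<Longrightarrow>
      (\<lambda>k. pint p (\<lambda>x. grad (\<phi> k) x - G x)) \<longlonglongrightarrow> 0 \<Longrightarrow> (\<lambda>k. pint s (\<lambda>x. \<phi> k x - u x)) \<longlonglongrightarrow> 0"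
proof -
  define n where "n = real CARD('n)"
  define C where "C = (p * (n - 1) / (n - p)) powr p * 2 powr p"
  have s: "s = n * p / (n - p)" by (simp add: s_def crit_exp_def n_def)
  have p0: "0 < p" using p by simp
  have gen: "pint s v \<le> epow (ennreal C * pint p H) (n / (n - p))" if v: "W0 \<Omega> p v H" for v H
  proof -
    note [measurable] = W0_measurable[OF v]
    obtain \<phi> where \<phi>: "\<And>k::nat. test_function \<Omega> (\<phi> k)" "(\<lambda>k. pint p (\<lambda>x. \<phi> k x - v x)) \<longlonglongrightarrow> 0"
      "(\<lambda>k. pint p (\<lambda>x. grad (\<phi> k) x - H x)) \<longlonglongrightarrow> 0" "AE x in lborel. (\<lambda>k. \<phi> k x) \<longlonglongrightarrow> v x"
      "AE x in lborel. (\<lambda>k. grad (\<phi> k) x) \<longlonglongrightarrow> H x"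
      by (rule W0_sequence[OF v p0]) (rule that)
    have "\<exists>R. \<forall>x. norm x \<ge> R \<longrightarrow> \<phi> k x = 0" for k
      using test_function_bounded_support[OF \<phi>(1)[of k]] by metis
    then obtain R where R: "\<And>k x. norm x \<ge> R k \<Longrightarrow> \<phi> k x = 0" by metis
    show ?thesis unfolding s C_def n_def
      by (rule Sobolev_limit[OF test_function_has_derivative[OF \<phi>(1)] continuous_on_grad_test_function[OF \<phi>(1)] R
           _ _ \<phi>(4,3)]) (use p W0_finite[OF v] in auto)
  qed
  show "pint s u < top"
  proof -
    have "epow (ennreal C * pint p G) (n / (n - p)) < top"
      using W0_finite[OF u] p by (auto simp: less_top[symmetric] ennreal_mult_eq_top_iff)
    then show ?thesis using gen[OF u] by (rule le_less_trans[rotated])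
  qed
  assume \<phi>: "\<And>k::nat. test_function \<Omega> (\<phi> k)" "(\<lambda>k. pint p (\<lambda>x. \<phi> k x - u x)) \<longlonglongrightarrow> 0"
      "(\<lambda>k. pint p (\<lambda>x. grad (\<phi> k) x - G x)) \<longlonglongrightarrow> 0"
  have test: "W0 \<Omega> p (\<phi> k) (grad (\<phi> k))" for k
    unfolding W0_def using test_function_measurable[OF \<phi>(1)] \<phi>(1) p
    by (intro conjI exI[of _ "\<lambda>_. \<phi> k"]) (auto simp: pint_def)
  have le: "pint s (\<lambda>x. \<phi> k x - u x) \<le> epow (ennreal C * pint p (\<lambda>x. grad (\<phi> k) x - G x)) (n / (n - p))" for k
    using p by (intro gen W0_diff test u) auto
  have "(\<lambda>k. epow (ennreal C * pint p (\<lambda>x. grad (\<phi> k) x - G x)) (n / (n - p))) \<longlonglongrightarrow> epow 0 (n / (n - p))"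
    using p by (intro epow_tendsto ennreal_tendsto_0_cmult \<phi>) (auto simp: n_def)
  then have "(\<lambda>k. epow (ennreal C * pint p (\<lambda>x. grad (\<phi> k) x - G x)) (n / (n - p))) \<longlonglongrightarrow> 0" by simp
  then show "(\<lambda>k. pint s (\<lambda>x. \<phi> k x - u x)) \<longlonglongrightarrow> 0" using le by (rule ennreal_tendsto_0_le)
qed

section \<open>The chain rule in \<open>W0\<close>\<close>

text \<open>The error splits in two: replacing \<open>\<Gamma> k\<close> by \<open>G\<close> costs
  at most the bound \<open>B\<close>, and replacing \<open>b (\<phi> k x)\<close> by
  \<open>b (u x)\<close> in front of the fixed \<open>G\<close> is dominated convergence.\<close>

lemma pint_chain_tendsto:
  fixes \<phi> :: "nat \<Rightarrow> 'a::euclidean_space \<Rightarrow> real" and \<Gamma> :: "nat \<Rightarrow> 'a \<Rightarrow> 'b::euclidean_space"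
  assumes [measurable]: "\<And>k. \<phi> k \<in> borel_measurable borel" "\<And>k. \<Gamma> k \<in> borel_measurable borel"
      "u \<in> borel_measurable borel" "G \<in> borel_measurable borel"
    and b: "continuous_on UNIV b" "\<And>t. \<bar>b t\<bar> \<le> B"
    and p: "0 < p" and AE: "AE x in lborel. (\<lambda>k. \<phi> k x) \<longlonglongrightarrow> u x"
    and lim: "(\<lambda>k. pint p (\<lambda>x. \<Gamma> k x - G x)) \<longlonglongrightarrow> 0" and G: "pint p G < top"
  shows "(\<lambda>k. pint p (\<lambda>x. b (\<phi> k x) *\<^sub>R \<Gamma> k x - b (u x) *\<^sub>R G x)) \<longlonglongrightarrow> 0"
proof -
  have [measurable]: "b \<in> borel_measurable borel" using b(1) by (rule borel_measurable_continuous_onI)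
  have B: "B \<ge> 0" using b(2)[of 0] by simp
  have 1: "(\<lambda>k. pint p (\<lambda>x. b (\<phi> k x) *\<^sub>R \<Gamma> k x - b (\<phi> k x) *\<^sub>R G x)) \<longlonglongrightarrow> 0"
  proof (rule ennreal_tendsto_0_le)
    show "(\<lambda>k. ennreal (B powr p) * pint p (\<lambda>x. \<Gamma> k x - G x)) \<longlonglongrightarrow> 0"
      by (intro ennreal_tendsto_0_cmult lim) auto
    fix k
    have "pint p (\<lambda>x. b (\<phi> k x) *\<^sub>R \<Gamma> k x - b (\<phi> k x) *\<^sub>R G x) \<le>
        (\<integral>\<^sup>+x. ennreal (B powr p) * ennreal (norm (\<Gamma> k x - G x) powr p) \<partial>lborel)"
      unfolding pint_def
    proof (rule nn_integral_mono)
      fix x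
      have "norm (b (\<phi> k x) *\<^sub>R \<Gamma> k x - b (\<phi> k x) *\<^sub>R G x) = \<bar>b (\<phi> k x)\<bar> * norm (\<Gamma> k x - G x)"
        by (simp flip: scaleR_diff_right)
      then have "norm (b (\<phi> k x) *\<^sub>R \<Gamma> k x - b (\<phi> k x) *\<^sub>R G x) powr p = \<bar>b (\<phi> k x)\<bar> powr p * norm (\<Gamma> k x - G x) powr p"
        by (simp add: powr_mult)
      also have "\<dots> \<le> B powr p * norm (\<Gamma> k x - G x) powr p"
        using b(2) p by (intro mult_right_mono powr_mono2) auto
      finally show "ennreal (norm (b (\<phi> k x) *\<^sub>R \<Gamma> k x - b (\<phi> k x) *\<^sub>R G x) powr p)
          \<le> ennreal (B powr p) * ennreal (norm (\<Gamma> k x - G x) powr p)"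
        by (simp add: ennreal_mult[symmetric] ennreal_leI)
    qed
    then show "pint p (\<lambda>x. b (\<phi> k x) *\<^sub>R \<Gamma> k x - b (\<phi> k x) *\<^sub>R G x) \<le> ennreal (B powr p) * pint p (\<lambda>x. \<Gamma> k x - G x)"
      by (simp add: nn_integral_cmult pint_def)
  qed
  have 2: "(\<lambda>k. pint p (\<lambda>x. b (\<phi> k x) *\<^sub>R G x - b (u x) *\<^sub>R G x)) \<longlonglongrightarrow> 0"
  proof -
    have "(\<lambda>k. pint p (\<lambda>x. b (\<phi> k x) *\<^sub>R G x - b (u x) *\<^sub>R G x)) \<longlonglongrightarrow> (\<integral>\<^sup>+(x::'a). 0 \<partial>lborel)"
      unfolding pint_def
    proof (rule nn_integral_dominated_convergence[where w="\<lambda>x. ennreal ((2 * B) powr p) * ennreal (norm (G x) powr p)"])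
      show "(\<integral>\<^sup>+x. ennreal ((2 * B) powr p) * ennreal (norm (G x) powr p) \<partial>lborel) < \<infinity>"
        using G by (simp add: nn_integral_cmult pint_def ennreal_mult_less_top)
      show "AE x in lborel. ennreal (norm (b (\<phi> k x) *\<^sub>R G x - b (u x) *\<^sub>R G x) powr p)
          \<le> ennreal ((2 * B) powr p) * ennreal (norm (G x) powr p)" for k
      proof (rule AE_I2)
        fix x
        have "norm (b (\<phi> k x) *\<^sub>R G x - b (u x) *\<^sub>R G x) = \<bar>b (\<phi> k x) - b (u x)\<bar> * norm (G x)"
          by (simp flip: scaleR_diff_left)
        then have "norm (b (\<phi> k x) *\<^sub>R G x - b (u x) *\<^sub>R G x) powr p = \<bar>b (\<phi> k x) - b (u x)\<bar> powr p * norm (G x) powr p"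
          by (simp add: powr_mult)
        also have "\<dots> \<le> (2 * B) powr p * norm (G x) powr p"
          using b(2)[of "\<phi> k x"] b(2)[of "u x"] p by (intro mult_right_mono powr_mono2) auto
        finally show "ennreal (norm (b (\<phi> k x) *\<^sub>R G x - b (u x) *\<^sub>R G x) powr p)
            \<le> ennreal ((2 * B) powr p) * ennreal (norm (G x) powr p)"
          by (simp add: ennreal_mult[symmetric] ennreal_leI)
      qed
      from AE show "AE x in lborel. (\<lambda>k. ennreal (norm (b (\<phi> k x) *\<^sub>R G x - b (u x) *\<^sub>R G x) powr p)) \<longlonglongrightarrow> 0"
      proof eventually_elim
        case (elim x)
        have "(\<lambda>k. b (\<phi> k x)) \<longlonglongrightarrow> b (u x)"
          using b(1) elim by (auto intro: continuous_on_tendsto_compose)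
        then have "(\<lambda>k. b (\<phi> k x) *\<^sub>R G x - b (u x) *\<^sub>R G x) \<longlonglongrightarrow> b (u x) *\<^sub>R G x - b (u x) *\<^sub>R G x"
          by (intro tendsto_intros)
        then have "(\<lambda>k. norm (b (\<phi> k x) *\<^sub>R G x - b (u x) *\<^sub>R G x) powr p) \<longlonglongrightarrow> 0 powr p"
          using p by (intro tendsto_powr' tendsto_const) (auto intro: tendsto_norm_zero)
        then show ?case using tendsto_ennrealI by fastforce
      qed
    qed auto
    then show ?thesis by simp
  qed
  show ?thesis
    by (rule pint_tendsto_triangle[OF _ _ _ p 1 2]) auto
qed

text \<open>A bounded derivative makes \<open>\<Phi>\<close> Lipschitz, which controls the
  functions; \<open>pint_chain_tendsto\<close> controls the gradients. Smoothness and
  \<open>\<Phi> 0 = 0\<close> keep the composed approximants test functions.\<close>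

lemma W0_chain:
  fixes u :: "real^'n \<Rightarrow> real"
  assumes u: "W0 \<Omega> p u G" and p: "0 < p"
    and der: "\<And>t. (\<Phi> has_real_derivative \<Phi>' t) (at t)" and cont: "continuous_on UNIV \<Phi>'"
    and B: "\<And>t. \<bar>\<Phi>' t\<bar> \<le> B" and 0: "\<Phi> 0 = 0"
    and smooth: "\<And>\<phi> k. (\<And>k. Ck_on k UNIV \<phi>) \<Longrightarrow> Ck_on k UNIV (\<lambda>x::real^'n. \<Phi> (\<phi> x))"
  shows "W0 \<Omega> p (\<lambda>x. \<Phi> (u x)) (\<lambda>x. \<Phi>' (u x) *\<^sub>R G x)"
proof -
  note [measurable] = W0_measurable[OF u]
  obtain \<phi> where \<phi>: "\<And>k::nat. test_function \<Omega> (\<phi> k)" "(\<lambda>k. pint p (\<lambda>x. \<phi> k x - u x)) \<longlonglongrightarrow> 0"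
      "(\<lambda>k. pint p (\<lambda>x. grad (\<phi> k) x - G x)) \<longlonglongrightarrow> 0" "AE x in lborel. (\<lambda>k. \<phi> k x) \<longlonglongrightarrow> u x"
      "AE x in lborel. (\<lambda>k. grad (\<phi> k) x) \<longlonglongrightarrow> G x"
    by (rule W0_sequence[OF u p]) (rule that)
  note [measurable] = test_function_measurable[OF \<phi>(1)]
  have "continuous_on UNIV \<Phi>" using der by (meson DERIV_isCont continuous_at_imp_continuous_on)
  then have [measurable]: "\<Phi> \<in> borel_measurable borel" "\<Phi>' \<in> borel_measurable borel"
    using cont by (auto intro: borel_measurable_continuous_onI)
  have B0: "B \<ge> 0" using B[of 0] by simp
  have lip: "\<bar>\<Phi> s - \<Phi> t\<bar> \<le> B * \<bar>s - t\<bar>" for s t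
    using field_differentiable_bound[of UNIV \<Phi> \<Phi>' B s t] der B by auto
  have test: "test_function \<Omega> (\<lambda>x. \<Phi> (\<phi> k x))" for k
    by (rule test_functionI[OF _ \<phi>(1)[of k]]) (use smooth[of "\<phi> k", OF test_function_Ck_on[OF \<phi>(1)]] 0 in auto)
  have gr: "grad (\<lambda>x. \<Phi> (\<phi> k x)) x = \<Phi>' (\<phi> k x) *\<^sub>R grad (\<phi> k) x" for k x
    using has_derivative_compose[OF test_function_has_derivative[OF \<phi>(1)] der[unfolded has_field_derivative_def]]
    by (intro grad_eqI) simp
  have 1: "(\<lambda>k. pint p (\<lambda>x. \<Phi> (\<phi> k x) - \<Phi> (u x))) \<longlonglongrightarrow> 0"
  proof (rule ennreal_tendsto_0_le)
    show "(\<lambda>k. ennreal (B powr p) * pint p (\<lambda>x. \<phi> k x - u x)) \<longlonglongrightarrow> 0"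
      by (intro ennreal_tendsto_0_cmult \<phi>) auto
    fix k
    have "pint p (\<lambda>x. \<Phi> (\<phi> k x) - \<Phi> (u x)) \<le> (\<integral>\<^sup>+x. ennreal (B powr p) * ennreal (norm (\<phi> k x - u x) powr p) \<partial>lborel)"
      unfolding pint_def
    proof (rule nn_integral_mono)
      fix x
      have "\<bar>\<Phi> (\<phi> k x) - \<Phi> (u x)\<bar> powr p \<le> (B * \<bar>\<phi> k x - u x\<bar>) powr p"
        using lip p by (intro powr_mono2) auto
      then show "ennreal (norm (\<Phi> (\<phi> k x) - \<Phi> (u x)) powr p) \<le> ennreal (B powr p) * ennreal (norm (\<phi> k x - u x) powr p)"
        using B0 by (simp add: powr_mult ennreal_mult[symmetric] ennreal_leI)
    qed
    then show "pint p (\<lambda>x. \<Phi> (\<phi> k x) - \<Phi> (u x)) \<le> ennreal (B powr p) * pint p (\<lambda>x. \<phi> k x - u x)"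
      by (simp add: nn_integral_cmult pint_def)
  qed
  have 2: "(\<lambda>k. pint p (\<lambda>x. grad (\<lambda>x. \<Phi> (\<phi> k x)) x - \<Phi>' (u x) *\<^sub>R G x)) \<longlonglongrightarrow> 0"
    unfolding gr by (rule pint_chain_tendsto[OF _ _ _ _ cont B p \<phi>(4,3)]) (use W0_finite[OF u p] in auto)
  show ?thesis unfolding W0_def
    using 1 2 test by (intro conjI exI[of _ "\<lambda>k x. \<Phi> (\<phi> k x)"]) auto
qed

section \<open>Extending the equation from test functions to \<open>W0\<close>\<close>

lemma nn_integral_inner_le:
  fixes A H :: "'a::euclidean_space \<Rightarrow> 'b::euclidean_space"
  assumes [measurable]: "A \<in> borel_measurable borel" "H \<in> borel_measurable borel"
    and p: "1 < p"
  shows "(\<integral>\<^sup>+x. ennreal \<bar>A x \<bullet> H x\<bar> \<partial>lborel) \<le> epow (pint (p / (p - 1)) A) (1 - 1 / p) * epow (pint p H) (1 / p)"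
proof -
  have pp: "p / (p - 1) * (1 - 1 / p) = 1" using p by (simp add: field_simps)
  have "(\<integral>\<^sup>+x. ennreal \<bar>A x \<bullet> H x\<bar> \<partial>lborel) \<le>
      (\<integral>\<^sup>+x. epow (ennreal (norm (A x) powr (p / (p - 1)))) (1 - 1 / p) * epow (ennreal (norm (H x) powr p)) (1 / p) \<partial>lborel)"
  proof (rule nn_integral_mono)
    fix x
    have "ennreal \<bar>A x \<bullet> H x\<bar> \<le> ennreal (norm (A x) * norm (H x))"
      by (intro ennreal_leI Cauchy_Schwarz_ineq2)
    also have "\<dots> = epow (ennreal (norm (A x) powr (p / (p - 1)))) (1 - 1 / p) * epow (ennreal (norm (H x) powr p)) (1 / p)"
      using p by (simp add: epow_ennreal powr_powr pp ennreal_mult del: times_divide_eq_left)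
    finally show "ennreal \<bar>A x \<bullet> H x\<bar> \<le> epow (ennreal (norm (A x) powr (p / (p - 1)))) (1 - 1 / p) * epow (ennreal (norm (H x) powr p)) (1 / p)" .
  qed
  also have "\<dots> \<le> epow (pint (p / (p - 1)) A) (1 - 1 / p) * epow (pint p H) (1 / p)"
    unfolding pint_def using p by (intro nn_integral_Holder) auto
  finally show ?thesis .
qed

lemma integrable_inner_pint:
  fixes A H :: "'a::euclidean_space \<Rightarrow> 'b::euclidean_space"
  assumes [measurable]: "A \<in> borel_measurable borel" "H \<in> borel_measurable borel"
    and p: "1 < p" and "pint (p / (p - 1)) A < top" "pint p H < top"
  shows "integrable lborel (\<lambda>x. A x \<bullet> H x)"
proof (rule integrableI_bounded)
  have "epow (pint (p / (p - 1)) A) (1 - 1 / p) * epow (pint p H) (1 / p) < top"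
    using assms by (auto simp: ennreal_mult_less_top epow_less_top_iff)
  then show "(\<integral>\<^sup>+x. ennreal (norm (A x \<bullet> H x)) \<partial>lborel) < \<infinity>"
    using nn_integral_inner_le[OF assms(1,2) p] by (auto intro: le_less_trans)
qed auto

lemma integral_inner_tendsto:
  fixes A :: "'a::euclidean_space \<Rightarrow> 'b::euclidean_space"
  assumes [measurable]: "A \<in> borel_measurable borel" "\<And>k. H k \<in> borel_measurable borel" "H' \<in> borel_measurable borel"
    and p: "1 < p" and A: "pint (p / (p - 1)) A < top" and H: "\<And>k::nat. pint p (H k) < top" "pint p H' < top"
    and lim: "(\<lambda>k. pint p (\<lambda>x. H k x - H' x)) \<longlonglongrightarrow> 0"
  shows "(\<lambda>k. \<integral>x. A x \<bullet> H k x \<partial>lborel) \<longlonglongrightarrow> (\<integral>x. A x \<bullet> H' x \<partial>lborel)"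
proof (rule tendsto_L1_int)
  show "integrable lborel (\<lambda>x. A x \<bullet> H k x)" for k
    using assms by (intro integrable_inner_pint) auto
  show "integrable lborel (\<lambda>x. A x \<bullet> H' x)"
    using assms by (intro integrable_inner_pint) auto
  show "(\<lambda>k. \<integral>\<^sup>+x. ennreal (norm (A x \<bullet> H k x - A x \<bullet> H' x)) \<partial>lborel) \<longlonglongrightarrow> 0"
  proof (rule ennreal_tendsto_0_le)
    have "(\<lambda>k. epow (pint p (\<lambda>x. H k x - H' x)) (1 / p)) \<longlonglongrightarrow> epow 0 (1 / p)"
      using p by (intro epow_tendsto lim) auto
    then show "(\<lambda>k. epow (pint (p / (p - 1)) A) (1 - 1 / p) * epow (pint p (\<lambda>x. H k x - H' x)) (1 / p)) \<longlonglongrightarrow> 0"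
      using A by (intro ennreal_tendsto_0_cmult) (auto simp: less_top)
    show "(\<integral>\<^sup>+x. ennreal (norm (A x \<bullet> H k x - A x \<bullet> H' x)) \<partial>lborel)
        \<le> epow (pint (p / (p - 1)) A) (1 - 1 / p) * epow (pint p (\<lambda>x. H k x - H' x)) (1 / p)" for k
      using nn_integral_inner_le[of A "\<lambda>x. H k x - H' x" p] p by (simp add: inner_diff_right)
  qed
qed

text \<open>Both sides are continuous along the approximants of \<open>v\<close>: the left one
  because \<open>A\<close> lies in the dual space for \<open>p\<close> and gradients converge in
  \<open>L^p\<close>, the right one because \<open>g\<close> lies in the dual space for
  \<open>s\<close> and, by Sobolev, the functions converge in \<open>L^s\<close>.\<close>

lemma equation_W0:
  fixes A :: "real^'n \<Rightarrow> real^'n" and p :: real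
  defines "s \<equiv> crit_exp CARD('n) p"
  assumes [measurable]: "A \<in> borel_measurable borel" "g \<in> borel_measurable borel"
    and p: "1 < p" "p < real CARD('n)"
    and A: "pint (p / (p - 1)) A < top" and g: "pint (s / (s - 1)) g < top"
    and eq: "\<And>\<phi>. test_function \<Omega> \<phi> \<Longrightarrow> (\<integral>x. A x \<bullet> grad \<phi> x \<partial>lborel) = (\<integral>x. g x * \<phi> x \<partial>lborel)"
    and v: "W0 \<Omega> p v H"
  shows "integrable lborel (\<lambda>x. A x \<bullet> H x)" "integrable lborel (\<lambda>x. g x * v x)"
    "(\<integral>x. A x \<bullet> H x \<partial>lborel) = (\<integral>x. g x * v x \<partial>lborel)"
proof -
  note [measurable] = W0_measurable[OF v]
  have p0: "0 < p" using p by simp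
  have s: "1 < s"
  proof -
    have "real CARD('n) - p < real CARD('n) * p"
      using p mult_strict_left_mono[OF p(1), of "real CARD('n)"] by (smt (verit) mult_cancel_left2 of_nat_0_less_iff zero_less_card_finite)
    then show ?thesis using p by (simp add: s_def crit_exp_def field_simps)
  qed
  obtain \<phi> where \<phi>: "\<And>k::nat. test_function \<Omega> (\<phi> k)" "(\<lambda>k. pint p (\<lambda>x. \<phi> k x - v x)) \<longlonglongrightarrow> 0"
      "(\<lambda>k. pint p (\<lambda>x. grad (\<phi> k) x - H x)) \<longlonglongrightarrow> 0" "AE x in lborel. (\<lambda>k. \<phi> k x) \<longlonglongrightarrow> v x"
      "AE x in lborel. (\<lambda>k. grad (\<phi> k) x) \<longlonglongrightarrow> H x"
    by (rule W0_sequence[OF v p0]) (rule that)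
  note [measurable] = test_function_measurable[OF \<phi>(1)]
  have sv: "pint s v < top" and slim: "(\<lambda>k. pint s (\<lambda>x. \<phi> k x - v x)) \<longlonglongrightarrow> 0"
    unfolding s_def using W0_Sobolev[OF v p] \<phi> by auto
  show "integrable lborel (\<lambda>x. A x \<bullet> H x)"
    using W0_finite[OF v p0] A p by (intro integrable_inner_pint) auto
  show "integrable lborel (\<lambda>x. g x * v x)"
    using integrable_inner_pint[of g v s] sv g s by simp
  have 1: "(\<lambda>k. \<integral>x. A x \<bullet> grad (\<phi> k) x \<partial>lborel) \<longlonglongrightarrow> (\<integral>x. A x \<bullet> H x \<partial>lborel)"
    using W0_finite[OF v p0] pint_test_function_finite[OF \<phi>(1) p0] A p \<phi>(3)
    by (intro integral_inner_tendsto[where p=p]) auto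
  have "(\<lambda>k. \<integral>x. g x \<bullet> \<phi> k x \<partial>lborel) \<longlonglongrightarrow> (\<integral>x. g x \<bullet> v x \<partial>lborel)"
    using sv pint_test_function_finite(1)[OF \<phi>(1)] g s slim
    by (intro integral_inner_tendsto[where p=s]) auto
  then have "(\<lambda>k. \<integral>x. A x \<bullet> grad (\<phi> k) x \<partial>lborel) \<longlonglongrightarrow> (\<integral>x. g x * v x \<partial>lborel)"
    by (simp add: eq[OF \<phi>(1)])
  with 1 show "(\<integral>x. A x \<bullet> H x \<partial>lborel) = (\<integral>x. g x * v x \<partial>lborel)"
    by (rule LIMSEQ_unique)
qed

section \<open>The rate at which dilations converge\<close>

text \<open>The difference is the integral over \<open>t\<close> in \<open>{1..c}\<close> of the
  derivative along the ray. Hoelder in \<open>t\<close> gives \<open>c - 1\<close> to the power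
  \<open>p - 1\<close>; after exchanging the integrals, the \<open>t\<close>-integration contributes
  the missing factor \<open>c - 1\<close>.\<close>

lemma test_function_dilation_difference:
  fixes c R :: real and \<phi> :: "real^'n \<Rightarrow> real"
  assumes \<phi>: "test_function \<Omega> \<phi>" and \<Omega>: "\<Omega> \<subseteq> cball 0 R" and p: "1 < p" and c: "c \<ge> 1"
  shows "pint p (\<lambda>x. \<phi> (c *\<^sub>R x) - \<phi> x) \<le> ennreal (((c - 1) * R) powr p) * pint p (grad \<phi>)"
proof (cases "\<Omega> = {}")
  case True
  then have "\<phi> x = 0" for x using test_function_eq_0[OF \<phi>] by simp
  then show ?thesis by (simp add: pint_def)
next
  case False
  then have R: "R \<ge> 0" using \<Omega> by (metis cball_empty not_le subset_empty)
  note [measurable] = test_function_measurable[OF \<phi>]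
  define I where "I t = (indicator {1..c} t :: ennreal)" for t
  have [measurable]: "I \<in> borel_measurable borel" unfolding I_def by measurable
  define N where "N t x = ennreal (norm (grad \<phi> (t *\<^sub>R x)) powr p)" for t :: real and x :: "real^'n"
  have [measurable]: "(\<lambda>(x, t). N t x) \<in> borel_measurable (borel \<Otimes>\<^sub>M borel)" unfolding N_def by measurable
  have pt: "ennreal (norm (\<phi> (c *\<^sub>R x) - \<phi> x) powr p) \<le>
      ennreal ((c - 1) powr (p - 1) * R powr p) * (\<integral>\<^sup>+t. I t * N t x \<partial>lborel)" for x
  proof -
    define g' where "g' t = grad \<phi> (t *\<^sub>R x) \<bullet> x" for t
    have [measurable]: "g' \<in> borel_measurable borel" unfolding g'_def by measurable
    have der: "((\<lambda>t. \<phi> (t *\<^sub>R x)) has_real_derivative g' t) (at t)" for t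
    proof -
      have "((\<lambda>t. t *\<^sub>R x) has_derivative (\<lambda>h. h *\<^sub>R x)) (at t)" by (auto intro!: derivative_eq_intros)
      from has_derivative_compose[OF this test_function_has_derivative[OF \<phi>]]
      show ?thesis unfolding has_field_derivative_def
        by (rule has_derivative_eq_rhs) (auto simp: fun_eq_iff g'_def)
    qed
    have cont: "continuous_on UNIV g'" unfolding g'_def
      by (intro continuous_intros continuous_on_compose2[OF continuous_on_grad_test_function[OF \<phi>]]) auto
    have hb: "has_bochner_integral lborel (\<lambda>t. indicator {1..c} t *\<^sub>R g' t) (\<phi> (c *\<^sub>R x) - \<phi> (1 *\<^sub>R x))"
      using c der cont by (intro has_bochner_integral_FTC_Icc)
        (auto simp: has_real_derivative_iff_has_vector_derivative[symmetric] intro: DERIV_subset continuous_on_subset)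
    then have "\<phi> (c *\<^sub>R x) - \<phi> x = (\<integral>t. indicator {1..c} t *\<^sub>R g' t \<partial>lborel)"
      by (simp add: has_bochner_integral_iff)
    then have "ennreal (norm (\<phi> (c *\<^sub>R x) - \<phi> x)) \<le> (\<integral>\<^sup>+t. norm (indicator {1..c} t *\<^sub>R g' t) \<partial>lborel)"
      using integral_norm_bound_ennreal hb by (metis has_bochner_integral_iff)
    \<comment> \<open>The indicator \<open>I\<close> is placed in both Hoelder factors, since the
      first one must integrate to \<open>c - 1\<close>.\<close>
    also have "\<dots> = (\<integral>\<^sup>+t. epow (I t) (1 - 1 / p) * epow (I t * ennreal (\<bar>g' t\<bar> powr p)) (1 / p) \<partial>lborel)"
      using p by (intro nn_integral_cong) (auto simp: I_def indicator_def epow_ennreal powr_powr)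
    also have "\<dots> \<le> epow (\<integral>\<^sup>+t. I t \<partial>lborel) (1 - 1 / p) * epow (\<integral>\<^sup>+t. I t * ennreal (\<bar>g' t\<bar> powr p) \<partial>lborel) (1 / p)"
      using p by (intro nn_integral_Holder) auto
    also have "(\<integral>\<^sup>+t. I t \<partial>lborel) = ennreal (c - 1)" using c by (simp add: I_def)
    also have "(\<integral>\<^sup>+t. I t * ennreal (\<bar>g' t\<bar> powr p) \<partial>lborel) \<le> (\<integral>\<^sup>+t. ennreal (R powr p) * (I t * N t x) \<partial>lborel)"
    proof (rule nn_integral_mono)
      fix t
      show "I t * ennreal (\<bar>g' t\<bar> powr p) \<le> ennreal (R powr p) * (I t * N t x)"
      \<comment> \<open>The bound \<open>norm x \<le> R\<close> follows from
        \<open>t \<ge> 1\<close> where \<open>t *\<^sub>R x\<close> lies in \<Omega>; elsewhere the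
        gradient is 0.\<close>
      proof (cases "t \<in> {1..c} \<and> t *\<^sub>R x \<in> \<Omega>")
        case True
        have "norm x \<le> t * norm x" using True mult_right_mono[of 1 t "norm x"] by simp
        also have "\<dots> \<le> R" using True \<Omega> by (auto simp: subset_iff)
        finally have "\<bar>g' t\<bar> \<le> norm (grad \<phi> (t *\<^sub>R x)) * R"
          unfolding g'_def by (meson Cauchy_Schwarz_ineq2 mult_left_mono norm_ge_zero order_trans)
        then have "\<bar>g' t\<bar> powr p \<le> (norm (grad \<phi> (t *\<^sub>R x)) * R) powr p" using p by (intro powr_mono2) auto
        also have "\<dots> = R powr p * norm (grad \<phi> (t *\<^sub>R x)) powr p" using R by (simp add: powr_mult)
        finally show ?thesis using True
          by (simp add: I_def N_def ennreal_mult[symmetric] ennreal_leI)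
      next
        case False
        then have "I t = 0 \<or> g' t = 0"
          using test_function_eq_0[OF \<phi>, of "t *\<^sub>R x"] by (auto simp: I_def g'_def)
        then show ?thesis by auto
      qed
    qed
    also have "\<dots> = ennreal (R powr p) * (\<integral>\<^sup>+t. I t * N t x \<partial>lborel)"
      by (rule nn_integral_cmult) measurable
    finally have le: "ennreal (norm (\<phi> (c *\<^sub>R x) - \<phi> x)) \<le>
        epow (ennreal (c - 1)) (1 - 1 / p) * epow (ennreal (R powr p) * (\<integral>\<^sup>+t. I t * N t x \<partial>lborel)) (1 / p)"
      using p by (simp add: epow_mono mult_left_mono)
    have "ennreal (norm (\<phi> (c *\<^sub>R x) - \<phi> x) powr p) = epow (ennreal (norm (\<phi> (c *\<^sub>R x) - \<phi> x))) p"
      by (simp add: epow_ennreal)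
    also have "\<dots> \<le> epow (epow (ennreal (c - 1)) (1 - 1 / p) * epow (ennreal (R powr p) * (\<integral>\<^sup>+t. I t * N t x \<partial>lborel)) (1 / p)) p"
      using p le by (intro epow_mono) auto
    also have "\<dots> = ennreal ((c - 1) powr (p - 1)) * (ennreal (R powr p) * (\<integral>\<^sup>+t. I t * N t x \<partial>lborel))"
      using p c R by (simp add: epow_mult epow_epow epow_ennreal powr_powr left_diff_distrib)
    finally show ?thesis by (simp add: ennreal_mult mult.assoc)
  qed
  have "pint p (\<lambda>x. \<phi> (c *\<^sub>R x) - \<phi> x) \<le> (\<integral>\<^sup>+x. ennreal ((c - 1) powr (p - 1) * R powr p) * (\<integral>\<^sup>+t. I t * N t x \<partial>lborel) \<partial>lborel)"
    unfolding pint_def by (intro nn_integral_mono pt)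
  also have "\<dots> = ennreal ((c - 1) powr (p - 1) * R powr p) * (\<integral>\<^sup>+x. \<integral>\<^sup>+t. I t * N t x \<partial>lborel \<partial>lborel)"
    by (rule nn_integral_cmult) measurable
  also have "(\<integral>\<^sup>+x. \<integral>\<^sup>+t. I t * N t x \<partial>lborel \<partial>lborel) = (\<integral>\<^sup>+t. \<integral>\<^sup>+x. I t * N t x \<partial>lborel \<partial>lborel)"
    by (rule lborel_pair.Fubini') measurable
  also have "\<dots> \<le> (\<integral>\<^sup>+t. I t * pint p (grad \<phi>) \<partial>lborel)"
  proof (rule nn_integral_mono)
    fix t
    show "(\<integral>\<^sup>+x. I t * N t x \<partial>lborel) \<le> I t * pint p (grad \<phi>)"
    proof (cases "t \<in> {1..c}")
      case True
      have "(\<integral>\<^sup>+x. N t x \<partial>lborel) = ennreal (t powr (- CARD('n))) * pint p (grad \<phi>)"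
        using True pint_scale[of "grad \<phi>" t p] by (simp add: N_def pint_def)
      \<comment> \<open>The Jacobian factor is at most 1 because \<open>t \<ge> 1\<close>, so the
        estimate is uniform in \<open>t\<close>.\<close>
      also have "\<dots> \<le> 1 * pint p (grad \<phi>)"
        using True by (intro mult_right_mono) (use powr_mono[of "- real CARD('n)" 0 t] in auto)
      finally show ?thesis using True by (simp add: I_def)
    qed (simp add: I_def)
  qed
  also have "(\<integral>\<^sup>+t. I t * pint p (grad \<phi>) \<partial>lborel) = ennreal (c - 1) * pint p (grad \<phi>)"
    using c by (simp add: nn_integral_multc I_def)
  finally have "pint p (\<lambda>x. \<phi> (c *\<^sub>R x) - \<phi> x) \<le> ennreal ((c - 1) powr (p - 1) * R powr p) * (ennreal (c - 1) * pint p (grad \<phi>))"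
    by (simp add: mult_left_mono)
  also have "\<dots> = ennreal ((c - 1) powr (p - 1) * R powr p * (c - 1)) * pint p (grad \<phi>)"
    using c by (simp add: ennreal_mult mult.assoc)
  also have "(c - 1) powr (p - 1) * R powr p * (c - 1) = ((c - 1) * R) powr p"
    using c R powr_mult_base[of "c - 1" "p - 1"] by (simp add: powr_mult mult_ac)
  finally show ?thesis .
qed

text \<open>Fatou's lemma along test functions; \<open>2 powr p\<close> is again the cost of
  comparing their gradients with \<open>G\<close>.\<close>

lemma W0_dilation_difference:
  fixes c R :: real
  assumes u: "W0 \<Omega> p u G" and \<Omega>: "\<Omega> \<subseteq> cball 0 R" and p: "1 < p" and c: "c \<ge> 1"
  shows "pint p (\<lambda>x. u (c *\<^sub>R x) - u x) \<le> ennreal (2 powr p * ((c - 1) * R) powr p) * pint p G"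
proof -
  have p0: "0 < p" using p by simp
  note [measurable] = W0_measurable[OF u]
  obtain \<phi> where \<phi>: "\<And>k::nat. test_function \<Omega> (\<phi> k)" "(\<lambda>k. pint p (\<lambda>x. \<phi> k x - u x)) \<longlonglongrightarrow> 0"
      "(\<lambda>k. pint p (\<lambda>x. grad (\<phi> k) x - G x)) \<longlonglongrightarrow> 0" "AE x in lborel. (\<lambda>k. \<phi> k x) \<longlonglongrightarrow> u x"
      "AE x in lborel. (\<lambda>k. grad (\<phi> k) x) \<longlonglongrightarrow> G x"
    by (rule W0_sequence[OF u p0]) (rule that)
  note [measurable] = test_function_measurable[OF \<phi>(1)]
  define K where "K = ennreal (((c - 1) * R) powr p)"
  have le: "pint p (\<lambda>x. \<phi> k (c *\<^sub>R x) - \<phi> k x) \<le> K * (ennreal (2 powr p) * (pint p (\<lambda>x. grad (\<phi> k) x - G x) + pint p G))" for k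
  proof -
    have "pint p (\<lambda>x. grad (\<phi> k) x - 0) \<le> ennreal (2 powr p) * (pint p (\<lambda>x. grad (\<phi> k) x - G x) + pint p (\<lambda>x. G x - 0))"
      by (rule pint_triangle) (use p in auto)
    then have "pint p (grad (\<phi> k)) \<le> ennreal (2 powr p) * (pint p (\<lambda>x. grad (\<phi> k) x - G x) + pint p G)" by simp
    then show ?thesis
      using order_trans[OF test_function_dilation_difference[OF \<phi>(1)[of k] \<Omega> p c] mult_left_mono] unfolding K_def
      by auto
  qed
  \<comment> \<open>Dilations preserve null sets: \<open>g\<close> is the indicator of the set
    without convergence, and its integral scales by a constant.\<close>
  have "AE x in lborel. (\<lambda>k. \<phi> k (c *\<^sub>R x)) \<longlonglongrightarrow> u (c *\<^sub>R x)"
  proof -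
    define g where "g x = (if (\<lambda>k. \<phi> k x) \<longlonglongrightarrow> u x then 0 else 1 :: ennreal)" for x
    have [measurable]: "g \<in> borel_measurable borel" unfolding g_def by measurable
    have "(\<integral>\<^sup>+x. g x \<partial>lborel) = 0" using \<phi>(4) by (subst nn_integral_0_iff_AE) (auto simp: g_def)
    then have "(\<integral>\<^sup>+x. g (c *\<^sub>R x) \<partial>lborel) = 0" using c by (subst lborel_nn_integral_scale) auto
    then have "AE x in lborel. g (c *\<^sub>R x) = 0" by (subst (asm) nn_integral_0_iff_AE) auto
    then show ?thesis by eventually_elim (auto simp: g_def split: if_splits)
  qed
  with \<phi>(4) have AE: "AE x in lborel. (\<lambda>k. ennreal (norm (\<phi> k (c *\<^sub>R x) - \<phi> k x) powr p)) \<longlonglongrightarrow> ennreal (norm (u (c *\<^sub>R x) - u x) powr p)"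
  proof eventually_elim
    case (elim x)
    show ?case using p by (intro tendsto_ennrealI tendsto_powr' tendsto_norm tendsto_diff elim tendsto_const) auto
  qed
  have "pint p (\<lambda>x. u (c *\<^sub>R x) - u x) = (\<integral>\<^sup>+x. liminf (\<lambda>k. ennreal (norm (\<phi> k (c *\<^sub>R x) - \<phi> k x) powr p)) \<partial>lborel)"
    unfolding pint_def by (rule nn_integral_cong_AE) (use AE in \<open>eventually_elim, auto intro!: lim_imp_Liminf[symmetric]\<close>)
  also have "\<dots> \<le> liminf (\<lambda>k. pint p (\<lambda>x. \<phi> k (c *\<^sub>R x) - \<phi> k x))"
    unfolding pint_def by (rule nn_integral_liminf) measurable
  also have "\<dots> \<le> liminf (\<lambda>k. K * (ennreal (2 powr p) * (pint p (\<lambda>x. grad (\<phi> k) x - G x) + pint p G)))"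
    by (intro Liminf_mono always_eventually allI le)
  also have "\<dots> = K * (ennreal (2 powr p) * (0 + pint p G))"
    by (intro lim_imp_Liminf ennreal_tendsto_cmult tendsto_add \<phi> tendsto_const) (auto simp: K_def)
  finally show ?thesis by (simp add: K_def ennreal_mult mult_ac)
qed

section \<open>Higher integrability of solutions\<close>

text \<open>A bounded smooth version of \<open>1 + t\<^sup>2\<close>, to which it tends as
  \<epsilon> goes to 0. Its values lie between 1 and both \<open>1 / \<epsilon>\<close> and
  \<open>1 + t\<^sup>2\<close>; the lower bound makes real powers harmless.\<close>

definition cut_ratio :: "real \<Rightarrow> real \<Rightarrow> real" where
  "cut_ratio \<epsilon> t = (1 + t\<^sup>2) / (1 + \<epsilon> * t\<^sup>2)"

text \<open>The logarithmic derivative of \<open>cut_ratio\<close>, multiplied by \<open>t\<close>.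
  Its bounds 0 and 2 do not depend on \<epsilon>.\<close>

definition cut_slope :: "real \<Rightarrow> real \<Rightarrow> real" where
  "cut_slope \<epsilon> t = 2 * t\<^sup>2 * (1 - \<epsilon>) / ((1 + \<epsilon> * t\<^sup>2) * (1 + t\<^sup>2))"

text \<open>A smooth substitute for the truncated power \<open>t * min \<bar>t\<bar> L powr (2 * c)\<close>, where \<open>\<epsilon>\<close> corresponds
  to \<open>1 / L\<^sup>2\<close>.\<close>

definition cut_power :: "real \<Rightarrow> real \<Rightarrow> real \<Rightarrow> real" where
  "cut_power \<epsilon> c t = t * cut_ratio \<epsilon> t powr c"

definition cut_power_deriv :: "real \<Rightarrow> real \<Rightarrow> real \<Rightarrow> real" where
  "cut_power_deriv \<epsilon> c t = cut_ratio \<epsilon> t powr c * (1 + c * cut_slope \<epsilon> t)"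

context
  fixes \<epsilon> :: real assumes \<epsilon>: "0 < \<epsilon>" "\<epsilon> < 1"
begin

lemma cut_denominator_pos: "0 < 1 + \<epsilon> * t\<^sup>2" "0 < 1 + t\<^sup>2"
  using \<epsilon> by (auto intro!: add_pos_nonneg)

lemma cut_ratio_bounds: "1 \<le> cut_ratio \<epsilon> t" "cut_ratio \<epsilon> t \<le> 1 / \<epsilon>" "cut_ratio \<epsilon> t \<le> 1 + t\<^sup>2"
proof -
  have "\<epsilon> * t\<^sup>2 \<le> 1 * t\<^sup>2" using \<epsilon> by (intro mult_right_mono) auto
  then show "1 \<le> cut_ratio \<epsilon> t" using cut_denominator_pos[of t] by (simp add: cut_ratio_def)
  show "cut_ratio \<epsilon> t \<le> 1 / \<epsilon>" using cut_denominator_pos[of t] \<epsilon>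
    by (simp add: cut_ratio_def field_simps)
  have "1 + t\<^sup>2 \<le> (1 + t\<^sup>2) * (1 + \<epsilon> * t\<^sup>2)"
    using \<epsilon> mult_left_mono[of 1 "1 + \<epsilon> * t\<^sup>2" "1 + t\<^sup>2"] by simp
  then show "cut_ratio \<epsilon> t \<le> 1 + t\<^sup>2" using cut_denominator_pos[of t]
    by (simp add: cut_ratio_def pos_divide_le_eq)
qed

lemma cut_slope_bounds: "0 \<le> cut_slope \<epsilon> t" "cut_slope \<epsilon> t \<le> 2"
proof -
  show "0 \<le> cut_slope \<epsilon> t" using cut_denominator_pos[of t] \<epsilon> by (simp add: cut_slope_def)
  have "t\<^sup>2 * (1 - \<epsilon>) \<le> t\<^sup>2 * 1" using \<epsilon> by (intro mult_left_mono) auto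
  also have "\<dots> \<le> (1 + \<epsilon> * t\<^sup>2) * (1 + t\<^sup>2)" using \<epsilon> by (simp add: algebra_simps)
  finally have "2 * t\<^sup>2 * (1 - \<epsilon>) \<le> 2 * ((1 + \<epsilon> * t\<^sup>2) * (1 + t\<^sup>2))" by linarith
  then show "cut_slope \<epsilon> t \<le> 2" using cut_denominator_pos[of t]
    unfolding cut_slope_def by (subst pos_divide_le_eq) auto
qed

lemma DERIV_cut_power: "(cut_power \<epsilon> c has_real_derivative cut_power_deriv \<epsilon> c t) (at t)"
proof -
  define D where "D = 1 + \<epsilon> * t\<^sup>2"
  have D: "D > 0" and N: "1 + t\<^sup>2 > 0" using cut_denominator_pos[of t] by (auto simp: D_def)
  have r: "cut_ratio \<epsilon> t > 0" using cut_ratio_bounds(1)[of t] by simp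
  have "(cut_ratio \<epsilon> has_real_derivative (2 * t * D - (1 + t\<^sup>2) * (\<epsilon> * (2 * t))) / (D * D)) (at t)"
    unfolding cut_ratio_def[abs_def] D_def
    using D by (auto intro!: derivative_eq_intros simp: D_def)
  also have "2 * t * D - (1 + t\<^sup>2) * (\<epsilon> * (2 * t)) = 2 * t * (1 - \<epsilon>)" by (simp add: D_def algebra_simps)
  finally have dr: "(cut_ratio \<epsilon> has_real_derivative 2 * t * (1 - \<epsilon>) / (D * D)) (at t)" .
  have "cut_slope \<epsilon> t = t * (2 * t * (1 - \<epsilon>) / (D * D)) / cut_ratio \<epsilon> t"
    unfolding cut_slope_def cut_ratio_def D_def[symmetric]
    using D N by (simp add: power2_eq_square del: mult_eq_0_iff)
  then have sl: "cut_ratio \<epsilon> t powr c * cut_slope \<epsilon> t = t * (cut_ratio \<epsilon> t powr (c - 1) * (2 * t * (1 - \<epsilon>) / (D * D)))"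
    using r by (simp add: powr_diff mult_ac)
  have "((\<lambda>t. cut_ratio \<epsilon> t powr c) has_real_derivative c * cut_ratio \<epsilon> t powr (c - 1) * (2 * t * (1 - \<epsilon>) / (D * D))) (at t)"
    using DERIV_fun_powr[OF dr r, of c] by simp
  from DERIV_mult[OF DERIV_ident this]
  show ?thesis unfolding cut_power_def[abs_def]
    by (rule DERIV_cong) (use arg_cong[OF sl, of "(*) c"] in \<open>simp add: cut_power_deriv_def algebra_simps\<close>)
qed

lemma continuous_on_cut_power_deriv: "continuous_on UNIV (cut_power_deriv \<epsilon> c)"
proof -
  have nz: "1 + \<epsilon> * t\<^sup>2 \<noteq> 0" "1 + t\<^sup>2 \<noteq> 0" "cut_ratio \<epsilon> t \<noteq> 0" for t
    using cut_denominator_pos[of t] cut_ratio_bounds(1)[of t] by auto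
  have 1: "continuous_on UNIV (cut_ratio \<epsilon>)"
    unfolding cut_ratio_def[abs_def] using nz by (intro continuous_intros) auto
  have 2: "continuous_on UNIV (cut_slope \<epsilon>)"
    unfolding cut_slope_def[abs_def] using nz by (intro continuous_intros) auto
  show ?thesis unfolding cut_power_deriv_def[abs_def]
    using nz by (intro continuous_intros 1 2) auto
qed

text \<open>The first two bounds make the derivative comparable to
  \<open>cut_ratio \<epsilon> t powr c\<close> uniformly in \<epsilon>, as the energy estimate
  demands. The third depends on \<epsilon> and serves the chain rule only.\<close>

lemma cut_power_deriv_bounds:
  assumes "0 \<le> c"
  shows "cut_ratio \<epsilon> t powr c \<le> cut_power_deriv \<epsilon> c t" "cut_power_deriv \<epsilon> c t \<le> (1 + 2 * c) * cut_ratio \<epsilon> t powr c"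
    "\<bar>cut_power_deriv \<epsilon> c t\<bar> \<le> (1 + 2 * c) * (1 / \<epsilon>) powr c"
proof -
  have c: "0 \<le> c * cut_slope \<epsilon> t" "c * cut_slope \<epsilon> t \<le> c * 2"
    using cut_slope_bounds[of t] assms by (auto intro: mult_left_mono)
  show 1: "cut_ratio \<epsilon> t powr c \<le> cut_power_deriv \<epsilon> c t"
    using mult_left_mono[of 1 "1 + c * cut_slope \<epsilon> t" "cut_ratio \<epsilon> t powr c"] c by (simp add: cut_power_deriv_def)
  show 2: "cut_power_deriv \<epsilon> c t \<le> (1 + 2 * c) * cut_ratio \<epsilon> t powr c"
    using mult_left_mono[of "1 + c * cut_slope \<epsilon> t" "1 + 2 * c" "cut_ratio \<epsilon> t powr c"] c by (simp add: cut_power_deriv_def mult.commute)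
  have "cut_ratio \<epsilon> t powr c \<le> (1 / \<epsilon>) powr c"
    using cut_ratio_bounds[of t] assms by (intro powr_mono2) auto
  then have "(1 + 2 * c) * cut_ratio \<epsilon> t powr c \<le> (1 + 2 * c) * (1 / \<epsilon>) powr c"
    using assms by (intro mult_left_mono) auto
  moreover have "0 \<le> cut_ratio \<epsilon> t powr c" by simp
  ultimately show "\<bar>cut_power_deriv \<epsilon> c t\<bar> \<le> (1 + 2 * c) * (1 / \<epsilon>) powr c" using 1 2 by linarith
qed

lemma cut_power_nat: "cut_power \<epsilon> (real m) t = t * cut_ratio \<epsilon> t ^ m"
  using cut_ratio_bounds(1)[of t] by (simp add: cut_power_def powr_realpow)

text \<open>For a natural exponent the cut power is a rational function with positive denominator.
  Therefore the equation is tested with exponent \<open>m\<close>, while the real exponent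
  \<open>m / p\<close> occurs only in the Sobolev inequality.\<close>

lemma Ck_on_cut_power:
  fixes \<phi> :: "'a::real_normed_vector \<Rightarrow> real"
  assumes "Ck_on k UNIV \<phi>"
  shows "Ck_on k UNIV (\<lambda>x. cut_power \<epsilon> (real m) (\<phi> x))"
proof -
  have "1 + \<epsilon> * (\<phi> x * \<phi> x) \<noteq> 0" for x
    using cut_denominator_pos(1)[of "\<phi> x"] by (simp add: power2_eq_square)
  then have "Ck_on k UNIV (\<lambda>x. \<phi> x * ((1 + \<phi> x * \<phi> x) / (1 + \<epsilon> * (\<phi> x * \<phi> x))) ^ m)"
    by (intro Ck_on_mult Ck_on_power Ck_on_divide Ck_on_add Ck_on_const assms)
  then show ?thesis by (simp only: cut_power_nat) (simp add: cut_ratio_def power2_eq_square)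
qed

end

lemma ennreal_integral_le_nn_integral:
  fixes f :: "'a \<Rightarrow> real"
  assumes "integrable M f" shows "ennreal (\<integral>x. f x \<partial>M) \<le> (\<integral>\<^sup>+x. ennreal (f x) \<partial>M)"
proof -
  have "(\<integral>x. f x \<partial>M) \<le> (\<integral>x. max 0 (f x) \<partial>M)"
    using assms by (intro integral_mono) auto
  then have "ennreal (\<integral>x. f x \<partial>M) \<le> ennreal (\<integral>x. max 0 (f x) \<partial>M)" by (rule ennreal_leI)
  also have "\<dots> = (\<integral>\<^sup>+x. ennreal (max 0 (f x)) \<partial>M)"
    using assms by (intro nn_integral_eq_integral[symmetric]) auto
  finally show ?thesis by (simp add: max_def ennreal_neg cong: if_cong) (smt (verit) ennreal_neg nn_integral_cong)
qed

text \<open>The energy estimate of Brezis and Kato: testing with \<open>cut_power \<epsilon> m \<circ> u\<close> bounds \<open>Z\<close> by a multiple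
  of an integral in which, on \<open>{|u| > K}\<close>, \<open>Z\<close> reappears with a small factor.\<close>

lemma cut_power_energy:
  fixes u :: "real^'n \<Rightarrow> real" and p :: real and m :: nat
  defines "n \<equiv> real CARD('n)" and "s \<equiv> crit_exp CARD('n) p"
  assumes u: "W0 \<Omega> p u G" and p: "1 < p" "p < n"
    and A: "A = (\<lambda>x. norm (G x) powr (p - 2) *\<^sub>R G x)" and [measurable]: "g \<in> borel_measurable borel"
    and eq: "\<And>v H. W0 \<Omega> p v H \<Longrightarrow> integrable lborel (\<lambda>x. A x \<bullet> H x) \<and> integrable lborel (\<lambda>x. g x * v x)
        \<and> (\<integral>x. A x \<bullet> H x \<partial>lborel) = (\<integral>x. g x * v x \<partial>lborel)"
    and g: "\<And>x t. u x * t \<ge> 0 \<Longrightarrow> g x * t \<le> M * \<bar>u x\<bar> powr (s - 1) * \<bar>t\<bar>" and M: "M \<ge> 0"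
    and \<epsilon>: "0 < \<epsilon>" "\<epsilon> < 1"
  shows "pint s (\<lambda>x. cut_power \<epsilon> (m / p) (u x)) \<le>
    epow (ennreal ((p * (n - 1) / (n - p)) powr p * 2 powr p * (1 + 2 * m / p) powr p * M) *
      (\<integral>\<^sup>+x. ennreal (\<bar>u x\<bar> powr s * cut_ratio \<epsilon> (u x) powr m) \<partial>lborel)) (n / (n - p))"
proof -
  note [measurable] = W0_measurable[OF u]
  have p0: "0 < p" using p by simp
  \<comment> \<open>With this \<open>c\<close> the \<open>p\<close>-th power of
    \<open>cut_ratio powr c\<close> is \<open>cut_ratio powr m\<close>, the weight that the test
    function of exponent \<open>m\<close> puts on \<open>norm (G x) powr p\<close>.\<close>
  define c where "c = real m / p"
  have c: "c \<ge> 0" using p by (simp add: c_def)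
  define C0 where "C0 = (p * (n - 1) / (n - p)) powr p * 2 powr p"
  have [measurable]: "cut_ratio \<epsilon> \<in> borel_measurable borel" "cut_slope \<epsilon> \<in> borel_measurable borel"
    unfolding cut_ratio_def[abs_def] cut_slope_def[abs_def] by measurable
  have [measurable]: "cut_power \<epsilon> b \<in> borel_measurable borel" "cut_power_deriv \<epsilon> b \<in> borel_measurable borel" for b
    unfolding cut_power_def[abs_def] cut_power_deriv_def[abs_def] by measurable
  have W: "W0 \<Omega> p (\<lambda>x. cut_power \<epsilon> (real m) (u x)) (\<lambda>x. cut_power_deriv \<epsilon> (real m) (u x) *\<^sub>R G x)"
  proof (rule W0_chain[OF u p0 DERIV_cut_power[OF \<epsilon>] continuous_on_cut_power_deriv[OF \<epsilon>] cut_power_deriv_bounds(3)[OF \<epsilon>]])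
    show "Ck_on k UNIV (\<lambda>x. cut_power \<epsilon> (real m) (\<phi> x))" if "\<And>k. Ck_on k UNIV \<phi>" for \<phi> :: "real^'n \<Rightarrow> real" and k
      by (rule Ck_on_cut_power[OF \<epsilon> that])
  qed (auto simp: cut_power_def)
  have AH: "A x \<bullet> (cut_power_deriv \<epsilon> (real m) (u x) *\<^sub>R G x) = cut_power_deriv \<epsilon> (real m) (u x) * norm (G x) powr p" for x
  proof -
    have "norm (G x) powr (p - 2) * (G x \<bullet> G x) = norm (G x) powr p"
    proof (cases "G x = 0")
      case False
      then have "G x \<bullet> G x = norm (G x) powr 2" by (simp add: power2_norm_eq_inner)
      then show ?thesis by (simp only: powr_add[symmetric]) simp
    qed simp
    then show ?thesis by (simp add: A mult.left_commute)
  qed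
  have nn: "0 \<le> cut_power_deriv \<epsilon> (real m) t" for t
    using cut_power_deriv_bounds(1)[OF \<epsilon>, of "real m" t] by (auto intro: order_trans[OF powr_ge_zero])
  have E: "(\<integral>\<^sup>+x. ennreal (cut_power_deriv \<epsilon> (real m) (u x) * norm (G x) powr p) \<partial>lborel) \<le>
      ennreal M * (\<integral>\<^sup>+x. ennreal (\<bar>u x\<bar> powr s * cut_ratio \<epsilon> (u x) powr m) \<partial>lborel)"
  proof -
    note W' = eq[OF W, unfolded AH]
    have "(\<integral>\<^sup>+x. ennreal (cut_power_deriv \<epsilon> (real m) (u x) * norm (G x) powr p) \<partial>lborel) =
        ennreal (\<integral>x. cut_power_deriv \<epsilon> (real m) (u x) * norm (G x) powr p \<partial>lborel)"
      using W' nn by (intro nn_integral_eq_integral) auto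
    also have "\<dots> = ennreal (\<integral>x. g x * cut_power \<epsilon> (real m) (u x) \<partial>lborel)" using W' by simp
    \<comment> \<open>Only an upper bound for the integrand is at hand, so its integral is first
      dominated by that of its positive part.\<close>
    also have "\<dots> \<le> (\<integral>\<^sup>+x. ennreal (g x * cut_power \<epsilon> (real m) (u x)) \<partial>lborel)"
      using W' by (intro ennreal_integral_le_nn_integral) auto
    also have "\<dots> \<le> (\<integral>\<^sup>+x. ennreal M * ennreal (\<bar>u x\<bar> powr s * cut_ratio \<epsilon> (u x) powr m) \<partial>lborel)"
    proof (rule nn_integral_mono)
      fix x
      have "g x * cut_power \<epsilon> (real m) (u x) \<le> M * \<bar>u x\<bar> powr (s - 1) * \<bar>cut_power \<epsilon> (real m) (u x)\<bar>"
        by (rule g) (simp add: cut_power_def mult.assoc[symmetric])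
      also have "\<dots> = M * (\<bar>u x\<bar> powr (s - 1) * \<bar>u x\<bar> * cut_ratio \<epsilon> (u x) powr m)"
        by (simp add: cut_power_def abs_mult)
      also have "\<bar>u x\<bar> powr (s - 1) * \<bar>u x\<bar> = \<bar>u x\<bar> powr s"
        using powr_mult_base[of "\<bar>u x\<bar>" "s - 1"] by (simp add: mult.commute)
      finally show "ennreal (g x * cut_power \<epsilon> (real m) (u x)) \<le> ennreal M * ennreal (\<bar>u x\<bar> powr s * cut_ratio \<epsilon> (u x) powr m)"
        using M by (simp add: ennreal_mult[symmetric] ennreal_leI)
    qed
    also have "\<dots> = ennreal M * (\<integral>\<^sup>+x. ennreal (\<bar>u x\<bar> powr s * cut_ratio \<epsilon> (u x) powr m) \<partial>lborel)"
      by (rule nn_integral_cmult) measurable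
    finally show ?thesis .
  qed
  \<comment> \<open>The derivative of the cut power of exponent \<open>c\<close> is at most
    \<open>1 + 2 * c\<close> times the pure weight, whose \<open>p\<close>-th power the derivative
    for exponent \<open>m\<close> bounds from above.\<close>
  have E2: "pint p (\<lambda>x. cut_power_deriv \<epsilon> c (u x) *\<^sub>R G x) \<le>
      ennreal ((1 + 2 * c) powr p) * (\<integral>\<^sup>+x. ennreal (cut_power_deriv \<epsilon> (real m) (u x) * norm (G x) powr p) \<partial>lborel)"
  proof -
    have "pint p (\<lambda>x. cut_power_deriv \<epsilon> c (u x) *\<^sub>R G x) \<le>
        (\<integral>\<^sup>+x. ennreal ((1 + 2 * c) powr p) * ennreal (cut_power_deriv \<epsilon> (real m) (u x) * norm (G x) powr p) \<partial>lborel)"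
      unfolding pint_def
    proof (rule nn_integral_mono)
      fix x
      define r where "r = cut_ratio \<epsilon> (u x)"
      have b: "r powr c \<le> cut_power_deriv \<epsilon> c (u x)" "cut_power_deriv \<epsilon> c (u x) \<le> (1 + 2 * c) * r powr c"
        using cut_power_deriv_bounds[OF \<epsilon> c] by (auto simp: r_def)
      have nn': "0 \<le> cut_power_deriv \<epsilon> c (u x)" using b(1) by (rule order_trans[OF powr_ge_zero])
      have "\<bar>cut_power_deriv \<epsilon> c (u x)\<bar> powr p \<le> ((1 + 2 * c) * r powr c) powr p"
        using b nn' p by (intro powr_mono2) auto
      also have "\<dots> = (1 + 2 * c) powr p * r powr real m"
        using c p by (simp add: powr_mult powr_powr c_def)
      also have "\<dots> \<le> (1 + 2 * c) powr p * cut_power_deriv \<epsilon> (real m) (u x)"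
        using cut_power_deriv_bounds(1)[OF \<epsilon>, of "real m" "u x"] by (intro mult_left_mono) (auto simp: r_def)
      finally have "\<bar>cut_power_deriv \<epsilon> c (u x)\<bar> powr p * norm (G x) powr p \<le>
          (1 + 2 * c) powr p * cut_power_deriv \<epsilon> (real m) (u x) * norm (G x) powr p"
        by (rule mult_right_mono) simp
      then show "ennreal (norm (cut_power_deriv \<epsilon> c (u x) *\<^sub>R G x) powr p) \<le>
          ennreal ((1 + 2 * c) powr p) * ennreal (cut_power_deriv \<epsilon> (real m) (u x) * norm (G x) powr p)"
        using nn by (simp add: powr_mult ennreal_mult[symmetric] ennreal_leI mult.assoc)
    qed
    also have "\<dots> = ennreal ((1 + 2 * c) powr p) * (\<integral>\<^sup>+x. ennreal (cut_power_deriv \<epsilon> (real m) (u x) * norm (G x) powr p) \<partial>lborel)"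
      by (rule nn_integral_cmult) measurable
    finally show ?thesis .
  qed
  obtain \<phi> where \<phi>: "\<And>k::nat. test_function \<Omega> (\<phi> k)" "(\<lambda>k. pint p (\<lambda>x. \<phi> k x - u x)) \<longlonglongrightarrow> 0"
      "(\<lambda>k. pint p (\<lambda>x. grad (\<phi> k) x - G x)) \<longlonglongrightarrow> 0" "AE x in lborel. (\<lambda>k. \<phi> k x) \<longlonglongrightarrow> u x"
      "AE x in lborel. (\<lambda>k. grad (\<phi> k) x) \<longlonglongrightarrow> G x"
    by (rule W0_sequence[OF u p0]) (rule that)
  note [measurable] = test_function_measurable[OF \<phi>(1)]
  note fin = W0_finite[OF u p0]
  have "\<exists>R. \<forall>x. norm x \<ge> R \<longrightarrow> \<phi> k x = 0" for k
    using test_function_bounded_support[OF \<phi>(1)[of k]] by metis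
  then obtain R where R: "\<And>k x. norm x \<ge> R k \<Longrightarrow> \<phi> k x = 0" by metis
  have cc: "continuous_on UNIV (cut_power \<epsilon> c)"
    using DERIV_cut_power[OF \<epsilon>] by (meson DERIV_isCont continuous_at_imp_continuous_on)
  \<comment> \<open>Here the exponent is the real number \<open>c\<close>; the approximants need
    only be continuously differentiable for \<open>Sobolev_limit\<close>.\<close>
  have "pint (n * p / (n - p)) (\<lambda>x. cut_power \<epsilon> c (u x)) \<le>
      epow (ennreal C0 * pint p (\<lambda>x. cut_power_deriv \<epsilon> c (u x) *\<^sub>R G x)) (n / (n - p))"
    unfolding C0_def n_def
  proof (rule Sobolev_limit[where \<phi>="\<lambda>k x. cut_power \<epsilon> c (\<phi> k x)" and R=R and
        \<Gamma>="\<lambda>k x. cut_power_deriv \<epsilon> c (\<phi> k x) *\<^sub>R grad (\<phi> k) x"])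
    show "((\<lambda>x. cut_power \<epsilon> c (\<phi> k x)) has_derivative (\<bullet>) (cut_power_deriv \<epsilon> c (\<phi> k x) *\<^sub>R grad (\<phi> k) x)) (at x)" for k x
      using has_derivative_compose[OF test_function_has_derivative[OF \<phi>(1)] DERIV_cut_power[OF \<epsilon>, unfolded has_field_derivative_def]]
      by (rule has_derivative_eq_rhs) (auto simp: fun_eq_iff)
    show "continuous_on UNIV (\<lambda>x. cut_power_deriv \<epsilon> c (\<phi> k x) *\<^sub>R grad (\<phi> k) x)" for k
      by (intro continuous_intros continuous_on_compose2[OF continuous_on_cut_power_deriv[OF \<epsilon>]]
          continuous_on_test_function[OF \<phi>(1)] continuous_on_grad_test_function[OF \<phi>(1)]) auto
    show "cut_power \<epsilon> c (\<phi> k x) = 0" if "R k \<le> norm x" for k x using R[OF that] by (simp add: cut_power_def)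
    show "AE x in lborel. (\<lambda>k. cut_power \<epsilon> c (\<phi> k x)) \<longlonglongrightarrow> cut_power \<epsilon> c (u x)"
      using \<phi>(4) by eventually_elim (use cc in \<open>auto intro: continuous_on_tendsto_compose\<close>)
    show "(\<lambda>k. pint p (\<lambda>x. cut_power_deriv \<epsilon> c (\<phi> k x) *\<^sub>R grad (\<phi> k) x - cut_power_deriv \<epsilon> c (u x) *\<^sub>R G x)) \<longlonglongrightarrow> 0"
      by (rule pint_chain_tendsto[OF _ _ _ _ continuous_on_cut_power_deriv[OF \<epsilon>] cut_power_deriv_bounds(3)[OF \<epsilon> c] p0 \<phi>(4,3) fin(2)]) auto
    show "pint p (\<lambda>x. cut_power_deriv \<epsilon> c (u x) *\<^sub>R G x) < top"
    proof (rule le_less_trans[OF E2])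
      have "integrable lborel (\<lambda>x. cut_power_deriv \<epsilon> (real m) (u x) * norm (G x) powr p)"
        using eq[OF W, unfolded AH] by blast
      then have "(\<integral>\<^sup>+x. ennreal (cut_power_deriv \<epsilon> (real m) (u x) * norm (G x) powr p) \<partial>lborel) < top"
        using nn by (subst nn_integral_eq_integral) auto
      then show "ennreal ((1 + 2 * c) powr p) * (\<integral>\<^sup>+x. ennreal (cut_power_deriv \<epsilon> (real m) (u x) * norm (G x) powr p) \<partial>lborel) < top"
        by (simp add: ennreal_mult_less_top)
    qed
  qed (use p in \<open>auto simp: n_def\<close>)
  also have "\<dots> \<le> epow (ennreal C0 * (ennreal ((1 + 2 * c) powr p) * (ennreal M *
      (\<integral>\<^sup>+x. ennreal (\<bar>u x\<bar> powr s * cut_ratio \<epsilon> (u x) powr m) \<partial>lborel)))) (n / (n - p))"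
    using order_trans[OF E2 mult_left_mono[OF E]] p by (intro epow_mono mult_left_mono) auto
  also have "ennreal C0 * (ennreal ((1 + 2 * c) powr p) * (ennreal M *
      (\<integral>\<^sup>+x. ennreal (\<bar>u x\<bar> powr s * cut_ratio \<epsilon> (u x) powr m) \<partial>lborel))) =
      ennreal (C0 * (1 + 2 * c) powr p * M) * (\<integral>\<^sup>+x. ennreal (\<bar>u x\<bar> powr s * cut_ratio \<epsilon> (u x) powr m) \<partial>lborel)"
    using M by (simp add: C0_def ennreal_mult mult.assoc)
  finally show ?thesis by (simp add: c_def C0_def s_def crit_exp_def n_def)
qed

text \<open>The identities behind the absorption argument: the third splits the critical power as
  \<open>s * (p / n) + p\<close>, and the fourth makes \<open>p / n\<close> and \<open>p / s\<close>
  a pair of Hoelder exponents for the two pieces.\<close>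

lemma crit_exp_facts:
  fixes p n :: real
  assumes p: "1 < p" "p < n" and s: "s = n * p / (n - p)"
  shows "p < s" "1 < s" "s * (p / n) + p = s" "p / n + p / s = 1" "n / (n - p) = s / p"
proof -
  have n: "0 < n" "0 < n - p" using p by auto
  have "n - p < n * 1" using p by simp
  then have "p * (n - p) < p * n" using p by (intro mult_strict_left_mono) auto
  then show 1: "p < s" unfolding s using n by (simp add: pos_less_divide_eq mult.commute)
  then show "1 < s" using p by simp
  show "s * (p / n) + p = s" unfolding s using n by (simp add: field_simps)
  show "p / n + p / s = 1" unfolding s using n p by (simp add: field_simps)
  show "n / (n - p) = s / p" unfolding s using n p by simp
qed

text \<open>Sobolev bounds \<open>X = Z powr (p / s)\<close> by \<open>C1 * J\<close>. Where
  \<open>\<bar>u\<bar> \<le> K\<close>, the integrand of \<open>J\<close> is at most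
  \<open>b\<close> and \<Omega> has finite measure; where \<open>\<bar>u\<bar> > K\<close>, Hoelder
  bounds it by \<open>X\<close> times a power of the tail \<open>\<eta> K\<close>. For
  \<open>K\<close> large the tail absorbs, and the resulting bound is free of \<epsilon>, so Fatou's
  lemma removes the cut-off. One step reaches every \<open>m\<close>, without iteration.\<close>

lemma higher_integrability_aux:
  fixes u :: "real^'n \<Rightarrow> real" and p :: real and m :: nat
  defines "n \<equiv> real CARD('n)" and "s \<equiv> crit_exp CARD('n) p"
  assumes u: "W0 \<Omega> p u G" and p: "1 < p" "p < n"
    and A: "A = (\<lambda>x. norm (G x) powr (p - 2) *\<^sub>R G x)" and [measurable]: "g \<in> borel_measurable borel"
    and eq: "\<And>v H. W0 \<Omega> p v H \<Longrightarrow> integrable lborel (\<lambda>x. A x \<bullet> H x) \<and> integrable lborel (\<lambda>x. g x * v x)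
        \<and> (\<integral>x. A x \<bullet> H x \<partial>lborel) = (\<integral>x. g x * v x \<partial>lborel)"
    and g: "\<And>x t. u x * t \<ge> 0 \<Longrightarrow> g x * t \<le> M * \<bar>u x\<bar> powr (s - 1) * \<bar>t\<bar>" and M: "M \<ge> 0"
    and \<Omega>: "emeasure lborel \<Omega> < top" "\<Omega> \<in> sets borel" and u0: "\<And>x. x \<notin> \<Omega> \<Longrightarrow> u x = 0"
  shows "(\<integral>\<^sup>+x. ennreal (\<bar>u x\<bar> powr s * (1 + (u x)\<^sup>2) powr (real m * s / p)) \<partial>lborel) < top"
proof -
  note [measurable] = W0_measurable[OF u] \<Omega>(2)
  have sdef: "s = n * p / (n - p)" by (simp add: s_def n_def crit_exp_def)
  note sf = crit_exp_facts[OF p sdef]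
  have pint_u: "pint s u < top" using W0_Sobolev(1)[OF u p(1)] p by (simp add: s_def n_def)
  define C1 where "C1 = (p * (n - 1) / (n - p)) powr p * 2 powr p * (1 + 2 * m / p) powr p * M"
  define \<eta> where "\<eta> k = (\<integral>\<^sup>+x. ennreal (\<bar>u x\<bar> powr s * indicator {x. \<bar>u x\<bar> > real k} x) \<partial>lborel)" for k :: nat
  have "\<eta> \<longlonglongrightarrow> (\<integral>\<^sup>+(x::real^'n). 0 \<partial>lborel)"
    unfolding \<eta>_def
  proof (rule nn_integral_dominated_convergence[where w="\<lambda>x. ennreal (norm (u x) powr s)"])
    show "AE x in lborel. (\<lambda>k. ennreal (\<bar>u x\<bar> powr s * indicator {x. \<bar>u x\<bar> > real k} x)) \<longlonglongrightarrow> 0"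
    proof (rule AE_I2)
      fix x
      obtain N :: nat where "\<bar>u x\<bar> < real N" using reals_Archimedean2 by blast
      then have "\<forall>\<^sub>F k in sequentially. ennreal (\<bar>u x\<bar> powr s * indicator {x. \<bar>u x\<bar> > real k} x) = 0"
        by (auto simp: eventually_sequentially indicator_def intro!: exI[of _ N])
      then show "(\<lambda>k. ennreal (\<bar>u x\<bar> powr s * indicator {x. \<bar>u x\<bar> > real k} x)) \<longlonglongrightarrow> 0" by (rule tendsto_eventually)
    qed
    show "AE x in lborel. ennreal (\<bar>u x\<bar> powr s * indicator {x. \<bar>u x\<bar> > real k} x) \<le> ennreal (norm (u x) powr s)" for k
      by (auto simp: indicator_def intro!: ennreal_leI)
    show "(\<integral>\<^sup>+x. ennreal (norm (u x) powr s) \<partial>lborel) < \<infinity>" using pint_u by (simp add: pint_def)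
  qed measurable
  then have "\<eta> \<longlonglongrightarrow> 0" by simp
  then have "(\<lambda>k. epow (\<eta> k) (p / n)) \<longlonglongrightarrow> epow 0 (p / n)" using p by (intro epow_tendsto) auto
  then have "(\<lambda>k. ennreal C1 * epow (\<eta> k) (p / n)) \<longlonglongrightarrow> 0"
    by (intro ennreal_tendsto_0_cmult) auto
  then have "\<forall>\<^sub>F k in sequentially. ennreal C1 * epow (\<eta> k) (p / n) < ennreal (1 / 2)"
  proof (rule order_tendstoD)
    have "ennreal 0 < ennreal (1 / 2)" by (rule ennreal_lessI) simp_all
    then show "0 < ennreal (1 / 2)" by (simp only: ennreal_0)
  qed
  \<comment> \<open>\<open>C1\<close> depends on \<open>m\<close> but not on \<epsilon>, so one
    \<open>K\<close> serves all cut-offs.\<close>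
  then obtain K where K: "ennreal C1 * epow (\<eta> K) (p / n) < ennreal (1 / 2)" by (auto simp: eventually_sequentially)
  define b where "b = real K powr s * (1 + (real K)\<^sup>2) powr m"
  define B where "B = ennreal C1 * (ennreal b * emeasure lborel \<Omega>)"
  have B: "B < top" using \<Omega> by (simp add: B_def ennreal_mult_less_top)
  have main: "pint s (\<lambda>x. cut_power \<epsilon> (m / p) (u x)) \<le> epow (2 * B) (s / p)" if \<epsilon>: "0 < \<epsilon>" "\<epsilon> < 1" for \<epsilon>
  proof -
    have [measurable]: "cut_ratio \<epsilon> \<in> borel_measurable borel" "cut_power \<epsilon> c \<in> borel_measurable borel" for c
      unfolding cut_ratio_def[abs_def] cut_power_def[abs_def] by measurable
    define Z where "Z = pint s (\<lambda>x. cut_power \<epsilon> (m / p) (u x))"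
    define X where "X = epow Z (p / s)"
    \<comment> \<open>For fixed \<epsilon> the cut power is at most a constant multiple of
      \<open>\<bar>u\<bar>\<close>. Finiteness is what allows half of \<open>X\<close> to be
      subtracted below.\<close>
    have Zfin: "Z < top"
    proof -
      have "Z \<le> (\<integral>\<^sup>+x. ennreal (((1 / \<epsilon>) powr (m / p)) powr s) * ennreal (norm (u x) powr s) \<partial>lborel)"
        unfolding Z_def pint_def
      proof (rule nn_integral_mono)
        fix x
        have "cut_ratio \<epsilon> (u x) powr (m / p) \<le> (1 / \<epsilon>) powr (m / p)"
          using cut_ratio_bounds[OF \<epsilon>, of "u x"] p by (intro powr_mono2) auto
        then have "\<bar>cut_power \<epsilon> (m / p) (u x)\<bar> \<le> (1 / \<epsilon>) powr (m / p) * \<bar>u x\<bar>"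
          by (simp add: cut_power_def abs_mult mult.commute mult_left_mono)
        then have "\<bar>cut_power \<epsilon> (m / p) (u x)\<bar> powr s \<le> ((1 / \<epsilon>) powr (m / p) * \<bar>u x\<bar>) powr s"
          using sf by (intro powr_mono2) auto
        then show "ennreal (norm (cut_power \<epsilon> (m / p) (u x)) powr s) \<le> ennreal (((1 / \<epsilon>) powr (m / p)) powr s) * ennreal (norm (u x) powr s)"
          by (simp add: powr_mult ennreal_mult[symmetric] ennreal_leI)
      qed
      also have "\<dots> < top" using pint_u by (simp add: nn_integral_cmult pint_def ennreal_mult_less_top)
      finally show ?thesis .
    qed
    define J where "J = (\<integral>\<^sup>+x. ennreal (\<bar>u x\<bar> powr s * cut_ratio \<epsilon> (u x) powr m) \<partial>lborel)"
    have "Z \<le> epow (ennreal C1 * J) (n / (n - p))"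
      unfolding Z_def J_def C1_def n_def s_def
      by (rule cut_power_energy[OF u p(1) _ A _ eq g[unfolded s_def] M \<epsilon>]) (use p in \<open>auto simp: n_def\<close>)
    then have "X \<le> epow (epow (ennreal C1 * J) (n / (n - p))) (p / s)"
      unfolding X_def using p sf by (intro epow_mono) auto
    also have "\<dots> = ennreal C1 * J" using p sf by (simp add: epow_epow)
    finally have 1: "X \<le> ennreal C1 * J" .
    have "J \<le> (\<integral>\<^sup>+x. ennreal b * indicator \<Omega> x +
        epow (ennreal (\<bar>u x\<bar> powr s * indicator {x. \<bar>u x\<bar> > real K} x)) (p / n) * epow (ennreal (norm (cut_power \<epsilon> (m / p) (u x)) powr s)) (p / s) \<partial>lborel)"
      unfolding J_def
    proof (rule nn_integral_mono)
      fix x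
      define r where "r = cut_ratio \<epsilon> (u x)"
      have r: "1 \<le> r" "r \<le> 1 + (u x)\<^sup>2" using cut_ratio_bounds[OF \<epsilon>] by (auto simp: r_def)
      show "ennreal (\<bar>u x\<bar> powr s * cut_ratio \<epsilon> (u x) powr m) \<le> ennreal b * indicator \<Omega> x +
        epow (ennreal (\<bar>u x\<bar> powr s * indicator {x. \<bar>u x\<bar> > real K} x)) (p / n) * epow (ennreal (norm (cut_power \<epsilon> (m / p) (u x)) powr s)) (p / s)"
      proof (cases "\<bar>u x\<bar> > real K")
        case False
        show ?thesis
        proof (cases "x \<in> \<Omega>")
          case True
          have "(u x)\<^sup>2 \<le> (real K)\<^sup>2" using False power_mono[of "\<bar>u x\<bar>" "real K" 2] by simp
          then have "r powr m \<le> (1 + (real K)\<^sup>2) powr m" using r by (intro powr_mono2) auto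
          moreover have "\<bar>u x\<bar> powr s \<le> real K powr s" using False sf by (intro powr_mono2) auto
          ultimately have "\<bar>u x\<bar> powr s * r powr m \<le> b" unfolding b_def by (intro mult_mono) auto
          then show ?thesis using True by (auto simp: r_def[symmetric] intro!: add_increasing2 ennreal_leI)
        qed (simp add: u0)
      next
        case True
        \<comment> \<open>The part \<open>s * (p / n)\<close> of the exponent goes to the tail of
          \<open>u\<close>, the part \<open>p\<close> joins the weight to form the cut
          power.\<close>
        have "\<bar>u x\<bar> powr s * r powr m = (\<bar>u x\<bar> powr s) powr (p / n) * (\<bar>u x\<bar> powr p * r powr m)"
          using sf(3) by (simp only: powr_powr mult.assoc[symmetric] powr_add[symmetric])
        also have "\<bar>u x\<bar> powr p * r powr m = (\<bar>cut_power \<epsilon> (m / p) (u x)\<bar> powr s) powr (p / s)"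
          using p sf by (simp add: cut_power_def abs_mult powr_mult powr_powr r_def)
        finally have "ennreal (\<bar>u x\<bar> powr s * r powr m) = epow (ennreal (\<bar>u x\<bar> powr s * indicator {x. \<bar>u x\<bar> > real K} x)) (p / n) * epow (ennreal (norm (cut_power \<epsilon> (m / p) (u x)) powr s)) (p / s)"
          using True by (simp add: epow_ennreal ennreal_mult)
        then show ?thesis by (simp add: r_def)
      qed
    qed
    also have "\<dots> = ennreal b * emeasure lborel \<Omega> + (\<integral>\<^sup>+x. epow (ennreal (\<bar>u x\<bar> powr s * indicator {x. \<bar>u x\<bar> > real K} x)) (p / n) * epow (ennreal (norm (cut_power \<epsilon> (m / p) (u x)) powr s)) (p / s) \<partial>lborel)"
      by (subst nn_integral_add) (auto simp: nn_integral_cmult_indicator)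
    also have "\<dots> \<le> ennreal b * emeasure lborel \<Omega> + epow (\<eta> K) (p / n) * X"
      unfolding \<eta>_def X_def Z_def pint_def using p sf by (intro add_left_mono nn_integral_Holder) auto
    finally have "ennreal C1 * J \<le> ennreal C1 * (ennreal b * emeasure lborel \<Omega> + epow (\<eta> K) (p / n) * X)"
      by (rule mult_left_mono) simp
    also have "\<dots> = B + (ennreal C1 * epow (\<eta> K) (p / n)) * X"
      by (simp add: B_def distrib_left mult.assoc)
    also have "\<dots> \<le> B + ennreal (1 / 2) * X"
      using K by (intro add_left_mono mult_right_mono) auto
    finally have 2: "X \<le> B + ennreal (1 / 2) * X" using 1 by (rule order_trans[rotated])
    have Xf: "X < top" using Zfin by (simp add: X_def)
    have "X \<le> 2 * B"
    proof -
      define x y where "x = enn2real X" and "y = enn2real B"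
      have x: "X = ennreal x" "x \<ge> 0" and y: "B = ennreal y" "y \<ge> 0"
        using Xf B by (auto simp: x_def y_def ennreal_enn2real)
      have "ennreal (y + 1 / 2 * x) = ennreal y + ennreal (1 / 2 * x)" using x y by (intro ennreal_plus) auto
      also have "ennreal (1 / 2 * x) = ennreal (1 / 2) * ennreal x" using x by (intro ennreal_mult) auto
      finally have "ennreal x \<le> ennreal (y + 1 / 2 * x)" using 2 x(1) y(1) by (simp only:)
      then have "x \<le> 2 * y" using x y by (subst (asm) ennreal_le_iff) auto
      then have "ennreal x \<le> ennreal (2 * y)" by (rule ennreal_leI)
      then show ?thesis using x y by (simp add: ennreal_mult)
    qed
    then have "epow X (s / p) \<le> epow (2 * B) (s / p)" using p sf by (intro epow_mono) auto
    moreover have "epow X (s / p) = Z" using p sf by (simp add: X_def epow_epow)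
    ultimately show ?thesis by (simp add: Z_def)
  qed
  \<comment> \<open>The offset 2 keeps every value strictly below 1.\<close>
  define \<epsilon> where "\<epsilon> k = 1 / real (k + 2)" for k :: nat
  have \<epsilon>: "0 < \<epsilon> k" "\<epsilon> k < 1" for k by (auto simp: \<epsilon>_def)
  have \<epsilon>0: "\<epsilon> \<longlonglongrightarrow> 0" unfolding \<epsilon>_def by (rule LIMSEQ_ignore_initial_segment[OF lim_1_over_n])
  have lim: "(\<lambda>k. ennreal (norm (cut_power (\<epsilon> k) (m / p) (u x)) powr s)) \<longlonglongrightarrow> ennreal (\<bar>u x\<bar> powr s * (1 + (u x)\<^sup>2) powr (real m * s / p))" for x
  proof -
    have pos: "0 < 1 + (u x)\<^sup>2" by (rule add_pos_nonneg) auto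
    have "(\<lambda>k. cut_ratio (\<epsilon> k) (u x)) \<longlonglongrightarrow> (1 + (u x)\<^sup>2) / (1 + 0 * (u x)\<^sup>2)"
      unfolding cut_ratio_def by (intro tendsto_intros \<epsilon>0) auto
    then have "(\<lambda>k. cut_power (\<epsilon> k) (m / p) (u x)) \<longlonglongrightarrow> u x * (1 + (u x)\<^sup>2) powr (m / p)"
      unfolding cut_power_def using pos by (intro tendsto_mult tendsto_const tendsto_powr) auto
    then have "(\<lambda>k. norm (cut_power (\<epsilon> k) (m / p) (u x)) powr s) \<longlonglongrightarrow> norm (u x * (1 + (u x)\<^sup>2) powr (m / p)) powr s"
      using sf by (intro tendsto_powr' tendsto_norm tendsto_const) auto
    also have "norm (u x * (1 + (u x)\<^sup>2) powr (m / p)) powr s = \<bar>u x\<bar> powr s * (1 + (u x)\<^sup>2) powr (real m * s / p)"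
      by (simp add: abs_mult powr_mult powr_powr)
    finally show ?thesis by (rule tendsto_ennrealI)
  qed
  have [measurable]: "cut_power (\<epsilon> k) c \<in> borel_measurable borel" for k c
    unfolding cut_ratio_def[abs_def] cut_power_def[abs_def] by measurable
  have "(\<integral>\<^sup>+x. ennreal (\<bar>u x\<bar> powr s * (1 + (u x)\<^sup>2) powr (real m * s / p)) \<partial>lborel) =
      (\<integral>\<^sup>+x. liminf (\<lambda>k. ennreal (norm (cut_power (\<epsilon> k) (m / p) (u x)) powr s)) \<partial>lborel)"
    by (intro nn_integral_cong lim_imp_Liminf[symmetric] lim) auto
  also have "\<dots> \<le> liminf (\<lambda>k. pint s (\<lambda>x. cut_power (\<epsilon> k) (m / p) (u x)))"
    unfolding pint_def by (rule nn_integral_liminf) measurable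
  also have "\<dots> \<le> liminf (\<lambda>k::nat. epow (2 * B) (s / p))"
    by (intro Liminf_mono always_eventually allI main \<epsilon>)
  also have "\<dots> < top" using B by (simp add: Liminf_const ennreal_mult_less_top)
  finally show ?thesis .
qed

text \<open>Where \<open>\<bar>u\<bar> > 1\<close>, the power \<open>r\<close> is dominated once
  \<open>2 * m * s / p\<close> exceeds \<open>r\<close>; where \<open>\<bar>u\<bar> \<le> 1\<close>,
  the measure of \<Omega> suffices, as \<open>u\<close> vanishes outside.\<close>

lemma higher_integrability:
  fixes u :: "real^'n \<Rightarrow> real" and p :: real
  defines "n \<equiv> real CARD('n)" and "s \<equiv> crit_exp CARD('n) p"
  assumes u: "W0 \<Omega> p u G" and p: "1 < p" "p < n"
    and A: "A = (\<lambda>x. norm (G x) powr (p - 2) *\<^sub>R G x)" and g_meas: "g \<in> borel_measurable borel"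
    and eq: "\<And>v H. W0 \<Omega> p v H \<Longrightarrow> integrable lborel (\<lambda>x. A x \<bullet> H x) \<and> integrable lborel (\<lambda>x. g x * v x)
        \<and> (\<integral>x. A x \<bullet> H x \<partial>lborel) = (\<integral>x. g x * v x \<partial>lborel)"
    and g: "\<And>x t. u x * t \<ge> 0 \<Longrightarrow> g x * t \<le> M * \<bar>u x\<bar> powr (s - 1) * \<bar>t\<bar>" and M: "M \<ge> 0"
    and \<Omega>: "emeasure lborel \<Omega> < top" "\<Omega> \<in> sets borel" and u0: "\<And>x. x \<notin> \<Omega> \<Longrightarrow> u x = 0"
    and r: "0 \<le> r"
  shows "pint r u < top"
proof -
  note [measurable] = W0_measurable[OF u] \<Omega>(2)
  have sdef: "s = n * p / (n - p)" by (simp add: s_def n_def crit_exp_def)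
  note sf = crit_exp_facts[OF p sdef]
  obtain m :: nat where "r / (2 * s / p) < real m" using reals_Archimedean2 by blast
  then have m: "r < 2 * (real m * s / p)" using p sf by (simp add: divide_less_eq field_simps)
  define Y where "Y x = ennreal (\<bar>u x\<bar> powr s * (1 + (u x)\<^sup>2) powr (real m * s / p))" for x
  have [measurable]: "Y \<in> borel_measurable borel" unfolding Y_def by measurable
  have Y: "(\<integral>\<^sup>+x. Y x \<partial>lborel) < top"
    unfolding Y_def s_def
    by (rule higher_integrability_aux[OF u p(1) _ A g_meas eq g[unfolded s_def] M \<Omega> u0]) (use p in \<open>auto simp: n_def\<close>)
  have "pint r u \<le> (\<integral>\<^sup>+x. indicator \<Omega> x + Y x \<partial>lborel)"
    unfolding pint_def
  proof (rule nn_integral_mono)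
    fix x
    show "ennreal (norm (u x) powr r) \<le> indicator \<Omega> x + Y x"
    proof (cases "\<bar>u x\<bar> \<le> 1")
      case True
      show ?thesis
      proof (cases "u x = 0")
        case False
        then have "x \<in> \<Omega>" using u0 by auto
        have "\<bar>u x\<bar> powr r \<le> 1" using True r by (intro powr_le1) auto
        then show ?thesis using \<open>x \<in> \<Omega>\<close> by (auto intro!: add_increasing2 simp: ennreal_le_1)
      next
        case True
        then show ?thesis by simp
      qed
    next
      case False
      have "\<bar>u x\<bar> powr r \<le> \<bar>u x\<bar> powr (2 * (real m * s / p))" using False m by (intro powr_mono) auto
      also have "\<dots> = ((u x)\<^sup>2) powr (real m * s / p)" by (simp only: powr_powr[symmetric]) simp
      also have "\<dots> \<le> (1 + (u x)\<^sup>2) powr (real m * s / p)" using p sf by (intro powr_mono2) auto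
      also have "\<dots> \<le> \<bar>u x\<bar> powr s * (1 + (u x)\<^sup>2) powr (real m * s / p)"
        using False sf ge_one_powr_ge_zero[of "\<bar>u x\<bar>" s] by (intro mult_le_cancel_right1[THEN iffD2]) auto
      finally show ?thesis by (simp add: Y_def ennreal_leI add_increasing)
    qed
  qed
  also have "\<dots> = emeasure lborel \<Omega> + (\<integral>\<^sup>+x. Y x \<partial>lborel)" by (subst nn_integral_add) auto
  also have "\<dots> < top" using Y \<Omega> by simp
  finally show ?thesis .
qed

section \<open>Convexity and dilations\<close>

text \<open>The tangent inequality for the convex function \<open>norm a powr p / p\<close>,
  obtained from Cauchy-Schwarz and Young.\<close>

lemma norm_powr_convex:
  fixes a b :: "'a::real_inner"
  assumes p: "1 < p"
  shows "(norm a powr (p - 2) *\<^sub>R a) \<bullet> (b - a) \<le> (norm b powr p - norm a powr p) / p"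
proof (cases "a = 0")
  case True
  then show ?thesis using p by simp
next
  case False
  then have na: "norm a > 0" by simp
  have aa: "norm a powr (p - 2) * (a \<bullet> a) = norm a powr p"
  proof -
    have "a \<bullet> a = norm a powr 2" using na by (simp add: power2_norm_eq_inner)
    then show ?thesis by (simp only: powr_add[symmetric]) simp
  qed
  have "norm a powr (p - 2) * (a \<bullet> b) \<le> norm a powr (p - 2) * (norm a * norm b)"
    by (intro mult_left_mono norm_cauchy_schwarz) auto
  also have "\<dots> = norm a powr (p - 1) * norm b"
    using powr_mult_base[of "norm a" "p - 2"] na by (simp add: mult_ac)
  also have "\<dots> \<le> (norm a powr (p - 1)) powr (p / (p - 1)) / (p / (p - 1)) + norm b powr p / p"
    using p by (intro Youngs_inequality) (auto simp: field_simps)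
  also have "(norm a powr (p - 1)) powr (p / (p - 1)) / (p / (p - 1)) = norm a powr p * ((p - 1) / p)"
    using p by (simp add: powr_powr)
  finally have "norm a powr (p - 2) * (a \<bullet> b) - norm a powr p \<le> norm a powr p * ((p - 1) / p) + norm b powr p / p - norm a powr p"
    by simp
  also have "\<dots> = (norm b powr p - norm a powr p) / p"
    using p by (simp add: field_simps)
  finally show ?thesis by (simp add: inner_diff_right right_diff_distrib aa)
qed

lemma abs_powr_convex:
  assumes "1 < r"
  shows "spow (r - 1) a * (b - a) \<le> (\<bar>b\<bar> powr r - \<bar>a\<bar> powr r) / r"
  using norm_powr_convex[OF assms, of a b] by (simp add: spow_def)

lemma one_minus_powr_le:
  fixes t r :: real
  assumes "0 < t" "t \<le> 1" "0 < r"
  shows "1 - t powr r \<le> (1 + r) * (1 - t)"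
proof (cases "r > 1")
  case True
  have "1 + r * (t - 1) \<le> t powr r"
    using abs_powr_convex[of r 1 t] True assms by (simp add: spow_def field_simps)
  then have "1 - t powr r \<le> r * (1 - t)" by (simp add: algebra_simps)
  also have "\<dots> \<le> (1 + r) * (1 - t)" using assms by (intro mult_right_mono) auto
  finally show ?thesis .
next
  case False
  have "t powr 1 \<le> t powr r" using assms False by (intro powr_mono') auto
  then have "1 - t powr r \<le> 1 * (1 - t)" using assms by simp
  also have "\<dots> \<le> (1 + r) * (1 - t)" using assms by (intro mult_right_mono) auto
  finally show ?thesis .
qed

lemma spow_minus: "spow r (- a) = - spow r a"
  by (simp add: spow_def)

text \<open>By homogeneity only \<open>t = a / b\<close> in \<open>{-1..1}\<close> matters. Near
  \<open>t = 1\<close> the power is Lipschitz and \<open>1 - t\<close> is at most its power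
  \<delta>; for \<open>t \<le> 0\<close> that power is at least 1 while the left side is at most
  2.\<close>

lemma spow_Hoelder_aux:
  fixes a b r \<delta> :: real
  assumes b: "0 < b" and ab: "\<bar>a\<bar> \<le> b" and r: "0 < \<delta>" "\<delta> \<le> 1" "\<delta> \<le> r"
  shows "\<bar>spow r b - spow r a\<bar> \<le> (2 + r) * (\<bar>a\<bar> + \<bar>b\<bar>) powr (r - \<delta>) * \<bar>b - a\<bar> powr \<delta>"
proof -
  define t where "t = a / b"
  have t: "-1 \<le> t" "t \<le> 1" "a = t * b" using b ab by (auto simp: t_def abs_le_iff field_simps)
  have r0: "0 < r" using r by simp
  have abs_t: "\<bar>t\<bar> powr r \<le> 1" using t r0 by (intro powr_le1) auto
  have sa: "spow r a = spow r t * b powr r"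
    unfolding t(3) using b by (simp add: spow_def abs_mult powr_mult mult_ac) (simp add: powr_mult_base[symmetric] powr_diff)
  have main: "1 - spow r t \<le> (2 + r) * (1 - t) powr \<delta>"
  proof (cases "t > 0")
    case True
    have "1 - spow r t \<le> (1 + r) * (1 - t)"
      using one_minus_powr_le[OF True t(2) r0] True by (simp add: spow_eq_if)
    also have "1 - t \<le> (1 - t) powr \<delta>"
      using powr_mono'[of \<delta> 1 "1 - t"] r True t by simp
    finally have "1 - spow r t \<le> (1 + r) * (1 - t) powr \<delta>" using r0 by (simp add: mult_left_mono)
    also have "\<dots> \<le> (2 + r) * (1 - t) powr \<delta>" by (intro mult_right_mono) auto
    finally show ?thesis .
  next
    case False
    have "\<bar>spow r t\<bar> \<le> 1" using abs_t by (simp add: abs_spow)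
    then have "1 - spow r t \<le> 2 * 1" by linarith
    also have "\<dots> \<le> (2 + r) * (1 - t) powr \<delta>"
      using False r r0 ge_one_powr_ge_zero[of "1 - t" \<delta>] by (intro mult_mono) auto
    finally show ?thesis .
  qed
  have "spow r t \<le> 1" using abs_t abs_spow[of r t] by linarith
  have "\<bar>spow r b - spow r a\<bar> = (1 - spow r t) * b powr r"
    using b \<open>spow r t \<le> 1\<close> by (simp add: sa spow_eq_if[of r b] left_diff_distrib abs_of_nonneg mult_left_le_one_le)
  also have "\<dots> \<le> (2 + r) * (1 - t) powr \<delta> * b powr r"
    using main by (rule mult_right_mono) simp
  also have "b powr r = b powr (r - \<delta>) * b powr \<delta>" by (simp add: powr_add[symmetric])
  also have "(2 + r) * (1 - t) powr \<delta> * (b powr (r - \<delta>) * b powr \<delta>) = (2 + r) * b powr (r - \<delta>) * ((1 - t) * b) powr \<delta>"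
    using b t by (simp add: powr_mult)
  also have "(1 - t) * b = \<bar>b - a\<bar>" using b t ab by (simp add: left_diff_distrib)
  also have "(2 + r) * b powr (r - \<delta>) * \<bar>b - a\<bar> powr \<delta> \<le> (2 + r) * (\<bar>a\<bar> + \<bar>b\<bar>) powr (r - \<delta>) * \<bar>b - a\<bar> powr \<delta>"
    using b r r0 by (intro mult_right_mono mult_left_mono powr_mono2) auto
  finally show ?thesis .
qed

text \<open>The symmetries \<open>(a, b)\<close> to \<open>(b, a)\<close> and to
  \<open>(- a, - b)\<close> reduce it to the previous case. The exponent \<delta> replaces a
  Lipschitz bound because \<open>spow r\<close> has infinite slope at 0 when
  \<open>r < 1\<close>.\<close>

lemma spow_Hoelder:
  fixes a b r \<delta> :: real
  assumes r: "0 < \<delta>" "\<delta> \<le> 1" "\<delta> \<le> r"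
  shows "\<bar>spow r b - spow r a\<bar> \<le> (2 + r) * (\<bar>a\<bar> + \<bar>b\<bar>) powr (r - \<delta>) * \<bar>b - a\<bar> powr \<delta>"
proof -
  have 1: "\<bar>spow r b - spow r a\<bar> \<le> (2 + r) * (\<bar>a\<bar> + \<bar>b\<bar>) powr (r - \<delta>) * \<bar>b - a\<bar> powr \<delta>" if "\<bar>a\<bar> \<le> \<bar>b\<bar>" for a b
  proof -
    consider "b > 0" | "b < 0" | "b = 0" by linarith
    then show ?thesis
    proof cases
      case 1
      then show ?thesis using spow_Hoelder_aux[of b a] that r by simp
    next
      case 2
      have "\<bar>spow r (- b) - spow r (- a)\<bar> \<le> (2 + r) * (\<bar>- a\<bar> + \<bar>- b\<bar>) powr (r - \<delta>) * \<bar>- b - - a\<bar> powr \<delta>"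
        by (rule spow_Hoelder_aux) (use 2 that r in auto)
      moreover have "\<bar>- spow r b + spow r a\<bar> = \<bar>spow r b - spow r a\<bar>" "\<bar>- b + a\<bar> = \<bar>b - a\<bar>" by auto
      ultimately show ?thesis by (simp add: spow_minus)
    qed (use that in auto)
  qed
  show ?thesis
  proof (cases "\<bar>a\<bar> \<le> \<bar>b\<bar>")
    case False
    then show ?thesis using 1[of b a] by (simp add: abs_minus_commute add.commute)
  qed (rule 1)
qed

text \<open>With the sign of \<open>k\<close> unknown, convexity is used at \<open>a\<close> or at \<open>b\<close>.\<close>

lemma weighted_spow_ge:
  fixes k a b s \<delta> :: real
  assumes s: "1 < s" and \<delta>: "0 < \<delta>" "\<delta> \<le> 1" "\<delta> \<le> s - 1" and k: "\<bar>k\<bar> \<le> M"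
  shows "k * spow (s - 1) a * (b - a) \<ge> k * (\<bar>b\<bar> powr s - \<bar>a\<bar> powr s) / s
    - M * (1 + s) * ((\<bar>a\<bar> + \<bar>b\<bar>) powr (s - 1 - \<delta>) * \<bar>b - a\<bar> powr (1 + \<delta>))"
proof -
  define D where "D = (\<bar>a\<bar> + \<bar>b\<bar>) powr (s - 1 - \<delta>) * \<bar>b - a\<bar> powr (1 + \<delta>)"
  have D: "D \<ge> 0" by (simp add: D_def)
  have up: "spow (s - 1) a * (b - a) \<le> (\<bar>b\<bar> powr s - \<bar>a\<bar> powr s) / s" by (rule abs_powr_convex[OF s])
  have "spow (s - 1) b * (a - b) \<le> (\<bar>a\<bar> powr s - \<bar>b\<bar> powr s) / s" by (rule abs_powr_convex[OF s])
  \<comment> \<open>The tangent inequality at \<open>b\<close>, rewritten with the slope at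
    \<open>a\<close>; the difference of the slopes is the error that Hoelder continuity
    controls.\<close>
  then have "(\<bar>b\<bar> powr s - \<bar>a\<bar> powr s) / s \<le> spow (s - 1) a * (b - a) + (spow (s - 1) b - spow (s - 1) a) * (b - a)"
    by (simp add: algebra_simps diff_divide_distrib)
  also have "(spow (s - 1) b - spow (s - 1) a) * (b - a) \<le> (1 + s) * D"
  proof -
    have "(spow (s - 1) b - spow (s - 1) a) * (b - a) \<le> \<bar>spow (s - 1) b - spow (s - 1) a\<bar> * \<bar>b - a\<bar>"
      by (metis abs_ge_self abs_mult)
    also have "\<dots> \<le> ((2 + (s - 1)) * (\<bar>a\<bar> + \<bar>b\<bar>) powr (s - 1 - \<delta>) * \<bar>b - a\<bar> powr \<delta>) * \<bar>b - a\<bar>"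
      by (intro mult_right_mono spow_Hoelder) (use \<delta> in auto)
    also have "\<dots> = (1 + s) * D"
      by (simp add: D_def powr_add mult_ac)
    finally show ?thesis .
  qed
  finally have low: "(\<bar>b\<bar> powr s - \<bar>a\<bar> powr s) / s - (1 + s) * D \<le> spow (s - 1) a * (b - a)" by simp
  have MD: "k * ((1 + s) * D) \<le> M * ((1 + s) * D)" "0 \<le> M * ((1 + s) * D)"
    using k D s by (auto intro!: mult_right_mono mult_nonneg_nonneg)
  have "k * (\<bar>b\<bar> powr s - \<bar>a\<bar> powr s) / s - M * ((1 + s) * D) \<le> k * (spow (s - 1) a * (b - a))"
  proof (cases "k \<ge> 0")
    case True
    have "k * ((\<bar>b\<bar> powr s - \<bar>a\<bar> powr s) / s - (1 + s) * D) \<le> k * (spow (s - 1) a * (b - a))"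
      using True low by (intro mult_left_mono)
    then show ?thesis using MD by (simp add: right_diff_distrib)
  next
    case False
    have "k * ((\<bar>b\<bar> powr s - \<bar>a\<bar> powr s) / s) \<le> k * (spow (s - 1) a * (b - a))"
      using False up by (intro mult_left_mono_neg) auto
    then show ?thesis using MD by simp
  qed
  then show ?thesis by (simp add: D_def mult.assoc)
qed

section \<open>Dilations of the coefficients and of integrals\<close>

lemma inner_grad_eq_radial_deriv: "x \<bullet> grad f x = norm x * radial_deriv f x"
  by (cases "x = 0") (auto simp: radial_deriv_def)

lemma star_shaped_scale:
  assumes "star_shaped_wrt 0 \<Omega>" "x \<in> \<Omega>" "0 \<le> t" "t \<le> 1"
  shows "t *\<^sub>R x \<in> \<Omega>"
proof -
  have "t *\<^sub>R x \<in> closed_segment 0 x" using assms by (auto simp: closed_segment_def)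
  then show ?thesis using assms by (auto simp: star_shaped_wrt_def)
qed

lemma DERIV_along_ray:
  assumes "f differentiable (at (t *\<^sub>R x))"
  shows "((\<lambda>t. f (t *\<^sub>R x)) has_real_derivative (x \<bullet> grad f (t *\<^sub>R x))) (at t)"
proof -
  have "((\<lambda>t. t *\<^sub>R x) has_derivative (\<lambda>h. h *\<^sub>R x)) (at t)" by (auto intro!: derivative_eq_intros)
  from has_derivative_compose[OF this has_derivative_grad[OF assms]]
  show ?thesis unfolding has_field_derivative_def
    by (rule has_derivative_eq_rhs) (auto simp: fun_eq_iff inner_commute)
qed

text \<open>Along the ray the derivative at \<open>t\<close> is a nonnegative multiple of the radial
  derivative at \<open>t *\<^sub>R x\<close>; the division by \<open>t\<close> is safe because
  \<open>t \<ge> 1 / c\<close>.\<close>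

lemma radially_nonincreasing:
  assumes star: "star_shaped_wrt 0 \<Omega>" and diff: "\<And>x. x \<in> \<Omega> \<Longrightarrow> f differentiable (at x)"
    and rad: "\<And>x. x \<in> \<Omega> \<Longrightarrow> radial_deriv f x \<le> 0" and x: "x \<in> \<Omega>" and c: "1 \<le> c"
  shows "f x \<le> f ((1 / c) *\<^sub>R x)"
proof -
  have "f (1 *\<^sub>R x) \<le> f ((1 / c) *\<^sub>R x)"
  proof (rule DERIV_nonpos_imp_nonincreasing[where f="\<lambda>t. f (t *\<^sub>R x)"])
    fix t assume t: "1 / c \<le> t" "t \<le> 1"
    then have t0: "t > 0" using c by (smt (verit) divide_pos_pos)
    have in\<Omega>: "t *\<^sub>R x \<in> \<Omega>" using star_shaped_scale[OF star x] t t0 by auto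
    have "t * (x \<bullet> grad f (t *\<^sub>R x)) = norm (t *\<^sub>R x) * radial_deriv f (t *\<^sub>R x)"
      using inner_grad_eq_radial_deriv[of "t *\<^sub>R x" f] by simp
    also have "\<dots> \<le> 0" using rad[OF in\<Omega>] by (intro mult_nonneg_nonpos) auto
    finally have "x \<bullet> grad f (t *\<^sub>R x) \<le> 0" using t0 by (simp add: mult_le_0_iff)
    then show "\<exists>y. ((\<lambda>t. f (t *\<^sub>R x)) has_real_derivative y) (at t) \<and> y \<le> 0"
      using DERIV_along_ray[OF diff[OF in\<Omega>]] by blast
  qed (use c in auto)
  then show ?thesis by simp
qed

lemma dilation_quotient_tendsto:
  assumes diff: "f differentiable (at x)" and c: "c \<longlonglongrightarrow> 1" "\<And>k. c k > (1::real)"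
  shows "(\<lambda>k. (f ((1 / c k) *\<^sub>R x) - f x) / (c k - 1)) \<longlonglongrightarrow> - (norm x * radial_deriv f x)"
proof -
  have inv: "(\<lambda>k. 1 / c k) \<longlonglongrightarrow> 1" using tendsto_divide[OF tendsto_const c(1), of 1] by simp
  have ne: "1 / c k \<noteq> 1" for k using c(2)[of k] by auto
  have "((\<lambda>t. (f (t *\<^sub>R x) - f (1 *\<^sub>R x)) / (t - 1)) \<longlongrightarrow> x \<bullet> grad f (1 *\<^sub>R x)) (at 1)"
    using DERIV_along_ray[of f 1 x] diff by (simp add: has_field_derivative_iff)
  then have "(\<lambda>k. (f ((1 / c k) *\<^sub>R x) - f (1 *\<^sub>R x)) / (1 / c k - 1)) \<longlonglongrightarrow> x \<bullet> grad f (1 *\<^sub>R x)"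
    by (rule filterlim_compose) (use inv ne in \<open>auto simp: filterlim_at\<close>)
  \<comment> \<open>The quotient of \<open>1 / c k - 1\<close> by \<open>c k - 1\<close> is
    \<open>- (1 / c k)\<close>, which tends to -1 and accounts for the sign of the limit.\<close>
  then have "(\<lambda>k. ((f ((1 / c k) *\<^sub>R x) - f x) / (1 / c k - 1)) * (- (1 / c k))) \<longlonglongrightarrow> (x \<bullet> grad f x) * (- 1)"
    by (intro tendsto_mult tendsto_minus inv) auto
  moreover have "((f ((1 / c k) *\<^sub>R x) - f x) / (1 / c k - 1)) * (- (1 / c k)) = (f ((1 / c k) *\<^sub>R x) - f x) / (c k - 1)" for k
  proof -
    define X d where "X = f ((1 / c k) *\<^sub>R x) - f x" and "d = c k - 1"
    have d: "d > 0" "c k = 1 + d" using c(2)[of k] by (auto simp: d_def)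
    have "1 / (1 + d) - 1 = - (d / (1 + d))" using d by (simp add: field_simps)
    then show ?thesis unfolding X_def[symmetric] d_def[symmetric] using d by simp
  qed
  ultimately show ?thesis by (simp add: inner_grad_eq_radial_deriv)
qed

lemma lborel_integral_scale:
  fixes F :: "'a::euclidean_space \<Rightarrow> real"
  assumes F: "integrable lborel F" and c: "0 < c"
  shows "integrable lborel (\<lambda>x. F (c *\<^sub>R x))"
    "(\<integral>x. F (c *\<^sub>R x) \<partial>lborel) = c powr (- DIM('a)) * (\<integral>x. F x \<partial>lborel)"
proof -
  have [measurable]: "F \<in> borel_measurable borel" using F by auto
  have "(\<integral>\<^sup>+x. ennreal (norm (F (c *\<^sub>R x))) \<partial>lborel) = ennreal (c powr (- DIM('a))) * (\<integral>\<^sup>+x. ennreal (norm (F x)) \<partial>lborel)"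
    by (rule lborel_nn_integral_scale) (use c in auto)
  also have "\<dots> < \<infinity>" using F by (auto simp: integrable_iff_bounded ennreal_mult_less_top)
  finally show I: "integrable lborel (\<lambda>x. F (c *\<^sub>R x))" by (intro integrableI_bounded) auto
  have "(\<integral>x. F x \<partial>lborel) = c ^ DIM('a) * (\<integral>x. F (c *\<^sub>R x) \<partial>lborel)"
    using c by (subst lborel_affine[of c 0]) (simp_all add: integral_density integral_distr)
  then show "(\<integral>x. F (c *\<^sub>R x) \<partial>lborel) = c powr (- DIM('a)) * (\<integral>x. F x \<partial>lborel)"
    using c by (simp add: powr_minus powr_realpow)
qed

lemma integrable_weight:
  fixes k u :: "'a::euclidean_space \<Rightarrow> real"
  assumes [measurable]: "k \<in> borel_measurable borel" "u \<in> borel_measurable borel"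
    and k: "\<And>x. \<bar>k x\<bar> \<le> M" and u: "pint r u < top"
  shows "integrable lborel (\<lambda>x. k x * \<bar>u x\<bar> powr r)"
proof -
  have "integrable lborel (\<lambda>x. \<bar>u x\<bar> powr r)"
    by (intro integrableI_nonneg) (use u in \<open>auto simp: pint_def\<close>)
  then have "integrable lborel (\<lambda>x. M * \<bar>u x\<bar> powr r)" by simp
  then show ?thesis
  proof (rule Bochner_Integration.integrable_bound)
    have "0 \<le> M" using k[of 0] by simp
    then show "AE x in lborel. norm (k x * \<bar>u x\<bar> powr r) \<le> norm (M * \<bar>u x\<bar> powr r)"
      using k by (auto simp: abs_mult intro!: mult_right_mono)
  qed measurable
qed

text \<open>The change of variables moves the dilation from \<open>u\<close>, about whose pointwise
  differentiability nothing is known, to the coefficient \<open>k\<close>.\<close>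

lemma weight_scale:
  fixes k u :: "'a::euclidean_space \<Rightarrow> real"
  assumes [measurable]: "k \<in> borel_measurable borel" "u \<in> borel_measurable borel"
    and k: "\<And>x. \<bar>k x\<bar> \<le> M" and u: "pint r u < top" and c: "0 < c"
  shows "integrable lborel (\<lambda>x. k x * \<bar>u (c *\<^sub>R x)\<bar> powr r)"
    "(\<integral>x. k x * \<bar>u (c *\<^sub>R x)\<bar> powr r \<partial>lborel) = c powr (- DIM('a)) * (\<integral>x. k ((1 / c) *\<^sub>R x) * \<bar>u x\<bar> powr r \<partial>lborel)"
proof -
  have "integrable lborel (\<lambda>x. k ((1 / c) *\<^sub>R x) * \<bar>u x\<bar> powr r)"
    by (rule integrable_weight) (use k u in auto)
  from lborel_integral_scale[OF this c] c
  show "integrable lborel (\<lambda>x. k x * \<bar>u (c *\<^sub>R x)\<bar> powr r)"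
    "(\<integral>x. k x * \<bar>u (c *\<^sub>R x)\<bar> powr r \<partial>lborel) = c powr (- DIM('a)) * (\<integral>x. k ((1 / c) *\<^sub>R x) * \<bar>u x\<bar> powr r \<partial>lborel)"
    by auto
qed

text \<open>Hoelder with exponents \<open>1 - \<beta>\<close> and
  \<open>\<beta> = (1 + \<delta>) / p\<close>: the difference enters through its \<open>L^p\<close>
  norm, of order \<open>c - 1\<close>, and the rest through a power \<open>t\<close> of
  \<open>u\<close> and its dilation, bounded uniformly in \<open>c\<close>.\<close>

lemma dilation_remainder:
  fixes u :: "real^'n \<Rightarrow> real" and p s \<delta> R :: real
  assumes u: "W0 \<Omega> p u G" and \<Omega>: "\<Omega> \<subseteq> cball 0 R" and p: "1 < p"
    and \<delta>: "0 < \<delta>" "1 + \<delta> < p" "\<delta> < s - 1" and fin: "\<And>r. 0 \<le> r \<Longrightarrow> pint r u < top"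
  obtains K where "\<And>c. c > 1 \<Longrightarrow> integrable lborel (\<lambda>x. (\<bar>u x\<bar> + \<bar>u (c *\<^sub>R x)\<bar>) powr (s - 1 - \<delta>) * \<bar>u (c *\<^sub>R x) - u x\<bar> powr (1 + \<delta>))"
    "\<And>c. c > 1 \<Longrightarrow> (\<integral>x. (\<bar>u x\<bar> + \<bar>u (c *\<^sub>R x)\<bar>) powr (s - 1 - \<delta>) * \<bar>u (c *\<^sub>R x) - u x\<bar> powr (1 + \<delta>) \<partial>lborel) \<le> K * (c - 1) powr (1 + \<delta>)"
proof -
  note [measurable] = W0_measurable[OF u]
  have p0: "0 < p" using p by simp
  define \<beta> where "\<beta> = (1 + \<delta>) / p"
  have \<beta>: "0 < \<beta>" "\<beta> < 1" using \<delta> p by (auto simp: \<beta>_def)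
  \<comment> \<open>Chosen so that \<open>t * (1 - \<beta>)\<close> is the exponent of the first
    factor; \<open>t\<close> may exceed the critical exponent, which is where \<open>fin\<close> is
    needed.\<close>
  define t where "t = (s - 1 - \<delta>) / (1 - \<beta>)"
  have t: "0 < t" "t * (1 - \<beta>) = s - 1 - \<delta>" using \<delta> \<beta> by (auto simp: t_def)
  define Q where "Q = ennreal (2 powr p * \<bar>R\<bar> powr p) * pint p G"
  define C where "C = epow (ennreal (2 powr t) * (2 * pint t u)) (1 - \<beta>) * epow Q \<beta>"
  have C: "C < top" using fin[of t] t W0_finite[OF u p0]
    by (auto simp: C_def Q_def ennreal_mult_less_top)
  define K where "K = enn2real C"
  have CK: "C = ennreal K" "K \<ge> 0" using C by (auto simp: K_def ennreal_enn2real)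
  have main: "(\<integral>\<^sup>+x. ennreal ((\<bar>u x\<bar> + \<bar>u (c *\<^sub>R x)\<bar>) powr (s - 1 - \<delta>) * \<bar>u (c *\<^sub>R x) - u x\<bar> powr (1 + \<delta>)) \<partial>lborel)
      \<le> ennreal (K * (c - 1) powr (1 + \<delta>))" if c: "c > 1" for c
  proof -
    have "(\<integral>\<^sup>+x. ennreal ((\<bar>u x\<bar> + \<bar>u (c *\<^sub>R x)\<bar>) powr (s - 1 - \<delta>) * \<bar>u (c *\<^sub>R x) - u x\<bar> powr (1 + \<delta>)) \<partial>lborel) =
        (\<integral>\<^sup>+x. epow (ennreal ((\<bar>u x\<bar> + \<bar>u (c *\<^sub>R x)\<bar>) powr t)) (1 - \<beta>) * epow (ennreal (norm (u (c *\<^sub>R x) - u x) powr p)) \<beta> \<partial>lborel)"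
      using p t by (intro nn_integral_cong) (simp add: epow_ennreal powr_powr \<beta>_def ennreal_mult)
    also have "\<dots> \<le> epow (\<integral>\<^sup>+x. ennreal ((\<bar>u x\<bar> + \<bar>u (c *\<^sub>R x)\<bar>) powr t) \<partial>lborel) (1 - \<beta>) *
        epow (pint p (\<lambda>x. u (c *\<^sub>R x) - u x)) \<beta>"
      unfolding pint_def using \<beta> by (intro nn_integral_Holder) auto
    also have "\<dots> \<le> epow (ennreal (2 powr t) * (2 * pint t u)) (1 - \<beta>) *
        epow (ennreal (2 powr p * ((c - 1) * \<bar>R\<bar>) powr p) * pint p G) \<beta>"
    proof (intro mult_mono epow_mono)
      have "(\<integral>\<^sup>+x. ennreal ((\<bar>u x\<bar> + \<bar>u (c *\<^sub>R x)\<bar>) powr t) \<partial>lborel) \<le>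
          (\<integral>\<^sup>+x. ennreal (2 powr t) * (ennreal (norm (u x) powr t) + ennreal (norm (u (c *\<^sub>R x)) powr t)) \<partial>lborel)"
      proof (rule nn_integral_mono)
        fix x
        have "(\<bar>u x\<bar> + \<bar>u (c *\<^sub>R x)\<bar>) powr t \<le> 2 powr t * (\<bar>u x\<bar> powr t + \<bar>u (c *\<^sub>R x)\<bar> powr t)"
          using powr_triangle[OF t(1), of "\<bar>u x\<bar>" "- \<bar>u (c *\<^sub>R x)\<bar>" 0] by simp
        then show "ennreal ((\<bar>u x\<bar> + \<bar>u (c *\<^sub>R x)\<bar>) powr t) \<le> ennreal (2 powr t) * (ennreal (norm (u x) powr t) + ennreal (norm (u (c *\<^sub>R x)) powr t))"
          by (simp add: ennreal_mult[symmetric] ennreal_plus[symmetric] ennreal_leI del: ennreal_plus)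
      qed
      also have "\<dots> = ennreal (2 powr t) * (pint t u + pint t (\<lambda>x. u (c *\<^sub>R x)))"
        unfolding pint_def by (subst nn_integral_cmult) (auto simp: nn_integral_add)
      also have "pint t (\<lambda>x. u (c *\<^sub>R x)) = ennreal (c powr (- CARD('n))) * pint t u"
        using pint_scale[of u c t] c by simp
      also have "\<dots> \<le> 1 * pint t u"
        using c powr_mono[of "- real CARD('n)" 0 c] by (intro mult_right_mono) (auto simp: ennreal_le_1)
      also have "pint t u + 1 * pint t u = 2 * pint t u" by (simp add: mult_2)
      finally show "(\<integral>\<^sup>+x. ennreal ((\<bar>u x\<bar> + \<bar>u (c *\<^sub>R x)\<bar>) powr t) \<partial>lborel) \<le> ennreal (2 powr t) * (2 * pint t u)"
        by (simp add: mult_left_mono add_left_mono)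
      have "\<Omega> \<subseteq> cball 0 \<bar>R\<bar>" using \<Omega> by (auto simp: subset_iff)
      then show "pint p (\<lambda>x. u (c *\<^sub>R x) - u x) \<le> ennreal (2 powr p * ((c - 1) * \<bar>R\<bar>) powr p) * pint p G"
        using c by (intro W0_dilation_difference[OF u _ p]) auto
    qed (use \<beta> in auto)
    also have "ennreal (2 powr p * ((c - 1) * \<bar>R\<bar>) powr p) * pint p G = ennreal ((c - 1) powr p) * Q"
    proof -
      have "2 powr p * ((c - 1) * \<bar>R\<bar>) powr p = (c - 1) powr p * (2 powr p * \<bar>R\<bar> powr p)"
        using c by (simp add: powr_mult)
      then show ?thesis by (simp add: Q_def ennreal_mult mult.assoc mult.left_commute)
    qed
    also have "epow (ennreal ((c - 1) powr p) * Q) \<beta> = ennreal ((c - 1) powr (1 + \<delta>)) * epow Q \<beta>"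
      using p by (simp add: epow_mult[OF \<beta>(1)] epow_ennreal powr_powr) (simp add: \<beta>_def)
    also have "epow (ennreal (2 powr t) * (2 * pint t u)) (1 - \<beta>) * (ennreal ((c - 1) powr (1 + \<delta>)) * epow Q \<beta>) = C * ennreal ((c - 1) powr (1 + \<delta>))"
      by (simp add: C_def mult.assoc mult.commute mult.left_commute)
    also have "\<dots> = ennreal (K * (c - 1) powr (1 + \<delta>))" using CK by (simp add: ennreal_mult)
    finally show ?thesis .
  qed
  have I: "integrable lborel (\<lambda>x. (\<bar>u x\<bar> + \<bar>u (c *\<^sub>R x)\<bar>) powr (s - 1 - \<delta>) * \<bar>u (c *\<^sub>R x) - u x\<bar> powr (1 + \<delta>))" if "c > 1" for c
    by (rule integrableI_nonneg) (use main[OF that] in \<open>auto intro: le_less_trans\<close>)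
  show ?thesis
  proof (rule that[OF I])
    fix c :: real assume c: "c > 1"
    have "ennreal (\<integral>x. (\<bar>u x\<bar> + \<bar>u (c *\<^sub>R x)\<bar>) powr (s - 1 - \<delta>) * \<bar>u (c *\<^sub>R x) - u x\<bar> powr (1 + \<delta>) \<partial>lborel)
        \<le> ennreal (K * (c - 1) powr (1 + \<delta>))"
      using main[OF c] I[OF c] by (subst nn_integral_eq_integral[symmetric]) auto
    then show "(\<integral>x. (\<bar>u x\<bar> + \<bar>u (c *\<^sub>R x)\<bar>) powr (s - 1 - \<delta>) * \<bar>u (c *\<^sub>R x) - u x\<bar> powr (1 + \<delta>) \<partial>lborel) \<le> K * (c - 1) powr (1 + \<delta>)"
      using CK by (subst (asm) ennreal_le_iff) auto
  qed auto
qed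

text \<open>By \<open>mono\<close>, and since \<open>u\<close> vanishes outside \<Omega>, the
  difference quotients are nonnegative. Fatou's lemma then bounds the integral of
  \<open>d * \<bar>u\<bar> powr r\<close> over \<Omega> by the limit 0.\<close>

lemma weight_Fatou:
  fixes k u :: "'a::euclidean_space \<Rightarrow> real"
  assumes [measurable]: "k \<in> borel_measurable borel" "u \<in> borel_measurable borel"
    and k: "\<And>x. \<bar>k x\<bar> \<le> M" and u: "pint r u < top" and u0: "\<And>x. x \<notin> \<Omega> \<Longrightarrow> u x = 0"
    and mono: "\<And>x c. x \<in> \<Omega> \<Longrightarrow> 1 \<le> c \<Longrightarrow> k x \<le> k ((1 / c) *\<^sub>R x)"
    and c: "\<And>j::nat. c j > 1"
    and d: "\<And>x. x \<in> \<Omega> \<Longrightarrow> (\<lambda>j. (k ((1 / c j) *\<^sub>R x) - k x) / (c j - 1)) \<longlonglongrightarrow> d x"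
    and lim: "(\<lambda>j. (\<integral>x. (k ((1 / c j) *\<^sub>R x) - k x) * \<bar>u x\<bar> powr r \<partial>lborel) / (c j - 1)) \<longlonglongrightarrow> 0"
  shows "AE x in lborel. x \<in> \<Omega> \<longrightarrow> d x \<noteq> 0 \<longrightarrow> u x = 0"
proof -
  define F where "F j x = (k ((1 / c j) *\<^sub>R x) - k x) / (c j - 1) * \<bar>u x\<bar> powr r" for j x
  have [measurable]: "F j \<in> borel_measurable borel" for j unfolding F_def by measurable
  have nn: "0 \<le> F j x" for j x
    using mono[of x "c j"] u0[of x] c[of j] by (cases "x \<in> \<Omega>") (auto simp: F_def)
  have int: "integrable lborel (\<lambda>x. (k ((1 / c j) *\<^sub>R x) - k x) * \<bar>u x\<bar> powr r)" for j
  proof (rule integrable_weight)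
    show "\<bar>k ((1 / c j) *\<^sub>R x) - k x\<bar> \<le> 2 * M" for x using k[of x] k[of "(1 / c j) *\<^sub>R x"] by linarith
  qed (use u in auto)
  have "integrable lborel (\<lambda>x. (k ((1 / c j) *\<^sub>R x) - k x) * \<bar>u x\<bar> powr r / (c j - 1))" for j
    using int[of j] by (rule integrable_divide)
  then have intF: "integrable lborel (F j)" for j unfolding F_def by (simp only: times_divide_eq_left)
  have "(\<integral>\<^sup>+x. ennreal (F j x) \<partial>lborel) = ennreal ((\<integral>x. (k ((1 / c j) *\<^sub>R x) - k x) * \<bar>u x\<bar> powr r \<partial>lborel) / (c j - 1))" for j
  proof -
    have "(\<integral>x. F j x \<partial>lborel) = (\<integral>x. (k ((1 / c j) *\<^sub>R x) - k x) * \<bar>u x\<bar> powr r \<partial>lborel) / (c j - 1)"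
      by (simp only: F_def times_divide_eq_left integral_divide_zero)
    then show ?thesis using intF nn by (subst nn_integral_eq_integral) auto
  qed
  then have lim0: "(\<lambda>j. \<integral>\<^sup>+x. ennreal (F j x) \<partial>lborel) \<longlonglongrightarrow> 0"
    using tendsto_ennrealI[OF lim] by simp
  have "(\<integral>\<^sup>+x. liminf (\<lambda>j. ennreal (F j x)) \<partial>lborel) \<le> liminf (\<lambda>j. \<integral>\<^sup>+x. ennreal (F j x) \<partial>lborel)"
    by (rule nn_integral_liminf) measurable
  also have "\<dots> = 0" by (rule lim_imp_Liminf[OF _ lim0]) simp
  finally have "AE x in lborel. liminf (\<lambda>j. ennreal (F j x)) = 0"
    by (subst (asm) le_zero_eq, subst (asm) nn_integral_0_iff_AE) auto
  then show ?thesis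
  proof eventually_elim
    case (elim x)
    show ?case
    proof (intro impI)
      assume x: "x \<in> \<Omega>" and dx: "d x \<noteq> 0"
      have Fx: "(\<lambda>j. F j x) \<longlonglongrightarrow> d x * \<bar>u x\<bar> powr r"
        unfolding F_def by (intro tendsto_mult d[OF x] tendsto_const)
      then have "liminf (\<lambda>j. ennreal (F j x)) = ennreal (d x * \<bar>u x\<bar> powr r)"
        by (intro lim_imp_Liminf tendsto_ennrealI) auto
      then have "d x * \<bar>u x\<bar> powr r \<le> 0" using elim by (simp add: ennreal_eq_0_iff)
      moreover have "0 \<le> d x * \<bar>u x\<bar> powr r"
        using Fx nn by (intro LIMSEQ_le_const[OF Fx]) auto
      ultimately show "u x = 0" using dx by auto
    qed
  qed
qed

lemma powr_quotient_tendsto: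
  fixes e :: real
  assumes "c \<longlonglongrightarrow> 1" "\<And>j::nat. c j > (1::real)"
  shows "(\<lambda>j. (c j powr e - 1) / (c j - 1)) \<longlonglongrightarrow> e"
proof -
  have "((\<lambda>x::real. x powr e) has_real_derivative e) (at 1)"
    by (auto intro!: derivative_eq_intros)
  then have "((\<lambda>x::real. (x powr e - 1) / (x - 1)) \<longlongrightarrow> e) (at 1)"
    by (simp add: has_field_derivative_iff)
  moreover have "filterlim c (at 1) sequentially"
    using assms by (auto simp: filterlim_at less_imp_neq[THEN not_sym])
  ultimately show ?thesis by (rule filterlim_compose)
qed

section \<open>The Pohozaev inequality\<close>

text \<open>Testing the equation with \<open>u(c \<cdot>) - u\<close>, which belongs to \<open>W\<^sub>0\<close> because \<open>\<Omega>\<close> is star-shaped.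
  Convexity replaces the regularity theory usually needed for the Pohozaev identity.\<close>

lemma dilation_inequality:
  fixes u :: "real^'n \<Rightarrow> real" and p q s \<delta> M c :: real
  defines "N \<equiv> real CARD('n)"
  assumes u: "W0 \<Omega> p u G" and star: "star_shaped_wrt 0 \<Omega>" and p: "1 < p" and q: "p - 1 < q" and s: "1 < s"
    and \<delta>: "0 < \<delta>" "\<delta> \<le> 1" "\<delta> < s - 1"
    and fin: "\<And>r. 0 \<le> r \<Longrightarrow> pint r u < top" and c: "1 < c"
    and meas[measurable]: "f \<in> borel_measurable borel" "h \<in> borel_measurable borel" "a \<in> borel_measurable borel"
    and M: "\<And>x. \<bar>f x\<bar> \<le> M" "\<And>x. \<bar>h x\<bar> \<le> M" "\<And>x. \<bar>a x\<bar> \<le> M"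
    and sign: "\<And>x. h x \<le> 0" "\<And>x. 0 \<le> a x"
    and eq: "\<And>v H. W0 \<Omega> p v H \<Longrightarrow> integrable lborel (\<lambda>x. (norm (G x) powr (p - 2) *\<^sub>R G x) \<bullet> H x)
        \<and> integrable lborel (\<lambda>x. (f x * spow (s - 1) (u x) + h x * spow q (u x) - a x * spow (p - 1) (u x)) * v x)
        \<and> (\<integral>x. (norm (G x) powr (p - 2) *\<^sub>R G x) \<bullet> H x \<partial>lborel) =
          (\<integral>x. (f x * spow (s - 1) (u x) + h x * spow q (u x) - a x * spow (p - 1) (u x)) * v x \<partial>lborel)"
    and E: "integrable lborel (\<lambda>x. norm (G x) powr p)"
    and I: "integrable lborel (\<lambda>x. (\<bar>u x\<bar> + \<bar>u (c *\<^sub>R x)\<bar>) powr (s - 1 - \<delta>) * \<bar>u (c *\<^sub>R x) - u x\<bar> powr (1 + \<delta>))"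
    and K: "(\<integral>x. (\<bar>u x\<bar> + \<bar>u (c *\<^sub>R x)\<bar>) powr (s - 1 - \<delta>) * \<bar>u (c *\<^sub>R x) - u x\<bar> powr (1 + \<delta>) \<partial>lborel) \<le> K * (c - 1) powr (1 + \<delta>)"
  shows "c powr (- N) * ((\<integral>x. f ((1 / c) *\<^sub>R x) * \<bar>u x\<bar> powr s \<partial>lborel) / s
        + (\<integral>x. h ((1 / c) *\<^sub>R x) * \<bar>u x\<bar> powr (q + 1) \<partial>lborel) / (q + 1)
        - (\<integral>x. a ((1 / c) *\<^sub>R x) * \<bar>u x\<bar> powr p \<partial>lborel) / p)
      - ((\<integral>x. f x * \<bar>u x\<bar> powr s \<partial>lborel) / s + (\<integral>x. h x * \<bar>u x\<bar> powr (q + 1) \<partial>lborel) / (q + 1)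
        - (\<integral>x. a x * \<bar>u x\<bar> powr p \<partial>lborel) / p)
      - M * (1 + s) * (K * (c - 1) powr (1 + \<delta>))
    \<le> (c powr (p - N) - 1) / p * (\<integral>x. norm (G x) powr p \<partial>lborel)"
proof -
  note [measurable] = W0_measurable[OF u]
  have p0: "0 < p" and c0: "0 < c" and q1: "1 < q + 1" using p c q by auto
  define w where "w x = u (c *\<^sub>R x)" for x
  define D where "D x = (\<bar>u x\<bar> + \<bar>w x\<bar>) powr (s - 1 - \<delta>) * \<bar>w x - u x\<bar> powr (1 + \<delta>)" for x
  have M0: "0 \<le> M" using M(1)[of 0] by simp
  have W: "W0 \<Omega> p (\<lambda>x. w x - u x) (\<lambda>x. c *\<^sub>R G (c *\<^sub>R x) - G x)"
    unfolding w_def using c by (intro W0_diff W0_scale u p0 star) auto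
  \<comment> \<open>Under dilation the energy scales by \<open>c powr p\<close> from the gradient
    and by \<open>c powr (- N)\<close> from the volume.\<close>
  have lhs: "(\<integral>x. (norm (G x) powr (p - 2) *\<^sub>R G x) \<bullet> (c *\<^sub>R G (c *\<^sub>R x) - G x) \<partial>lborel)
      \<le> (c powr (p - N) - 1) / p * (\<integral>x. norm (G x) powr p \<partial>lborel)"
  proof -
    have Ec: "integrable lborel (\<lambda>x. norm (G (c *\<^sub>R x)) powr p)"
      "(\<integral>x. norm (G (c *\<^sub>R x)) powr p \<partial>lborel) = c powr (- N) * (\<integral>x. norm (G x) powr p \<partial>lborel)"
      using lborel_integral_scale[OF E c0] by (auto simp: N_def)
    have nc: "norm (c *\<^sub>R G (c *\<^sub>R x)) powr p = c powr p * norm (G (c *\<^sub>R x)) powr p" for x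
      using c0 by (simp add: powr_mult)
    have "(\<integral>x. (norm (G x) powr (p - 2) *\<^sub>R G x) \<bullet> (c *\<^sub>R G (c *\<^sub>R x) - G x) \<partial>lborel)
        \<le> (\<integral>x. (c powr p * norm (G (c *\<^sub>R x)) powr p - norm (G x) powr p) / p \<partial>lborel)"
    proof (rule integral_mono)
      show "integrable lborel (\<lambda>x. (norm (G x) powr (p - 2) *\<^sub>R G x) \<bullet> (c *\<^sub>R G (c *\<^sub>R x) - G x))"
        using eq[OF W] by blast
      show "integrable lborel (\<lambda>x. (c powr p * norm (G (c *\<^sub>R x)) powr p - norm (G x) powr p) / p)"
        using Ec E by (intro integrable_divide Bochner_Integration.integrable_diff integrable_mult_right) auto
    qed (use norm_powr_convex[OF p] nc in metis)
    also have "\<dots> = (c powr p * (c powr (- N) * (\<integral>x. norm (G x) powr p \<partial>lborel)) - (\<integral>x. norm (G x) powr p \<partial>lborel)) / p"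
      using Ec E by simp
    also have "\<dots> = (c powr (p - N) - 1) / p * (\<integral>x. norm (G x) powr p \<partial>lborel)"
      by (simp add: left_diff_distrib mult.assoc[symmetric] powr_add[symmetric])
    finally show ?thesis .
  qed
  \<comment> \<open>Multiplication by \<open>h x \<le> 0\<close> reverses the convexity inequality,
    and \<open>a\<close> enters with a minus sign: both point the right way. Only the
    \<open>f\<close> term costs the remainder \<open>D\<close>.\<close>
  have pw: "(f x * spow (s - 1) (u x) + h x * spow q (u x) - a x * spow (p - 1) (u x)) * (w x - u x) \<ge>
      (f x * \<bar>w x\<bar> powr s - f x * \<bar>u x\<bar> powr s) / s - M * (1 + s) * D x
      + (h x * \<bar>w x\<bar> powr (q + 1) - h x * \<bar>u x\<bar> powr (q + 1)) / (q + 1)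
      - (a x * \<bar>w x\<bar> powr p - a x * \<bar>u x\<bar> powr p) / p" for x
  proof -
    have 1: "f x * spow (s - 1) (u x) * (w x - u x) \<ge> f x * (\<bar>w x\<bar> powr s - \<bar>u x\<bar> powr s) / s - M * (1 + s) * D x"
      unfolding D_def by (rule weighted_spow_ge[OF s]) (use \<delta> M in auto)
    have "spow (q + 1 - 1) (u x) * (w x - u x) \<le> (\<bar>w x\<bar> powr (q + 1) - \<bar>u x\<bar> powr (q + 1)) / (q + 1)"
      by (rule abs_powr_convex[OF q1])
    from mult_left_mono_neg[OF this sign(1)[of x]]
    have 2: "h x * spow q (u x) * (w x - u x) \<ge> h x * (\<bar>w x\<bar> powr (q + 1) - \<bar>u x\<bar> powr (q + 1)) / (q + 1)"
      by (simp add: mult.assoc)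
    from mult_left_mono[OF abs_powr_convex[OF p, of "u x" "w x"] sign(2)[of x]]
    have 3: "a x * spow (p - 1) (u x) * (w x - u x) \<le> a x * (\<bar>w x\<bar> powr p - \<bar>u x\<bar> powr p) / p"
      by (simp add: mult.assoc)
    from 1 2 3 show ?thesis by (simp only: distrib_right left_diff_distrib right_diff_distrib)
  qed
  note wi = integrable_weight[OF _ W0_measurable(1)[OF u]] and ws = weight_scale[OF _ W0_measurable(1)[OF u] _ _ c0]
  have fi: "integrable lborel (\<lambda>x. f x * \<bar>u x\<bar> powr s)" "integrable lborel (\<lambda>x. f x * \<bar>w x\<bar> powr s)"
    "(\<integral>x. f x * \<bar>w x\<bar> powr s \<partial>lborel) = c powr (- N) * (\<integral>x. f ((1 / c) *\<^sub>R x) * \<bar>u x\<bar> powr s \<partial>lborel)"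
    unfolding w_def N_def using wi[OF meas(1) M(1) fin[of "s"]] ws[OF meas(1) M(1) fin[of "s"]] s by auto
  have hi: "integrable lborel (\<lambda>x. h x * \<bar>u x\<bar> powr (q + 1))" "integrable lborel (\<lambda>x. h x * \<bar>w x\<bar> powr (q + 1))"
    "(\<integral>x. h x * \<bar>w x\<bar> powr (q + 1) \<partial>lborel) = c powr (- N) * (\<integral>x. h ((1 / c) *\<^sub>R x) * \<bar>u x\<bar> powr (q + 1) \<partial>lborel)"
    unfolding w_def N_def using wi[OF meas(2) M(2) fin[of "q + 1"]] ws[OF meas(2) M(2) fin[of "q + 1"]] q1 by auto
  have ai: "integrable lborel (\<lambda>x. a x * \<bar>u x\<bar> powr p)" "integrable lborel (\<lambda>x. a x * \<bar>w x\<bar> powr p)"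
    "(\<integral>x. a x * \<bar>w x\<bar> powr p \<partial>lborel) = c powr (- N) * (\<integral>x. a ((1 / c) *\<^sub>R x) * \<bar>u x\<bar> powr p \<partial>lborel)"
    unfolding w_def N_def using wi[OF meas(3) M(3) fin[of "p"]] ws[OF meas(3) M(3) fin[of "p"]] p by auto
  have Di: "integrable lborel D" using I by (simp add: D_def[abs_def] w_def)
  have DK: "M * (1 + s) * (\<integral>x. D x \<partial>lborel) \<le> M * (1 + s) * (K * (c - 1) powr (1 + \<delta>))"
    using K M0 s by (intro mult_left_mono) (auto simp: D_def w_def)
  define Fw Fu Hw Hu Aw Au where "Fw = (\<integral>x. f x * \<bar>w x\<bar> powr s \<partial>lborel)" and "Fu = (\<integral>x. f x * \<bar>u x\<bar> powr s \<partial>lborel)"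
    and "Hw = (\<integral>x. h x * \<bar>w x\<bar> powr (q + 1) \<partial>lborel)" and "Hu = (\<integral>x. h x * \<bar>u x\<bar> powr (q + 1) \<partial>lborel)"
    and "Aw = (\<integral>x. a x * \<bar>w x\<bar> powr p \<partial>lborel)" and "Au = (\<integral>x. a x * \<bar>u x\<bar> powr p \<partial>lborel)"
  note defs = Fw_def Fu_def Hw_def Hu_def Aw_def Au_def
  have ints: "integrable lborel (\<lambda>x. (f x * \<bar>w x\<bar> powr s - f x * \<bar>u x\<bar> powr s) / s - M * (1 + s) * D x)"
    "integrable lborel (\<lambda>x. (h x * \<bar>w x\<bar> powr (q + 1) - h x * \<bar>u x\<bar> powr (q + 1)) / (q + 1))"
    "integrable lborel (\<lambda>x. (a x * \<bar>w x\<bar> powr p - a x * \<bar>u x\<bar> powr p) / p)"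
    using fi hi ai Di by (auto intro!: Bochner_Integration.integrable_diff integrable_divide integrable_mult_right)
  have vals: "(\<integral>x. (f x * \<bar>w x\<bar> powr s - f x * \<bar>u x\<bar> powr s) / s - M * (1 + s) * D x \<partial>lborel) = (Fw - Fu) / s - M * (1 + s) * (\<integral>x. D x \<partial>lborel)"
    "(\<integral>x. (h x * \<bar>w x\<bar> powr (q + 1) - h x * \<bar>u x\<bar> powr (q + 1)) / (q + 1) \<partial>lborel) = (Hw - Hu) / (q + 1)"
    "(\<integral>x. (a x * \<bar>w x\<bar> powr p - a x * \<bar>u x\<bar> powr p) / p \<partial>lborel) = (Aw - Au) / p"
    unfolding defs using fi hi ai Di by (auto simp: Bochner_Integration.integral_diff)
  have "(Fw - Fu) / s - M * (1 + s) * (\<integral>x. D x \<partial>lborel) + (Hw - Hu) / (q + 1) - (Aw - Au) / p =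
      (\<integral>x. (f x * \<bar>w x\<bar> powr s - f x * \<bar>u x\<bar> powr s) / s - M * (1 + s) * D x
      + (h x * \<bar>w x\<bar> powr (q + 1) - h x * \<bar>u x\<bar> powr (q + 1)) / (q + 1)
      - (a x * \<bar>w x\<bar> powr p - a x * \<bar>u x\<bar> powr p) / p \<partial>lborel)"
    by (simp only: Bochner_Integration.integral_diff[OF Bochner_Integration.integrable_add[OF ints(1,2)] ints(3)]
        Bochner_Integration.integral_add[OF ints(1,2)] vals)
  also have "\<dots> \<le> (\<integral>x. (f x * spow (s - 1) (u x) + h x * spow q (u x) - a x * spow (p - 1) (u x)) * (w x - u x) \<partial>lborel)"
    by (rule integral_mono)
      (use ints eq[OF W] pw in \<open>auto intro!: Bochner_Integration.integrable_diff Bochner_Integration.integrable_add\<close>)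
  also have "\<dots> \<le> (c powr (p - N) - 1) / p * (\<integral>x. norm (G x) powr p \<partial>lborel)"
    using lhs eq[OF W] by simp
  finally have "(Fw - Fu) / s - M * (1 + s) * (\<integral>x. D x \<partial>lborel) + (Hw - Hu) / (q + 1) - (Aw - Au) / p
      \<le> (c powr (p - N) - 1) / p * (\<integral>x. norm (G x) powr p \<partial>lborel)" .
  with DK have "(Fw - Fu) / s - M * (1 + s) * (K * (c - 1) powr (1 + \<delta>)) + (Hw - Hu) / (q + 1) - (Aw - Au) / p
      \<le> (c powr (p - N) - 1) / p * (\<integral>x. norm (G x) powr p \<partial>lborel)" by linarith
  then show ?thesis
    using fi(3) hi(3) ai(3) unfolding defs[symmetric]
    by (simp add: algebra_simps diff_divide_distrib)
qed

text \<open>Divided by \<open>c j - 1\<close>, the hypothesis \<open>le\<close> bounds the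
  nonnegative quotients of \<open>T\<close> by a sequence tending to
  \<open>(p - N) / p * E + N * W\<close>, where \<open>p - N\<close> and \<open>- N\<close> are the
  derivatives at 1 of the scaling factors. The limit is nonnegative, so \<open>l\<close> makes it 0,
  and the quotients are squeezed.\<close>

lemma Pohozaev_limit:
  fixes c T :: "nat \<Rightarrow> real" and E W N p \<delta> K' :: real
  assumes c: "c \<longlonglongrightarrow> 1" "\<And>j::nat. c j > (1::real)" and \<delta>: "0 < \<delta>" and p: "p \<noteq> 0"
    and T0: "\<And>j. 0 \<le> T j"
    and le: "\<And>j. c j powr (- N) * (T j + W) - W - K' * (c j - 1) powr (1 + \<delta>) \<le> (c j powr (p - N) - 1) / p * E"
    and l: "(p - N) / p * E + N * W \<le> 0"
  shows "(p - N) / p * E + N * W = 0" "(\<lambda>j. T j / (c j - 1)) \<longlonglongrightarrow> 0"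
proof -
  define Q where "Q j = c j powr N * ((c j powr (p - N) - 1) / (c j - 1) / p * E - (c j powr (- N) - 1) / (c j - 1) * W + K' * (c j - 1) powr \<delta>)" for j
  have TQ: "T j / (c j - 1) \<le> Q j" for j
  proof -
    define d where "d = c j - 1"
    have d: "0 < d" "c j = 1 + d" using c(2)[of j] by (auto simp: d_def)
    have inv: "c j powr N * c j powr (- N) = 1" using d by (simp add: powr_add[symmetric])
    have "c j powr (- N) * T j \<le> (c j powr (p - N) - 1) / p * E - (c j powr (- N) - 1) * W + K' * (c j - 1) powr (1 + \<delta>)"
      using le[of j] by (simp add: algebra_simps)
    then have "c j powr N * (c j powr (- N) * T j) \<le> c j powr N * ((c j powr (p - N) - 1) / p * E - (c j powr (- N) - 1) * W + K' * (c j - 1) powr (1 + \<delta>))"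
      by (rule mult_left_mono) simp
    then have "T j \<le> c j powr N * ((c j powr (p - N) - 1) / p * E - (c j powr (- N) - 1) * W + K' * d powr (1 + \<delta>))"
      using inv by (simp add: mult.assoc[symmetric] d_def[symmetric])
    then have "T j / d \<le> c j powr N * ((c j powr (p - N) - 1) / p * E - (c j powr (- N) - 1) * W + K' * d powr (1 + \<delta>)) / d"
      using d by (intro divide_right_mono) auto
    also have "\<dots> = Q j"
    proof -
      have "P * (X / p * E - Y * W + K' * (d * Z)) / d = P * (X / d / p * E - Y / d * W + K' * Z)" for P X Y Z :: real
        using d(1) by (cases "p = 0") (simp_all add: field_simps)
      then show ?thesis unfolding Q_def d_def[symmetric] using d(1) by (simp add: powr_add)
    qed
    finally show ?thesis by (simp add: d_def)
  qed
  have powc: "(\<lambda>j. c j powr N) \<longlonglongrightarrow> 1 powr N" by (intro tendsto_powr c tendsto_const) simp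
  have powd: "(\<lambda>j. (c j - 1) powr \<delta>) \<longlonglongrightarrow> 0 powr \<delta>"
  proof (rule tendsto_powr'[OF _ tendsto_const])
    show "(\<lambda>j. c j - 1) \<longlonglongrightarrow> 0" using tendsto_diff[OF c(1) tendsto_const[of 1]] by simp
  qed (use \<delta> c(2) in \<open>auto simp: less_imp_le\<close>)
  have "Q \<longlonglongrightarrow> 1 powr N * ((p - N) / p * E - (- N) * W + K' * 0 powr \<delta>)"
    unfolding Q_def using powr_quotient_tendsto[OF c, of "p - N"] powr_quotient_tendsto[OF c, of "- N"]
    by (intro tendsto_mult tendsto_add tendsto_diff tendsto_divide powc powd tendsto_const)
       (use p in auto)
  then have Q: "Q \<longlonglongrightarrow> (p - N) / p * E + N * W" by simp
  have nn: "0 \<le> T j / (c j - 1)" for j using T0[of j] c(2)[of j] by simp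
  have "0 \<le> (p - N) / p * E + N * W"
    by (rule LIMSEQ_le_const[OF Q]) (use nn TQ order_trans in blast)
  with l show z: "(p - N) / p * E + N * W = 0" by simp
  show "(\<lambda>j. T j / (c j - 1)) \<longlonglongrightarrow> 0"
    by (rule tendsto_sandwich[OF _ _ tendsto_const Q[unfolded z]]) (use nn TQ in auto)
qed

text \<open>The one-sided Pohozaev identity \<open>(N - p)/p \<integral>|G|\<^sup>p \<le> N \<integral>F(x, u) + \<integral>x \<cdot> \<nabla>\<^sub>xF(x, u)\<close>, where \<open>F(x, t)\<close> is the
  primitive in \<open>t\<close> of the zero-order terms of the equation, in the
  form that under the sign assumptions every term vanishes.\<close>

theorem Pohozaev:
  fixes u :: "real^'n \<Rightarrow> real" and p q M R :: real
  defines "N \<equiv> real CARD('n)" and "s \<equiv> crit_exp CARD('n) p"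
  assumes u: "W0 \<Omega> p u G" and star: "star_shaped_wrt 0 \<Omega>" and \<Omega>R: "\<Omega> \<subseteq> cball 0 R"
    and p: "1 < p" "p < N" and q: "p - 1 < q" "q < s - 1"
    and fin: "\<And>r. 0 \<le> r \<Longrightarrow> pint r u < top" and u0: "\<And>x. x \<notin> \<Omega> \<Longrightarrow> u x = 0"
    and meas[measurable]: "f \<in> borel_measurable borel" "h \<in> borel_measurable borel" "a \<in> borel_measurable borel"
    and M: "\<And>x. \<bar>f x\<bar> \<le> M" "\<And>x. \<bar>h x\<bar> \<le> M" "\<And>x. \<bar>a x\<bar> \<le> M"
    and sign: "\<And>x. h x \<le> 0" "\<And>x. 0 \<le> a x"
    and mono: "\<And>x c. x \<in> \<Omega> \<Longrightarrow> 1 \<le> c \<Longrightarrow> f x \<le> f ((1 / c) *\<^sub>R x)"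
       "\<And>x c. x \<in> \<Omega> \<Longrightarrow> 1 \<le> c \<Longrightarrow> h x \<le> h ((1 / c) *\<^sub>R x)"
       "\<And>x c. x \<in> \<Omega> \<Longrightarrow> 1 \<le> c \<Longrightarrow> - a x \<le> - a ((1 / c) *\<^sub>R x)"
    and eq: "\<And>v H. W0 \<Omega> p v H \<Longrightarrow> integrable lborel (\<lambda>x. (norm (G x) powr (p - 2) *\<^sub>R G x) \<bullet> H x)
        \<and> integrable lborel (\<lambda>x. (f x * spow (s - 1) (u x) + h x * spow q (u x) - a x * spow (p - 1) (u x)) * v x)
        \<and> (\<integral>x. (norm (G x) powr (p - 2) *\<^sub>R G x) \<bullet> H x \<partial>lborel) =
          (\<integral>x. (f x * spow (s - 1) (u x) + h x * spow q (u x) - a x * spow (p - 1) (u x)) * v x \<partial>lborel)"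
    and c: "c \<longlonglongrightarrow> 1" "\<And>j::nat. c j > (1::real)"
  shows "AE x in lborel. h x \<noteq> 0 \<longrightarrow> u x = 0" "AE x in lborel. a x \<noteq> 0 \<longrightarrow> u x = 0"
    "(\<lambda>j. (\<integral>x. (f ((1 / c j) *\<^sub>R x) - f x) * \<bar>u x\<bar> powr s \<partial>lborel) / (c j - 1)) \<longlonglongrightarrow> 0"
    "(\<lambda>j. (\<integral>x. (h ((1 / c j) *\<^sub>R x) - h x) * \<bar>u x\<bar> powr (q + 1) \<partial>lborel) / (c j - 1)) \<longlonglongrightarrow> 0"
    "(\<lambda>j. (\<integral>x. (- a ((1 / c j) *\<^sub>R x) - - a x) * \<bar>u x\<bar> powr p \<partial>lborel) / (c j - 1)) \<longlonglongrightarrow> 0"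
proof -
  note [measurable] = W0_measurable[OF u]
  have p0: "0 < p" and N0: "0 < N" using p by auto
  have sdef: "s = N * p / (N - p)" by (simp add: s_def N_def crit_exp_def)
  note sf = crit_exp_facts[OF p sdef]
  have q0: "0 < q" and q1: "0 < q + 1" using p q by auto
  \<comment> \<open>Half of \<open>p - 1\<close> secures \<open>1 + \<delta> < p\<close>, and
    \<open>p < s\<close> then gives \<open>\<delta> < s - 1\<close>; the cap 1 is required by the
    Hoelder continuity of \<open>spow\<close>.\<close>
  define \<delta> where "\<delta> = min 1 ((p - 1) / 2)"
  have \<delta>: "0 < \<delta>" "\<delta> \<le> 1" "1 + \<delta> < p" "\<delta> < s - 1" using p sf by (auto simp: \<delta>_def min_def field_simps)
  have s0: "0 < s" using sf by simp
  define E where "E = (\<integral>x. norm (G x) powr p \<partial>lborel)"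
  have Ei: "integrable lborel (\<lambda>x. norm (G x) powr p)"
    using W0_finite(2)[OF u p0] by (intro integrableI_nonneg) (auto simp: pint_def)
  have Wi: "integrable lborel (\<lambda>x. k x * \<bar>u x\<bar> powr r)" "integrable lborel (\<lambda>x. k ((1 / b) *\<^sub>R x) * \<bar>u x\<bar> powr r)"
    if [measurable]: "k \<in> borel_measurable borel" and "\<And>x. \<bar>k x\<bar> \<le> M" "0 \<le> r" for k r and b :: real
    using that fin by (auto intro!: integrable_weight[where M=M])
  define F H A where "F = (\<integral>x. f x * \<bar>u x\<bar> powr s \<partial>lborel)" and "H = (\<integral>x. h x * \<bar>u x\<bar> powr (q + 1) \<partial>lborel)"
    and "A = (\<integral>x. a x * \<bar>u x\<bar> powr p \<partial>lborel)"
  define TF TH TA where "TF b = (\<integral>x. (f ((1 / b) *\<^sub>R x) - f x) * \<bar>u x\<bar> powr s \<partial>lborel)"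
    and "TH b = (\<integral>x. (h ((1 / b) *\<^sub>R x) - h x) * \<bar>u x\<bar> powr (q + 1) \<partial>lborel)"
    and "TA b = (\<integral>x. (- a ((1 / b) *\<^sub>R x) - - a x) * \<bar>u x\<bar> powr p \<partial>lborel)" for b :: real
  have TF: "(\<integral>x. f ((1 / b) *\<^sub>R x) * \<bar>u x\<bar> powr s \<partial>lborel) = TF b + F"
    and TH: "(\<integral>x. h ((1 / b) *\<^sub>R x) * \<bar>u x\<bar> powr (q + 1) \<partial>lborel) = TH b + H"
    and TA: "(\<integral>x. a ((1 / b) *\<^sub>R x) * \<bar>u x\<bar> powr p \<partial>lborel) = A - TA b" for b
    unfolding TF_def TH_def TA_def F_def H_def A_def
    using Wi(1)[OF meas(1) M(1), of s] Wi(1)[OF meas(2) M(2), of "q + 1"] Wi(1)[OF meas(3) M(3), of p] s0 q1 p0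
      Wi(2)[OF meas(1) M(1), where r=s and b=b] Wi(2)[OF meas(2) M(2), where r="q + 1" and b=b] Wi(2)[OF meas(3) M(3), where r=p and b=b]
    by (auto simp: left_diff_distrib Bochner_Integration.integral_diff Bochner_Integration.integral_add Bochner_Integration.integral_minus)
  have nn: "0 \<le> TF b" "0 \<le> TH b" "0 \<le> TA b" if "1 \<le> b" for b
  proof -
    have "0 \<le> (f ((1 / b) *\<^sub>R x) - f x) * \<bar>u x\<bar> powr s" "0 \<le> (h ((1 / b) *\<^sub>R x) - h x) * \<bar>u x\<bar> powr (q + 1)"
      "0 \<le> (- a ((1 / b) *\<^sub>R x) - - a x) * \<bar>u x\<bar> powr p" for x
      using mono[of x b] that u0[of x] by (cases "x \<in> \<Omega>"; simp)+
    then show "0 \<le> TF b" "0 \<le> TH b" "0 \<le> TA b"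
      unfolding TF_def TH_def TA_def by (auto intro!: Bochner_Integration.integral_nonneg)
  qed
  obtain K where K: "\<And>c. c > 1 \<Longrightarrow> integrable lborel (\<lambda>x. (\<bar>u x\<bar> + \<bar>u (c *\<^sub>R x)\<bar>) powr (s - 1 - \<delta>) * \<bar>u (c *\<^sub>R x) - u x\<bar> powr (1 + \<delta>))"
    "\<And>c. c > 1 \<Longrightarrow> (\<integral>x. (\<bar>u x\<bar> + \<bar>u (c *\<^sub>R x)\<bar>) powr (s - 1 - \<delta>) * \<bar>u (c *\<^sub>R x) - u x\<bar> powr (1 + \<delta>) \<partial>lborel) \<le> K * (c - 1) powr (1 + \<delta>)"
    by (rule dilation_remainder[OF u \<Omega>R p(1) \<delta>(1,3,4) fin]) (auto intro: that)
  \<comment> \<open>The increments of the three weights between \<open>x\<close> and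
    \<open>(1 / c j) *\<^sub>R x\<close>. Each is nonnegative, so control of the sum controls every
    one of them.\<close>
  define T where "T j = TF (c j) / s + TH (c j) / (q + 1) + TA (c j) / p" for j
  define W where "W = F / s + H / (q + 1) - A / p"
  have T0: "0 \<le> T j" for j
    using nn[of "c j"] c(2)[of j] s0 q1 p0 by (simp add: T_def)
  have le: "c j powr (- N) * (T j + W) - W - M * (1 + s) * K * (c j - 1) powr (1 + \<delta>) \<le> (c j powr (p - N) - 1) / p * E" for j
  proof -
    have "c j powr (- N) * ((TF (c j) + F) / s + (TH (c j) + H) / (q + 1) - (A - TA (c j)) / p) - (F / s + H / (q + 1) - A / p)
        - M * (1 + s) * (K * (c j - 1) powr (1 + \<delta>)) \<le> (c j powr (p - N) - 1) / p * E"
      using dilation_inequality[OF u star p(1) q(1) sf(2) \<delta>(1,2,4) fin c(2) meas M sign eq Ei K(1)[OF c(2)] K(2)[OF c(2)], of j]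
      unfolding TF TH TA F_def[symmetric] H_def[symmetric] A_def[symmetric] E_def[symmetric] N_def[symmetric] .
    moreover have "(TF (c j) + F) / s + (TH (c j) + H) / (q + 1) - (A - TA (c j)) / p = T j + W"
      by (simp add: T_def W_def add_divide_distrib diff_divide_distrib)
    ultimately show ?thesis by (simp add: W_def mult.assoc)
  qed
  \<comment> \<open>The equation tested with \<open>u\<close> itself; it eliminates \<open>E\<close>
    from the Pohozaev expression.\<close>
  have EFHA: "E = F + H - A"
  proof -
    have "(norm (G x) powr (p - 2) *\<^sub>R G x) \<bullet> G x = norm (G x) powr p" for x
    proof (cases "G x = 0")
      case False
      then have "G x \<bullet> G x = norm (G x) powr 2" by (simp add: power2_norm_eq_inner)
      then show ?thesis by (simp only: inner_scaleR_left powr_add[symmetric]) simp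
    qed simp
    moreover have "(f x * spow (s - 1) (u x) + h x * spow q (u x) - a x * spow (p - 1) (u x)) * u x
        = f x * \<bar>u x\<bar> powr s + h x * \<bar>u x\<bar> powr (q + 1) - a x * \<bar>u x\<bar> powr p" for x
      using spow_mult_self[of "s - 1" "u x"] spow_mult_self[of q "u x"] spow_mult_self[of "p - 1" "u x"]
      by (simp add: distrib_right left_diff_distrib mult.assoc)
    ultimately have "E = (\<integral>x. f x * \<bar>u x\<bar> powr s + h x * \<bar>u x\<bar> powr (q + 1) - a x * \<bar>u x\<bar> powr p \<partial>lborel)"
      using eq[OF u] by (simp add: E_def)
    also have "\<dots> = F + H - A"
      unfolding F_def H_def A_def
      using Wi(1)[OF meas(1) M(1), of s] Wi(1)[OF meas(2) M(2), of "q + 1"] Wi(1)[OF meas(3) M(3), of p] s0 q1 p0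
      by (simp add: Bochner_Integration.integral_diff Bochner_Integration.integral_add)
    finally show ?thesis .
  qed
  have A0: "0 \<le> A" unfolding A_def using sign by (auto intro!: Bochner_Integration.integral_nonneg)
  have "0 \<le> (\<integral>x. - (h x * \<bar>u x\<bar> powr (q + 1)) \<partial>lborel)"
    by (rule Bochner_Integration.integral_nonneg) (simp add: sign mult_nonpos_nonneg)
  then have H0: "H \<le> 0" by (simp add: H_def)
  have pne: "p \<noteq> 0" using p0 by simp
  \<comment> \<open>The coefficient left on \<open>H\<close> after elimination of \<open>E\<close>.
    As \<open>(N - p) / p\<close> equals \<open>N / s\<close>, it is positive because
    \<open>q + 1 < s\<close>.\<close>
  define \<kappa> where "\<kappa> = N / (q + 1) - (N - p) / p"
  have \<kappa>: "0 < \<kappa>"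
  proof -
    have "N / s < N / (q + 1)" using q q1 N0 by (intro divide_strict_left_mono) auto
    moreover have "N / s = (N - p) / p" using p N0 by (simp add: sdef)
    ultimately show ?thesis by (simp add: \<kappa>_def)
  qed
  \<comment> \<open>For the critical exponent the coefficients of \<open>F\<close> cancel, so no
    sign of \<open>f\<close> enters; those of \<open>A\<close> add up to -1.\<close>
  have l: "(p - N) / p * E + N * W = \<kappa> * H - A"
  proof -
    define x y where "x = (N - p) / p" and "y = N / (q + 1)"
    have 1: "(p - N) / p = - x" and 2: "N / p = x + 1"
      unfolding x_def using p0 by (simp_all add: diff_divide_distrib)
    have 3: "N / s = x" using p N0 by (simp add: sdef x_def)
    have "N * W = (N / s) * F + y * H - (N / p) * A" by (simp add: W_def y_def algebra_simps)
    then have 4: "N * W = x * F + y * H - (x + 1) * A" by (simp only: 2 3)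
    show ?thesis unfolding 1 4 EFHA \<kappa>_def x_def[symmetric] y_def[symmetric] by (simp add: algebra_simps)
  qed
  have l0: "\<kappa> * H \<le> 0" using \<kappa> H0 by (simp add: mult_nonneg_nonpos)
  have "(p - N) / p * E + N * W \<le> 0" using l l0 A0 by simp
  note lim = Pohozaev_limit[OF c \<delta>(1) pne T0 le this]
  \<comment> \<open>Both \<open>\<kappa> * H\<close> and \<open>- A\<close> are nonpositive and
    their sum is zero.\<close>
  have "A = 0" "H = 0" using lim(1) l l0 A0 \<kappa> by (auto simp: mult_less_0_iff)
  have "AE x in lborel. - (h x * \<bar>u x\<bar> powr (q + 1)) = 0"
    using \<open>H = 0\<close> Wi(1)[OF meas(2) M(2), of "q + 1"] q1 sign
    by (subst integral_nonneg_eq_0_iff_AE[symmetric]) (auto simp: H_def mult_nonpos_nonneg)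
  then show "AE x in lborel. h x \<noteq> 0 \<longrightarrow> u x = 0" by eventually_elim auto
  have "AE x in lborel. a x * \<bar>u x\<bar> powr p = 0"
    using \<open>A = 0\<close> Wi(1)[OF meas(3) M(3), of p] p0 sign
    by (subst integral_nonneg_eq_0_iff_AE[symmetric]) (auto simp: A_def)
  then show "AE x in lborel. a x \<noteq> 0 \<longrightarrow> u x = 0" by eventually_elim auto
  \<comment> \<open>A nonnegative summand of \<open>T\<close> inherits the vanishing of the
    quotients of \<open>T\<close>.\<close>
  have part: "(\<lambda>j. X (c j) / (c j - 1)) \<longlonglongrightarrow> 0"
    if X: "\<And>j. 0 \<le> X (c j)" "\<And>j. X (c j) / r \<le> T j" and r: "0 < r" for X r
  proof (rule tendsto_sandwich[OF _ _ tendsto_const])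
    show "(\<lambda>j. r * (T j / (c j - 1))) \<longlonglongrightarrow> 0" using tendsto_mult[OF tendsto_const lim(2), of r] by simp
    have "X (c j) / (c j - 1) \<le> r * (T j / (c j - 1))" for j
    proof -
      have "X (c j) \<le> r * T j" using X(2)[of j] r by (simp add: divide_le_eq mult.commute)
      then have "X (c j) / (c j - 1) \<le> r * T j / (c j - 1)" using c(2)[of j] by (intro divide_right_mono) auto
      then show ?thesis by simp
    qed
    then show "\<forall>\<^sub>F j in sequentially. X (c j) / (c j - 1) \<le> r * (T j / (c j - 1))" by simp
    show "\<forall>\<^sub>F j in sequentially. 0 \<le> X (c j) / (c j - 1)"
      using X(1) c(2) by (intro always_eventually allI divide_nonneg_nonneg) (auto simp: less_imp_le)
  qed
  have nnc: "0 \<le> TF (c j)" "0 \<le> TH (c j)" "0 \<le> TA (c j)" for j using nn[of "c j"] c(2)[of j] by auto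
  show "(\<lambda>j. (\<integral>x. (f ((1 / c j) *\<^sub>R x) - f x) * \<bar>u x\<bar> powr s \<partial>lborel) / (c j - 1)) \<longlonglongrightarrow> 0"
    "(\<lambda>j. (\<integral>x. (h ((1 / c j) *\<^sub>R x) - h x) * \<bar>u x\<bar> powr (q + 1) \<partial>lborel) / (c j - 1)) \<longlonglongrightarrow> 0"
    "(\<lambda>j. (\<integral>x. (- a ((1 / c j) *\<^sub>R x) - - a x) * \<bar>u x\<bar> powr p \<partial>lborel) / (c j - 1)) \<longlonglongrightarrow> 0"
    unfolding TF_def[symmetric] TH_def[symmetric] TA_def[symmetric]
    using nnc s0 q1 p0 by (auto intro!: part[of TF s] part[of TH "q + 1"] part[of TA p] simp: T_def)
qed

section \<open>Borel representatives of solutions\<close>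

lemma borel_measurable_lebesgue_on_borel:
  fixes f :: "'a::euclidean_space \<Rightarrow> 'b::topological_space"
  assumes "f \<in> borel_measurable borel"
  shows "f \<in> borel_measurable (lebesgue_on S)"
  using assms by (intro measurable_restrict_space1 measurable_completion) simp

text \<open>Bridges \<open>lebesgue_on S\<close>, in which solutions are defined, and Borel
  functions on the whole space, for which dilations and Fubini were carried out. Each component has
  a Borel version, the components are reassembled, and the result is cut off outside
  \<open>S\<close>.\<close>

lemma borel_version:
  fixes v :: "'a::euclidean_space \<Rightarrow> 'b::euclidean_space"
  assumes v: "v \<in> borel_measurable (lebesgue_on S)" and S: "S \<in> sets borel"
  obtains v' where "v' \<in> borel_measurable borel" "\<And>x. x \<notin> S \<Longrightarrow> v' x = 0" "AE x in lebesgue_on S. v x = v' x"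
proof -
  have SL: "S \<in> sets lebesgue" using S by auto
  define v1 where "v1 x = (if x \<in> S then v x else 0)" for x
  have v1: "v1 \<in> borel_measurable (completion lborel)"
    using borel_measurable_if_I[OF v SL] by (simp add: v1_def[abs_def])
  have "\<exists>w. w \<in> borel_measurable borel \<and> (AE x in lborel. v1 x \<bullet> b = w x)" for b
  proof -
    have "(\<lambda>x. v1 x \<bullet> b) \<in> borel_measurable (completion lborel)" using v1 by simp
    from completion_ex_borel_measurable_real[OF this] show ?thesis by auto
  qed
  then have "\<exists>w. \<forall>b. w b \<in> borel_measurable borel \<and> (AE x in lborel. v1 x \<bullet> b = w b x)"
    by (intro choice) blast
  then obtain w where w: "\<And>b. w b \<in> borel_measurable borel" "\<And>b. AE x in lborel. v1 x \<bullet> b = w b x"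
    by blast
  note [measurable] = w(1) S
  define v' where "v' x = indicator S x *\<^sub>R (\<Sum>b\<in>Basis. w b x *\<^sub>R b)" for x
  have "AE x in lborel. \<forall>b\<in>Basis. v1 x \<bullet> b = w b x"
    using w(2) by (intro AE_finite_allI) auto
  then have "AE x in lebesgue. \<forall>b\<in>Basis. v1 x \<bullet> b = w b x" by (rule AE_completion)
  then have ae: "AE x in lebesgue. x \<in> S \<longrightarrow> v x = v' x"
  proof eventually_elim
    case (elim x)
    have "v1 x = (\<Sum>b\<in>Basis. (v1 x \<bullet> b) *\<^sub>R b)" by (simp add: euclidean_representation)
    also have "\<dots> = (\<Sum>b\<in>Basis. w b x *\<^sub>R b)" using elim by simp
    finally show ?case by (auto simp: v'_def v1_def)
  qed
  show ?thesis
  proof (rule that)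
    show "v' \<in> borel_measurable borel" unfolding v'_def by measurable
    show "v' x = 0" if "x \<notin> S" for x using that by (simp add: v'_def)
    show "AE x in lebesgue_on S. v x = v' x"
      using ae SL by (subst AE_restrict_space_iff) auto
  qed
qed

lemma integral_borel_version:
  fixes F :: "'a::euclidean_space \<Rightarrow> 'b::euclidean_space"
  assumes S: "S \<in> sets borel" and F: "F \<in> borel_measurable (lebesgue_on S)"
    and F': "F' \<in> borel_measurable borel" "\<And>x. x \<notin> S \<Longrightarrow> F' x = 0" and ae: "AE x in lebesgue_on S. F x = F' x"
  shows "(\<integral>x. F x \<partial>lebesgue_on S) = (\<integral>x. F' x \<partial>lborel)"
    "integrable (lebesgue_on S) F \<longleftrightarrow> integrable lborel F'"
proof -
  have S': "S \<inter> space lebesgue \<in> sets lebesgue" using S by auto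
  have eq: "(\<lambda>x. indicator S x *\<^sub>R F' x) = F'"
    using F'(2) by (auto simp: indicator_def fun_eq_iff)
  note F'L = borel_measurable_lebesgue_on_borel[OF F'(1), of S]
  have "(\<integral>x. F x \<partial>lebesgue_on S) = (\<integral>x. F' x \<partial>lebesgue_on S)"
    by (rule integral_cong_AE[OF F F'L ae])
  also have "\<dots> = (\<integral>x. F' x \<partial>lebesgue)" by (subst integral_restrict_space[OF S']) (simp only: eq)
  also have "\<dots> = (\<integral>x. F' x \<partial>lborel)" using F' by (intro integral_completion) auto
  finally show "(\<integral>x. F x \<partial>lebesgue_on S) = (\<integral>x. F' x \<partial>lborel)" .
  have "integrable (lebesgue_on S) F \<longleftrightarrow> integrable (lebesgue_on S) F'"
    by (rule integrable_cong_AE[OF F F'L ae])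
  also have "\<dots> \<longleftrightarrow> integrable lebesgue F'" by (subst integrable_restrict_space[OF S']) (simp only: eq)
  also have "\<dots> \<longleftrightarrow> integrable lborel F'" using F' by (intro integrable_completion) auto
  finally show "integrable (lebesgue_on S) F \<longleftrightarrow> integrable lborel F'" .
qed

lemma Lp_norm_borel_version:
  fixes w :: "real^'n \<Rightarrow> 'b::euclidean_space"
  assumes S: "S \<in> sets borel" and w: "w \<in> borel_measurable (lebesgue_on S)"
    and w': "w' \<in> borel_measurable borel" "\<And>x. x \<notin> S \<Longrightarrow> w' x = 0" and ae: "AE x in lebesgue_on S. w x = w' x"
  shows "Lp_norm S p w = enn2real (pint p w') powr (1 / p)"
    "integrable (lebesgue_on S) (\<lambda>x. norm (w x) powr p) \<Longrightarrow> pint p w' < top"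
proof -
  note [measurable] = w w'(1)
  have ae': "AE x in lebesgue_on S. norm (w x) powr p = norm (w' x) powr p" using ae by eventually_elim simp
  note ib = integral_borel_version[OF S _ _ _ ae']
  have "(\<integral>x. norm (w x) powr p \<partial>lebesgue_on S) = (\<integral>x. norm (w' x) powr p \<partial>lborel)"
    by (rule ib(1)) (use w'(2) in auto)
  also have "\<dots> = enn2real (pint p w')" unfolding pint_def by (rule integral_eq_nn_integral) auto
  finally show "Lp_norm S p w = enn2real (pint p w') powr (1 / p)" by (simp add: Lp_norm_def)
  assume "integrable (lebesgue_on S) (\<lambda>x. norm (w x) powr p)"
  then have "integrable lborel (\<lambda>x. norm (w' x) powr p)"
    by (subst (asm) ib(2)) (use w'(2) in auto)
  then show "pint p w' < top" by (simp add: pint_def integrable_iff_bounded)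
qed

text \<open>Local integrability speaks of compact subsets only; measurability on \<Omega> is glued
  from a countable cover by closed boxes.\<close>

lemma locally_integrable_measurable:
  fixes G :: "real^'n \<Rightarrow> 'b::euclidean_space"
  assumes \<Omega>: "open \<Omega>" and G: "locally_integrable \<Omega> G"
  shows "G \<in> borel_measurable (lebesgue_on \<Omega>)"
proof -
  obtain D where D: "countable D" "D \<subseteq> Pow \<Omega>" "\<And>X. X \<in> D \<Longrightarrow> \<exists>a b. X = cbox a b" "\<Union>D = \<Omega>"
    using open_countable_Union_open_cbox[OF \<Omega>] by blast
  show ?thesis
  proof (rule measurable_piecewise_restrict[OF D(1)])
    fix X assume X: "X \<in> D"
    then obtain a b where ab: "X = cbox a b" "X \<subseteq> \<Omega>" using D(2,3) by blast
    have "X \<in> sets lebesgue" using ab by simp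
    then show "X \<inter> space (lebesgue_on \<Omega>) \<in> sets (lebesgue_on \<Omega>)"
      using ab \<Omega> by (auto simp: sets_restrict_space space_restrict_space)
    have "G \<in> borel_measurable (lebesgue_on X)"
      using G ab compact_cbox unfolding locally_integrable_def by (intro borel_measurable_integrable) blast
    moreover have "restrict_space (lebesgue_on \<Omega>) X = lebesgue_on X"
      using \<Omega> ab \<open>X \<in> sets lebesgue\<close> by (subst restrict_restrict_space) (auto simp: Int_absorb1)
    ultimately show "G \<in> borel_measurable (restrict_space (lebesgue_on \<Omega>) X)" by simp
  qed (use D(4) in \<open>auto simp: space_restrict_space\<close>)
qed

lemma locally_integrable_borel_version:
  fixes G :: "real^'n \<Rightarrow> 'b::euclidean_space"
  assumes \<Omega>: "open \<Omega>" and G: "locally_integrable \<Omega> G" and G': "G' \<in> borel_measurable borel"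
    and ae: "AE x in lebesgue_on \<Omega>. G x = G' x" and K: "compact K" "K \<subseteq> \<Omega>"
  shows "integrable lborel (\<lambda>x. indicator K x *\<^sub>R G' x)"
proof -
  have KB: "K \<in> sets borel" "K \<in> sets lebesgue" using K by (auto simp: compact_imp_closed)
  note [measurable] = G' KB(1)
  have GK: "integrable (lebesgue_on K) G" using G K by (auto simp: locally_integrable_def)
  have "AE x in lebesgue. x \<in> \<Omega> \<longrightarrow> G x = G' x" using ae \<Omega> by (subst (asm) AE_restrict_space_iff) auto
  then have "AE x in lebesgue_on K. G x = indicator K x *\<^sub>R G' x"
    using KB K by (subst AE_restrict_space_iff) (auto elim!: eventually_mono)
  from integral_borel_version(2)[OF KB(1) _ _ _ this] GK show ?thesis by (auto simp: borel_measurable_integrable)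
qed

text \<open>The gradient chosen in \<open>is_solution\<close> need not be the one witnessing
  membership in \<open>sobolev_W0\<close>. Their difference annihilates all test functions, and the
  fundamental lemma applies to its Borel version.\<close>

lemma weak_gradient_unique:
  fixes G\<^sub>1 G\<^sub>2 :: "real^'n \<Rightarrow> real^'n"
  assumes \<Omega>: "open \<Omega>" and w: "has_weak_gradient \<Omega> u G\<^sub>1" "has_weak_gradient \<Omega> u G\<^sub>2"
  shows "AE x in lebesgue_on \<Omega>. G\<^sub>1 x = G\<^sub>2 x"
proof -
  have \<Omega>B: "\<Omega> \<in> sets borel" using \<Omega> by auto
  have loc: "locally_integrable \<Omega> G\<^sub>1" "locally_integrable \<Omega> G\<^sub>2" using w by (auto simp: has_weak_gradient_def)
  note m = loc[THEN locally_integrable_measurable[OF \<Omega>]]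
  obtain H\<^sub>1 where H1: "H\<^sub>1 \<in> borel_measurable borel" "\<And>x. x \<notin> \<Omega> \<Longrightarrow> H\<^sub>1 x = 0" "AE x in lebesgue_on \<Omega>. G\<^sub>1 x = H\<^sub>1 x"
    by (rule borel_version[OF m(1) \<Omega>B]) (rule that)
  obtain H\<^sub>2 where H2: "H\<^sub>2 \<in> borel_measurable borel" "\<And>x. x \<notin> \<Omega> \<Longrightarrow> H\<^sub>2 x = 0" "AE x in lebesgue_on \<Omega>. G\<^sub>2 x = H\<^sub>2 x"
    by (rule borel_version[OF m(2) \<Omega>B]) (rule that)
  note [measurable] = H1(1) H2(1)
  have "AE x in lborel. x \<in> \<Omega> \<longrightarrow> H\<^sub>1 x - H\<^sub>2 x = 0"
  proof (rule fundamental_lemma[OF \<Omega>])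
    show "integrable lborel (\<lambda>x. indicator (cbox a b) x *\<^sub>R (H\<^sub>1 x - H\<^sub>2 x))" if "cbox a b \<subseteq> \<Omega>" for a b
      using locally_integrable_borel_version[OF \<Omega> loc(1) H1(1,3) compact_cbox that]
        locally_integrable_borel_version[OF \<Omega> loc(2) H2(1,3) compact_cbox that]
      by (simp add: scaleR_diff_right)
    fix \<phi> assume \<phi>: "test_function \<Omega> \<phi>"
    note [measurable] = test_function_measurable[OF \<phi>]
    define K where "K = closure {x. \<phi> x \<noteq> 0}"
    have K: "compact K" "K \<subseteq> \<Omega>" using \<phi> by (auto simp: K_def test_function_def)
    have K0: "\<phi> x = 0" if "x \<notin> K" for x using that closure_subset[of "{x. \<phi> x \<noteq> 0}"] by (auto simp: K_def)
    have "bounded (\<phi> ` K)"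
      using K by (intro compact_imp_bounded compact_continuous_image continuous_on_subset[OF continuous_on_test_function[OF \<phi>]]) auto
    then obtain B where B: "\<And>x. x \<in> K \<Longrightarrow> \<bar>\<phi> x\<bar> \<le> B" by (auto simp: bounded_iff)
    have val: "(\<integral>x. \<phi> x *\<^sub>R G x \<partial>lebesgue_on \<Omega>) = (\<integral>x. \<phi> x *\<^sub>R H x \<partial>lborel)" "integrable lborel (\<lambda>x. \<phi> x *\<^sub>R H x)"
      if GH: "G \<in> borel_measurable (lebesgue_on \<Omega>)" "locally_integrable \<Omega> G" "H \<in> borel_measurable borel"
        "\<And>x. x \<notin> \<Omega> \<Longrightarrow> H x = 0" "AE x in lebesgue_on \<Omega>. G x = H x" for G H :: "real^'n \<Rightarrow> real^'n"
    proof -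
      note [measurable] = GH(1,3) borel_measurable_lebesgue_on_borel[OF test_function_measurable(1)[OF \<phi>], of \<Omega>]
      have ae: "AE x in lebesgue_on \<Omega>. \<phi> x *\<^sub>R G x = \<phi> x *\<^sub>R H x" using GH(5) by eventually_elim simp
      show "(\<integral>x. \<phi> x *\<^sub>R G x \<partial>lebesgue_on \<Omega>) = (\<integral>x. \<phi> x *\<^sub>R H x \<partial>lborel)"
        by (rule integral_borel_version(1)[OF \<Omega>B _ _ _ ae]) (use GH(4) in auto)
      have I: "integrable lborel (\<lambda>x. B *\<^sub>R (indicator K x *\<^sub>R H x))"
        by (intro integrable_scaleR_right locally_integrable_borel_version[OF \<Omega> GH(2,3,5) K])
      show "integrable lborel (\<lambda>x. \<phi> x *\<^sub>R H x)"
      proof (rule Bochner_Integration.integrable_bound[OF I])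
        have "norm (\<phi> x *\<^sub>R H x) \<le> norm (B *\<^sub>R (indicator K x *\<^sub>R H x))" for x
          using B[of x] K0[of x] by (cases "x \<in> K") (auto intro!: mult_right_mono)
        then show "AE x in lborel. norm (\<phi> x *\<^sub>R H x) \<le> norm (B *\<^sub>R (indicator K x *\<^sub>R H x))" by simp
      qed measurable
    qed
    note v1 = val[OF m(1) loc(1) H1] and v2 = val[OF m(2) loc(2) H2]
    have "(\<integral>x. \<phi> x *\<^sub>R G\<^sub>1 x \<partial>lebesgue_on \<Omega>) = (\<integral>x. \<phi> x *\<^sub>R G\<^sub>2 x \<partial>lebesgue_on \<Omega>)"
    proof -
      have "(\<integral>x. u x *\<^sub>R grad \<phi> x \<partial>lebesgue_on \<Omega>) = - (\<integral>x. \<phi> x *\<^sub>R G\<^sub>1 x \<partial>lebesgue_on \<Omega>)"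
        "(\<integral>x. u x *\<^sub>R grad \<phi> x \<partial>lebesgue_on \<Omega>) = - (\<integral>x. \<phi> x *\<^sub>R G\<^sub>2 x \<partial>lebesgue_on \<Omega>)"
        using w \<phi> unfolding has_weak_gradient_def by blast+
      then show ?thesis by (simp only: neg_equal_iff_equal)
    qed
    then show "(\<integral>x. \<phi> x *\<^sub>R (H\<^sub>1 x - H\<^sub>2 x) \<partial>lborel) = 0"
      using v1 v2 by (simp add: scaleR_diff_right)
  qed measurable
  then have "AE x in lebesgue. x \<in> \<Omega> \<longrightarrow> H\<^sub>1 x - H\<^sub>2 x = 0" by (rule AE_completion)
  then have "AE x in lebesgue_on \<Omega>. H\<^sub>1 x - H\<^sub>2 x = 0" using \<Omega> by (subst AE_restrict_space_iff) auto
  with H1(3) H2(3) show ?thesis by eventually_elim simp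
qed

text \<open>The extension by zero does not disturb the approximation, since test functions and their
  gradients vanish outside \<Omega> as well; uniqueness of weak gradients identifies
  \<open>G\<close> with the limit of the gradients.\<close>

lemma sobolev_W0_borel_version:
  fixes u :: "real^'n \<Rightarrow> real"
  assumes \<Omega>: "open \<Omega>" and p: "1 < p" and u: "u \<in> sobolev_W0 \<Omega> p" and w: "has_weak_gradient \<Omega> u G"
  obtains u' G' where "W0 \<Omega> p u' G'" "\<And>x. x \<notin> \<Omega> \<Longrightarrow> u' x = 0" "\<And>x. x \<notin> \<Omega> \<Longrightarrow> G' x = 0"
    "AE x in lebesgue_on \<Omega>. u x = u' x" "AE x in lebesgue_on \<Omega>. G x = G' x"
proof -
  have \<Omega>B: "\<Omega> \<in> sets borel" using \<Omega> by auto
  have p0: "0 < p" using p by simp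
  from u obtain G\<^sub>0 \<phi> where G0: "has_weak_gradient \<Omega> u G\<^sub>0" "Lp_function \<Omega> p G\<^sub>0" and Lu: "Lp_function \<Omega> p u"
    and \<phi>: "\<And>k::nat. test_function \<Omega> (\<phi> k)"
      "(\<lambda>k. Lp_norm \<Omega> p (\<lambda>x. grad (\<phi> k) x - G\<^sub>0 x) + Lp_norm \<Omega> p (\<lambda>x. \<phi> k x - u x)) \<longlonglongrightarrow> 0"
    by (auto simp: sobolev_W0_def)
  note [measurable] = test_function_measurable[OF \<phi>(1)]
  have mL: "u \<in> borel_measurable (lebesgue_on \<Omega>)" "G\<^sub>0 \<in> borel_measurable (lebesgue_on \<Omega>)"
    using Lu G0(2) by (auto simp: Lp_function_def)
  obtain u' where u': "u' \<in> borel_measurable borel" "\<And>x. x \<notin> \<Omega> \<Longrightarrow> u' x = 0" "AE x in lebesgue_on \<Omega>. u x = u' x"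
    by (rule borel_version[OF mL(1) \<Omega>B]) (rule that)
  obtain G' where G': "G' \<in> borel_measurable borel" "\<And>x. x \<notin> \<Omega> \<Longrightarrow> G' x = 0" "AE x in lebesgue_on \<Omega>. G\<^sub>0 x = G' x"
    by (rule borel_version[OF mL(2) \<Omega>B]) (rule that)
  note [measurable] = u'(1) G'(1) mL
  note tL = test_function_measurable[OF \<phi>(1), THEN borel_measurable_lebesgue_on_borel[of _ \<Omega>]]
  have fin: "pint p u' < top" "pint p G' < top"
    using Lp_norm_borel_version(2)[OF \<Omega>B mL(1) u'] Lp_norm_borel_version(2)[OF \<Omega>B mL(2) G'] Lu G0(2)
    by (auto simp: Lp_function_def)
  \<comment> \<open>Finiteness is an assumption here because \<open>enn2real\<close> sends
    \<open>top\<close> to 0: an infinite integral would pass for a vanishing norm.\<close>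
  have conv: "(\<lambda>k. pint p (w k)) \<longlonglongrightarrow> 0"
    if w: "\<And>k. pint p (w k) < top" "(\<lambda>k. enn2real (pint p (w k)) powr (1 / p)) \<longlonglongrightarrow> 0"
    for w :: "nat \<Rightarrow> real^'n \<Rightarrow> 'c::euclidean_space"
  proof -
    have "(\<lambda>k. (enn2real (pint p (w k)) powr (1 / p)) powr p) \<longlonglongrightarrow> 0 powr p"
      using w p0 by (intro tendsto_powr' tendsto_const) auto
    then have "(\<lambda>k. enn2real (pint p (w k))) \<longlonglongrightarrow> 0" using p0 by (simp add: powr_powr)
    then have "(\<lambda>k. ennreal (enn2real (pint p (w k)))) \<longlonglongrightarrow> ennreal 0" by (rule tendsto_ennrealI)
    then show ?thesis using w by (simp add: ennreal_enn2real)
  qed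
  have nu: "Lp_norm \<Omega> p (\<lambda>x. \<phi> k x - u x) = enn2real (pint p (\<lambda>x. \<phi> k x - u' x)) powr (1 / p)" for k
    by (rule Lp_norm_borel_version(1)[OF \<Omega>B])
      (use tL u' test_function_eq_0[OF \<phi>(1)] in \<open>auto elim!: eventually_mono\<close>)
  have nG: "Lp_norm \<Omega> p (\<lambda>x. grad (\<phi> k) x - G\<^sub>0 x) = enn2real (pint p (\<lambda>x. grad (\<phi> k) x - G' x)) powr (1 / p)" for k
    by (rule Lp_norm_borel_version(1)[OF \<Omega>B])
      (use tL G' test_function_eq_0[OF \<phi>(1)] in \<open>auto elim!: eventually_mono\<close>)
  \<comment> \<open>Rules out that \<open>Lp_norm\<close> is 0 merely because the integrand is not
    integrable.\<close>
  have fk: "pint p (\<lambda>x. \<phi> k x - u' x) < top" for k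
  proof -
    have "pint p (\<lambda>x. \<phi> k x - u' x) \<le> ennreal (2 powr p) * (pint p (\<lambda>x. \<phi> k x - 0) + pint p (\<lambda>x. 0 - u' x))"
      by (rule pint_triangle) (use p0 in auto)
    also have "\<dots> < top" using fin pint_test_function_finite(1)[OF \<phi>(1)[of k] p0]
      by (simp add: ennreal_mult_less_top pint_minus_commute[of p "\<lambda>_. 0"] pint_def)
    finally show ?thesis .
  qed
  have gk: "pint p (\<lambda>x. grad (\<phi> k) x - G' x) < top" for k
  proof -
    have "pint p (\<lambda>x. grad (\<phi> k) x - G' x) \<le> ennreal (2 powr p) * (pint p (\<lambda>x. grad (\<phi> k) x - 0) + pint p (\<lambda>x. 0 - G' x))"
      by (rule pint_triangle) (use p0 in auto)
    also have "\<dots> < top" using fin pint_test_function_finite(2)[OF \<phi>(1)[of k] p0]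
      by (simp add: ennreal_mult_less_top pint_minus_commute[of p "\<lambda>_. 0"] pint_def)
    finally show ?thesis .
  qed
  have lims: "(\<lambda>k. Lp_norm \<Omega> p (\<lambda>x. \<phi> k x - u x)) \<longlonglongrightarrow> 0" "(\<lambda>k. Lp_norm \<Omega> p (\<lambda>x. grad (\<phi> k) x - G\<^sub>0 x)) \<longlonglongrightarrow> 0"
    by (rule tendsto_sandwich[OF _ _ tendsto_const \<phi>(2)]; simp add: Lp_norm_def)+
  have W: "W0 \<Omega> p u' G'"
    unfolding W0_def
    using conv[of "\<lambda>k x. \<phi> k x - u' x", OF fk lims(1)[unfolded nu]] conv[of "\<lambda>k x. grad (\<phi> k) x - G' x", OF gk lims(2)[unfolded nG]]
      \<phi>(1) u'(1) G'(1) by blast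
  have "AE x in lebesgue_on \<Omega>. G x = G' x"
    using weak_gradient_unique[OF \<Omega> w G0(1)] G'(3) by eventually_elim simp
  then show ?thesis using that[OF W u'(2) G'(2) u'(3)] by blast
qed

text \<open>The smooth extension \<open>g\<close> agrees with \<open>f\<close> on the closure.
  Openness of \<Omega> transfers differentiability at its points, and compactness of the closure
  gives the bound.\<close>

lemma smooth_up_to_closure:
  fixes f :: "real^'n \<Rightarrow> real"
  assumes \<Omega>: "open \<Omega>" "bounded \<Omega>" and f: "smooth_up_to (closure \<Omega>) f"
  shows "x \<in> \<Omega> \<Longrightarrow> f differentiable (at x)" "continuous_on \<Omega> f" "\<exists>B. \<forall>x\<in>\<Omega>. \<bar>f x\<bar> \<le> B"
proof -
  obtain U g where g: "open U" "closure \<Omega> \<subseteq> U" "smooth_on U g" "\<And>x. x \<in> closure \<Omega> \<Longrightarrow> g x = f x"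
    using f by (auto simp: smooth_up_to_def)
  have gf: "g x = f x" if "x \<in> \<Omega>" for x using g(4) that closure_subset by blast
  have sub: "\<Omega> \<subseteq> U" using g(2) closure_subset by blast
  have "Ck_on (Suc 0) U g" "Ck_on 0 U g" using g(3) unfolding smooth_on_def by blast+
  then have gd: "\<And>x. x \<in> U \<Longrightarrow> g differentiable (at x)" and gc: "continuous_on U g" by auto
  show fd: "f differentiable (at x)" if x: "x \<in> \<Omega>" for x
  proof -
    obtain D where "(g has_derivative D) (at x)" using gd sub x unfolding differentiable_def by blast
    then have "(f has_derivative D) (at x)"
      by (rule has_derivative_transform_within_open[OF _ \<Omega>(1) x gf])
    then show ?thesis by (auto simp: differentiable_def)
  qed
  show "continuous_on \<Omega> f"
    by (intro continuous_at_imp_continuous_on ballI differentiable_imp_continuous_within fd)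
  have "compact (closure \<Omega>)" using \<Omega>(2) by simp
  then have "bounded (g ` closure \<Omega>)"
    using gc g(2) by (intro compact_imp_bounded compact_continuous_image) (auto intro: continuous_on_subset)
  then obtain B where "\<And>x. x \<in> closure \<Omega> \<Longrightarrow> \<bar>g x\<bar> \<le> B" by (auto simp: bounded_iff)
  then show "\<exists>B. \<forall>x\<in>\<Omega>. \<bar>f x\<bar> \<le> B" using gf closure_subset[of \<Omega>] by (metis subsetD)
qed

lemma spow_eqs:
  "spow (p - 1) t = \<bar>t\<bar> powr (p - 2) * t" "spow q t = \<bar>t\<bar> powr (q - 1) * t"
  by (simp_all add: spow_def)

text \<open>The coefficients are multiplied by the indicator of \<Omega> because nothing is known
  about them outside; this leaves the integrals unchanged, as \<open>u'\<close> and \<open>G\<close>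
  vanish there.\<close>

lemma is_solution_borel_version:
  fixes \<Omega> :: "(real^'n) set" and a f h u :: "real^'n \<Rightarrow> real" and p q :: real
  defines "s \<equiv> crit_exp CARD('n) p"
  assumes \<Omega>: "open \<Omega>" and p: "1 < p" and sol: "is_solution \<Omega> p q a f h u"
    and cont: "continuous_on \<Omega> a" "continuous_on \<Omega> f" "continuous_on \<Omega> h"
  obtains u' G where "W0 \<Omega> p u' G" "\<And>x. x \<notin> \<Omega> \<Longrightarrow> u' x = 0" "AE x in lebesgue_on \<Omega>. u x = u' x"
    "\<And>\<phi>. test_function \<Omega> \<phi> \<Longrightarrow>
      (\<integral>x. (norm (G x) powr (p - 2) *\<^sub>R G x) \<bullet> grad \<phi> x + indicator \<Omega> x *\<^sub>R a x * spow (p - 1) (u' x) * \<phi> x \<partial>lborel)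
      = (\<integral>x. (indicator \<Omega> x *\<^sub>R f x * spow (s - 1) (u' x) + indicator \<Omega> x *\<^sub>R h x * spow q (u' x)) * \<phi> x \<partial>lborel)"
proof -
  have \<Omega>B: "\<Omega> \<in> sets borel" "\<Omega> \<in> sets lebesgue" using \<Omega> by auto
  obtain G0 where u: "u \<in> sobolev_W0 \<Omega> p" and w: "has_weak_gradient \<Omega> u G0" and
    eq: "\<And>\<phi>. test_function \<Omega> \<phi> \<Longrightarrow>
         (\<integral>x. (norm (G0 x) powr (p - 2) *\<^sub>R G0 x) \<bullet> grad \<phi> x
              + a x * \<bar>u x\<bar> powr (p - 2) * u x * \<phi> x \<partial>lebesgue_on \<Omega>)
       = (\<integral>x. (f x * \<bar>u x\<bar> powr (s - 2) * u x
              + h x * \<bar>u x\<bar> powr (q - 1) * u x) * \<phi> x \<partial>lebesgue_on \<Omega>)"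
    using sol unfolding is_solution_def s_def by blast
  obtain u' G where W: "W0 \<Omega> p u' G" and z: "\<And>x. x \<notin> \<Omega> \<Longrightarrow> u' x = 0" "\<And>x. x \<notin> \<Omega> \<Longrightarrow> G x = 0"
    and ae: "AE x in lebesgue_on \<Omega>. u x = u' x" "AE x in lebesgue_on \<Omega>. G0 x = G x"
    by (rule sobolev_W0_borel_version[OF \<Omega> p u w]) (rule that)
  note [measurable] = W0_measurable[OF W] borel_measurable_continuous_on_indicator[OF \<Omega>B(1) cont(1)]
    borel_measurable_continuous_on_indicator[OF \<Omega>B(1) cont(2)] borel_measurable_continuous_on_indicator[OF \<Omega>B(1) cont(3)]
  have [measurable]: "u \<in> borel_measurable (lebesgue_on \<Omega>)"
    using u by (auto simp: sobolev_W0_def Lp_function_def)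
  have [measurable]: "G0 \<in> borel_measurable (lebesgue_on \<Omega>)"
    using w by (intro locally_integrable_measurable[OF \<Omega>]) (simp add: has_weak_gradient_def)
  have [measurable]: "a \<in> borel_measurable (lebesgue_on \<Omega>)" "f \<in> borel_measurable (lebesgue_on \<Omega>)" "h \<in> borel_measurable (lebesgue_on \<Omega>)"
    using cont \<Omega>B(2) by (auto intro: continuous_imp_measurable_on_sets_lebesgue)
  have in\<Omega>: "AE x in lebesgue_on \<Omega>. x \<in> \<Omega>" using \<Omega>B by (subst AE_restrict_space_iff) auto
  have "(\<integral>x. (norm (G x) powr (p - 2) *\<^sub>R G x) \<bullet> grad \<phi> x + indicator \<Omega> x *\<^sub>R a x * spow (p - 1) (u' x) * \<phi> x \<partial>lborel)
      = (\<integral>x. (indicator \<Omega> x *\<^sub>R f x * spow (s - 1) (u' x) + indicator \<Omega> x *\<^sub>R h x * spow q (u' x)) * \<phi> x \<partial>lborel)"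
    if \<phi>: "test_function \<Omega> \<phi>" for \<phi>
  proof -
    note [measurable] = test_function_measurable[OF \<phi>] test_function_measurable[OF \<phi>, THEN borel_measurable_lebesgue_on_borel[of _ \<Omega>]]
    have "(\<integral>x. (norm (G0 x) powr (p - 2) *\<^sub>R G0 x) \<bullet> grad \<phi> x + a x * \<bar>u x\<bar> powr (p - 2) * u x * \<phi> x \<partial>lebesgue_on \<Omega>) =
        (\<integral>x. (norm (G x) powr (p - 2) *\<^sub>R G x) \<bullet> grad \<phi> x + indicator \<Omega> x *\<^sub>R a x * spow (p - 1) (u' x) * \<phi> x \<partial>lborel)"
    proof (rule integral_borel_version(1)[OF \<Omega>B(1)])
      show "AE x in lebesgue_on \<Omega>. (norm (G0 x) powr (p - 2) *\<^sub>R G0 x) \<bullet> grad \<phi> x + a x * \<bar>u x\<bar> powr (p - 2) * u x * \<phi> x =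
          (norm (G x) powr (p - 2) *\<^sub>R G x) \<bullet> grad \<phi> x + indicator \<Omega> x *\<^sub>R a x * spow (p - 1) (u' x) * \<phi> x"
        using ae in\<Omega> by eventually_elim (simp add: spow_eqs(1) mult.assoc)
    qed (use z in \<open>measurable, auto\<close>)
    moreover have "(\<integral>x. (f x * \<bar>u x\<bar> powr (s - 2) * u x + h x * \<bar>u x\<bar> powr (q - 1) * u x) * \<phi> x \<partial>lebesgue_on \<Omega>) =
        (\<integral>x. (indicator \<Omega> x *\<^sub>R f x * spow (s - 1) (u' x) + indicator \<Omega> x *\<^sub>R h x * spow q (u' x)) * \<phi> x \<partial>lborel)"
    proof (rule integral_borel_version(1)[OF \<Omega>B(1)])
      show "AE x in lebesgue_on \<Omega>. (f x * \<bar>u x\<bar> powr (s - 2) * u x + h x * \<bar>u x\<bar> powr (q - 1) * u x) * \<phi> x =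
          (indicator \<Omega> x *\<^sub>R f x * spow (s - 1) (u' x) + indicator \<Omega> x *\<^sub>R h x * spow q (u' x)) * \<phi> x"
        using ae(1) in\<Omega>
      proof eventually_elim
        case (elim x)
        then have "indicator \<Omega> x = (1::real)" by simp
        then show ?case by (simp only: elim(1) spow_eqs(1)[of s] spow_eqs(2)[of q] scaleR_one mult.assoc)
      qed
      show "(\<lambda>x. (f x * \<bar>u x\<bar> powr (s - 2) * u x + h x * \<bar>u x\<bar> powr (q - 1) * u x) * \<phi> x) \<in> borel_measurable (lebesgue_on \<Omega>)"
        by measurable
      show "(\<lambda>x. (indicator \<Omega> x *\<^sub>R f x * spow (s - 1) (u' x) + indicator \<Omega> x *\<^sub>R h x * spow q (u' x)) * \<phi> x) \<in> borel_measurable borel"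
        by measurable
    qed (simp add: z)
    ultimately show ?thesis using eq[OF \<phi>] by simp
  qed
  then show ?thesis using that[OF W z(1) ae(1)] by blast
qed

section \<open>Checking the hypotheses for a solution, and the conclusion\<close>

lemma pint_add_finite:
  fixes f g :: "'a::euclidean_space \<Rightarrow> real"
  assumes [measurable]: "f \<in> borel_measurable borel" "g \<in> borel_measurable borel"
    and "0 < r" "pint r f < top" "pint r g < top"
  shows "pint r (\<lambda>x. f x + g x) < top" "pint r (\<lambda>x. f x - g x) < top"
proof -
  have "pint r (\<lambda>x. f x - - g x) \<le> ennreal (2 powr r) * (pint r (\<lambda>x. f x - 0) + pint r (\<lambda>x. 0 - - g x))"
    by (rule pint_triangle) (use assms in auto)
  also have "pint r (\<lambda>x. 0 - - g x) = pint r g" by simp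
  also have "ennreal (2 powr r) * (pint r (\<lambda>x. f x - 0) + pint r g) < top" using assms by (simp add: ennreal_mult_less_top)
  finally show "pint r (\<lambda>x. f x + g x) < top" by simp
  have "pint r (\<lambda>x. f x - g x) \<le> ennreal (2 powr r) * (pint r (\<lambda>x. f x - 0) + pint r (\<lambda>x. 0 - g x))"
    by (rule pint_triangle) (use assms in auto)
  also have "pint r (\<lambda>x. 0 - g x) = pint r g" by (simp add: pint_def)
  also have "ennreal (2 powr r) * (pint r (\<lambda>x. f x - 0) + pint r g) < top" using assms by (simp add: ennreal_mult_less_top)
  finally show "pint r (\<lambda>x. f x - g x) < top" .
qed

text \<open>Growth of order at most \<open>s - 1\<close>, raised to the dual exponent of
  \<open>s\<close>, is at most the critical power; smaller exponents are compensated by the finite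
  measure of \<Omega>.\<close>

lemma pint_weighted_spow_finite:
  fixes k u :: "'a::euclidean_space \<Rightarrow> real"
  assumes [measurable]: "k \<in> borel_measurable borel" "u \<in> borel_measurable borel" "\<Omega> \<in> sets borel"
    and k: "\<And>x. \<bar>k x\<bar> \<le> M" and s: "1 < s" "pint s u < top" and r: "0 < r" "r \<le> s - 1"
    and \<Omega>: "emeasure lborel \<Omega> < top" and u0: "\<And>x. x \<notin> \<Omega> \<Longrightarrow> u x = 0"
  shows "pint (s / (s - 1)) (\<lambda>x. k x * spow r (u x)) < top"
proof -
  define t where "t = s / (s - 1)"
  have t: "0 < t" "r * t \<le> s"
  proof -
    show "0 < t" using s by (simp add: t_def)
    then have "r * t \<le> (s - 1) * t" using r by (intro mult_right_mono) auto
    then show "r * t \<le> s" using s by (simp add: t_def)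
  qed
  have M: "0 \<le> M" using k[of 0] by simp
  have "pint t (\<lambda>x. k x * spow r (u x)) \<le> (\<integral>\<^sup>+x. ennreal (M powr t) * (indicator \<Omega> x + ennreal (norm (u x) powr s)) \<partial>lborel)"
    unfolding pint_def
  proof (rule nn_integral_mono)
    fix x
    have "\<bar>k x * spow r (u x)\<bar> powr t = \<bar>k x\<bar> powr t * \<bar>u x\<bar> powr (r * t)"
      by (simp add: abs_mult abs_spow powr_mult powr_powr)
    also have "\<dots> \<le> M powr t * \<bar>u x\<bar> powr (r * t)"
      using k t by (intro mult_right_mono powr_mono2) auto
    finally have 1: "ennreal (norm (k x * spow r (u x)) powr t) \<le> ennreal (M powr t) * ennreal (\<bar>u x\<bar> powr (r * t))"
      by (simp add: ennreal_mult[symmetric] ennreal_leI)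
    have 2: "ennreal (\<bar>u x\<bar> powr (r * t)) \<le> indicator \<Omega> x + ennreal (norm (u x) powr s)"
    proof (cases "x \<in> \<Omega>")
      case True
      show ?thesis
      proof (cases "\<bar>u x\<bar> \<le> 1")
        case le: True
        have "\<bar>u x\<bar> powr (r * t) \<le> 1" using le r t by (intro powr_le1) auto
        then show ?thesis using True by (auto intro!: add_increasing2 simp: ennreal_le_1)
      next
        case False
        then have "\<bar>u x\<bar> powr (r * t) \<le> \<bar>u x\<bar> powr s" using t by (intro powr_mono) auto
        then show ?thesis by (auto intro!: add_increasing ennreal_leI)
      qed
    qed (simp add: u0)
    show "ennreal (norm (k x * spow r (u x)) powr t) \<le> ennreal (M powr t) * (indicator \<Omega> x + ennreal (norm (u x) powr s))"
      using order_trans[OF 1 mult_left_mono[OF 2]] by simp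
  qed
  also have "\<dots> = ennreal (M powr t) * (emeasure lborel \<Omega> + pint s u)"
    unfolding pint_def by (subst nn_integral_cmult) (auto simp: nn_integral_add)
  also have "\<dots> < top" using s \<Omega> by (simp add: ennreal_mult_less_top)
  finally show ?thesis by (simp add: t_def)
qed

lemma solution_vanishes:
  fixes \<Omega> :: "(real^'n) set"
    and a f h :: "real^'n \<Rightarrow> real"
    and p q :: real
  assumes \<Omega>: "bounded \<Omega>" "open \<Omega>" and star: "star_shaped_wrt 0 \<Omega>"
    and p: "1 < p" "p < real CARD('n)"
    and q: "p - 1 < q" "q < crit_exp CARD('n) p - 1"
    and smooth: "smooth_up_to (closure \<Omega>) a" "smooth_up_to (closure \<Omega>) f" "smooth_up_to (closure \<Omega>) h"
    and sign: "\<forall>x\<in>\<Omega>. a x \<ge> 0" "\<forall>x\<in>\<Omega>. radial_deriv a x \<ge> 0" "\<forall>x\<in>\<Omega>. radial_deriv f x \<le> 0"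
       "\<forall>x\<in>\<Omega>. h x \<le> 0" "\<forall>x\<in>\<Omega>. radial_deriv h x \<le> 0"
    and strict: "(\<forall>x\<in>\<Omega> - {0}. a x > 0) \<or>
         (\<forall>x\<in>\<Omega> - {0}. radial_deriv a x > 0) \<or>
         (\<forall>x\<in>\<Omega> - {0}. radial_deriv f x < 0) \<or>
         (\<forall>x\<in>\<Omega> - {0}. h x < 0) \<or>
         (\<forall>x\<in>\<Omega> - {0}. radial_deriv h x < 0)"
    and sol: "is_solution \<Omega> p q a f h u"
  shows "AE x in lebesgue_on \<Omega>. u x = 0"
proof -
  have p0: "0 < p" using p by simp
  define s where "s = crit_exp CARD('n) p"
  have sf: "p < s" "1 < s"
    using crit_exp_facts[OF p, of s] by (auto simp: s_def crit_exp_def)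
  note sa = smooth_up_to_closure[OF \<Omega>(2,1) smooth(1)]
    and sff = smooth_up_to_closure[OF \<Omega>(2,1) smooth(2)]
    and sh = smooth_up_to_closure[OF \<Omega>(2,1) smooth(3)]
  \<comment> \<open>Extended by zero, the coefficients are Borel and bounded everywhere and keep the
    signs of \<open>a\<close> and \<open>h\<close>. Monotonicity along rays is used only inside
    \<Omega>, where the extension is invisible.\<close>
  define a1 f1 h1 where "a1 x = indicator \<Omega> x *\<^sub>R a x" and "f1 x = indicator \<Omega> x *\<^sub>R f x" and "h1 x = indicator \<Omega> x *\<^sub>R h x" for x
  have \<Omega>B[measurable]: "\<Omega> \<in> sets borel" using \<Omega> by auto
  have meas[measurable]: "f1 \<in> borel_measurable borel" "h1 \<in> borel_measurable borel" "a1 \<in> borel_measurable borel"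
    unfolding a1_def[abs_def] f1_def[abs_def] h1_def[abs_def]
    by (intro borel_measurable_continuous_on_indicator \<Omega>B sa(2) sff(2) sh(2))+
  have \<Omega>fin: "emeasure lborel \<Omega> < top"
    using emeasure_bounded_finite[OF \<Omega>(1)] by simp
  obtain R where R: "\<Omega> \<subseteq> cball 0 R"
    using \<Omega>(1) by (auto simp: bounded_iff subset_iff)
  obtain Ma Mf Mh where "\<forall>x\<in>\<Omega>. \<bar>a x\<bar> \<le> Ma" "\<forall>x\<in>\<Omega>. \<bar>f x\<bar> \<le> Mf" "\<forall>x\<in>\<Omega>. \<bar>h x\<bar> \<le> Mh"
    using sa(3) sff(3) sh(3) by blast
  then obtain M where M: "\<And>x. \<bar>f1 x\<bar> \<le> M" "\<And>x. \<bar>h1 x\<bar> \<le> M" "\<And>x. \<bar>a1 x\<bar> \<le> M"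
    by (intro that[of "max 0 (max Ma (max Mf Mh))"]; simp add: a1_def f1_def h1_def indicator_def; force)
  have M0: "0 \<le> M" using M(1)[of 0] by simp
  obtain u' G where W: "W0 \<Omega> p u' G" and u0: "\<And>x. x \<notin> \<Omega> \<Longrightarrow> u' x = 0" and ae: "AE x in lebesgue_on \<Omega>. u x = u' x"
    and eq0: "\<And>\<phi>. test_function \<Omega> \<phi> \<Longrightarrow>
      (\<integral>x. (norm (G x) powr (p - 2) *\<^sub>R G x) \<bullet> grad \<phi> x + a1 x * spow (p - 1) (u' x) * \<phi> x \<partial>lborel)
      = (\<integral>x. (f1 x * spow (s - 1) (u' x) + h1 x * spow q (u' x)) * \<phi> x \<partial>lborel)"
    by (rule is_solution_borel_version[OF \<Omega>(2) p(1) sol sa(2) sff(2) sh(2), folded a1_def f1_def h1_def s_def])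
      (rule that)
  note [measurable] = W0_measurable[OF W]
  define A where "A = (\<lambda>x. norm (G x) powr (p - 2) *\<^sub>R G x)"
  define g where "g x = f1 x * spow (s - 1) (u' x) + h1 x * spow q (u' x) - a1 x * spow (p - 1) (u' x)" for x
  have [measurable]: "A \<in> borel_measurable borel" "g \<in> borel_measurable borel"
    unfolding A_def g_def[abs_def] by measurable
  have us: "pint s u' < top" unfolding s_def by (rule W0_Sobolev(1)[OF W p])
  have Af: "pint (p / (p - 1)) A < top"
  proof -
    have "norm (A x) powr (p / (p - 1)) = norm (G x) powr p" for x
    proof -
      have "norm (A x) = norm (G x) powr (p - 1)"
        using abs_spow[of "p - 1" "norm (G x)"] by (simp add: A_def spow_def)
      then show ?thesis using p by (simp add: powr_powr)
    qed
    then show ?thesis using W0_finite(2)[OF W p0] by (simp add: pint_def)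
  qed
  \<comment> \<open>All three growth exponents \<open>s - 1\<close>, \<open>q\<close> and
    \<open>p - 1\<close> are at most \<open>s - 1\<close>.\<close>
  have gf: "pint (s / (s - 1)) (\<lambda>x. f1 x * spow (s - 1) (u' x)) < top"
      "pint (s / (s - 1)) (\<lambda>x. h1 x * spow q (u' x)) < top" "pint (s / (s - 1)) (\<lambda>x. a1 x * spow (p - 1) (u' x)) < top"
    by (rule pint_weighted_spow_finite[OF meas(1) W0_measurable(1)[OF W] \<Omega>B M(1) sf(2) us _ _ \<Omega>fin u0];
        use sf in simp)
      (rule pint_weighted_spow_finite[OF meas(2) W0_measurable(1)[OF W] \<Omega>B M(2) sf(2) us _ _ \<Omega>fin u0]
        pint_weighted_spow_finite[OF meas(3) W0_measurable(1)[OF W] \<Omega>B M(3) sf(2) us _ _ \<Omega>fin u0];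
        use p q sf in \<open>simp add: s_def\<close>)+
  have s': "0 < s / (s - 1)" using sf by simp
  have gfin: "pint (s / (s - 1)) g < top"
    unfolding g_def[abs_def] using gf s' by (intro pint_add_finite) auto
  have eq1: "(\<integral>x. A x \<bullet> grad \<phi> x \<partial>lborel) = (\<integral>x. g x * \<phi> x \<partial>lborel)" if \<phi>: "test_function \<Omega> \<phi>" for \<phi>
  proof -
    note [measurable] = test_function_measurable[OF \<phi>]
    have I: "integrable lborel (\<lambda>x. k x * \<phi> x)" if [measurable]: "k \<in> borel_measurable borel" and "pint (s / (s - 1)) k < top" for k
      using integrable_inner_pint[of k \<phi> s] that sf pint_test_function_finite(1)[OF \<phi>, of s] by simp
    have IA: "integrable lborel (\<lambda>x. A x \<bullet> grad \<phi> x)"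
      using Af p pint_test_function_finite(2)[OF \<phi> p0] by (intro integrable_inner_pint) auto
    have Ifh: "integrable lborel (\<lambda>x. (f1 x * spow (s - 1) (u' x) + h1 x * spow q (u' x)) * \<phi> x)"
      using gf s' by (intro I pint_add_finite) auto
    have Ia: "integrable lborel (\<lambda>x. a1 x * spow (p - 1) (u' x) * \<phi> x)" using gf by (intro I) auto
    have "(\<integral>x. A x \<bullet> grad \<phi> x \<partial>lborel) + (\<integral>x. a1 x * spow (p - 1) (u' x) * \<phi> x \<partial>lborel) =
        (\<integral>x. (f1 x * spow (s - 1) (u' x) + h1 x * spow q (u' x)) * \<phi> x \<partial>lborel)"
      using eq0[OF \<phi>] IA Ia by (simp add: A_def)
    moreover have "(\<integral>x. g x * \<phi> x \<partial>lborel) = (\<integral>x. (f1 x * spow (s - 1) (u' x) + h1 x * spow q (u' x)) * \<phi> x \<partial>lborel)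
        - (\<integral>x. a1 x * spow (p - 1) (u' x) * \<phi> x \<partial>lborel)"
      unfolding g_def left_diff_distrib by (rule Bochner_Integration.integral_diff[OF Ifh Ia])
    ultimately show ?thesis by simp
  qed
  have eq: "integrable lborel (\<lambda>x. A x \<bullet> H x) \<and> integrable lborel (\<lambda>x. g x * v x)
        \<and> (\<integral>x. A x \<bullet> H x \<partial>lborel) = (\<integral>x. g x * v x \<partial>lborel)" if "W0 \<Omega> p v H" for v H
    using equation_W0[of A g p \<Omega> v H] p Af gfin eq1 that by (auto simp: s_def)
  have sign1: "h1 x \<le> 0" "0 \<le> a1 x" for x using sign by (auto simp: h1_def a1_def indicator_def)
  have gsign: "g x * t \<le> M * \<bar>u' x\<bar> powr (s - 1) * \<bar>t\<bar>" if "0 \<le> u' x * t" for x t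
  proof -
    have pos: "0 \<le> spow r (u' x) * t" for r
      using that by (simp add: spow_def mult.assoc)
    have "f1 x * spow (s - 1) (u' x) * t \<le> \<bar>f1 x * spow (s - 1) (u' x) * t\<bar>" by simp
    also have "\<dots> = \<bar>f1 x\<bar> * (\<bar>u' x\<bar> powr (s - 1) * \<bar>t\<bar>)" by (simp add: abs_mult abs_spow mult.assoc)
    also have "\<dots> \<le> M * (\<bar>u' x\<bar> powr (s - 1) * \<bar>t\<bar>)" using M(1) by (intro mult_right_mono) auto
    finally have "f1 x * spow (s - 1) (u' x) * t \<le> M * \<bar>u' x\<bar> powr (s - 1) * \<bar>t\<bar>" by (simp add: mult.assoc)
    moreover have "h1 x * (spow q (u' x) * t) \<le> 0" "0 \<le> a1 x * (spow (p - 1) (u' x) * t)"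
      using sign1 pos by (auto intro: mult_nonpos_nonneg mult_nonneg_nonneg)
    ultimately show ?thesis by (simp add: g_def distrib_right left_diff_distrib mult.assoc)
  qed
  have fin: "pint r u' < top" if "0 \<le> r" for r
    by (rule higher_integrability[OF W p A_def _ eq _ M0 \<Omega>fin \<Omega>B u0 that]) (use gsign in \<open>auto simp: s_def\<close>)
  have mem: "(1 / c) *\<^sub>R x \<in> \<Omega>" if "x \<in> \<Omega>" "1 \<le> c" for x c
    by (rule star_shaped_scale[OF star]) (use that in auto)
  have neg: "(\<lambda>x. - a x) differentiable at x" "radial_deriv (\<lambda>x. - a x) x = - radial_deriv a x" if "x \<in> \<Omega>" for x
  proof -
    have d: "((\<lambda>x. - a x) has_derivative (\<lambda>h. (- grad a x) \<bullet> h)) (at x)"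
      using has_derivative_minus[OF has_derivative_grad[OF sa(1)[OF that]]] by simp
    then show "(\<lambda>x. - a x) differentiable at x" by (auto simp: differentiable_def)
    show "radial_deriv (\<lambda>x. - a x) x = - radial_deriv a x"
      using grad_eqI[OF d] by (simp add: radial_deriv_def)
  qed
  have mono: "f1 x \<le> f1 ((1 / c) *\<^sub>R x)" "h1 x \<le> h1 ((1 / c) *\<^sub>R x)" "- a1 x \<le> - a1 ((1 / c) *\<^sub>R x)"
    if x: "x \<in> \<Omega>" and c: "1 \<le> c" for x c
    using radially_nonincreasing[OF star sff(1) _ x c] radially_nonincreasing[OF star sh(1) _ x c]
      radially_nonincreasing[OF star neg(1) _ x c] sign neg(2) mem[OF x c] x
    by (auto simp: f1_def h1_def a1_def)
  define c where "c j = 1 + 1 / real (j + 1)" for j :: nat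
  have c: "c \<longlonglongrightarrow> 1" "\<And>j. c j > 1"
  proof -
    have "(\<lambda>j. 1 + 1 / real (j + 1)) \<longlonglongrightarrow> 1 + 0"
      by (intro tendsto_add tendsto_const LIMSEQ_ignore_initial_segment[OF lim_1_over_n])
    then show "c \<longlonglongrightarrow> 1" by (simp add: c_def[abs_def])
  qed (simp add: c_def)
  have P: "AE x in lborel. h1 x \<noteq> 0 \<longrightarrow> u' x = 0" "AE x in lborel. a1 x \<noteq> 0 \<longrightarrow> u' x = 0"
    "(\<lambda>j. (\<integral>x. (f1 ((1 / c j) *\<^sub>R x) - f1 x) * \<bar>u' x\<bar> powr s \<partial>lborel) / (c j - 1)) \<longlonglongrightarrow> 0"
    "(\<lambda>j. (\<integral>x. (h1 ((1 / c j) *\<^sub>R x) - h1 x) * \<bar>u' x\<bar> powr (q + 1) \<partial>lborel) / (c j - 1)) \<longlonglongrightarrow> 0"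
    "(\<lambda>j. (\<integral>x. (- a1 ((1 / c j) *\<^sub>R x) - - a1 x) * \<bar>u' x\<bar> powr p \<partial>lborel) / (c j - 1)) \<longlonglongrightarrow> 0"
    by (rule Pohozaev[OF W star R p q fin u0 meas M sign1 mono eq[unfolded A_def g_def s_def] c, folded s_def];
        assumption)+
  \<comment> \<open>Both \<open>x\<close> and \<open>(1 / c j) *\<^sub>R x\<close> lie in \<Omega>,
    so the zero extensions may be replaced by the original coefficients.\<close>
  have quot: "(\<lambda>j. (f1 ((1 / c j) *\<^sub>R x) - f1 x) / (c j - 1)) \<longlonglongrightarrow> - (norm x * radial_deriv f x)"
    "(\<lambda>j. (h1 ((1 / c j) *\<^sub>R x) - h1 x) / (c j - 1)) \<longlonglongrightarrow> - (norm x * radial_deriv h x)"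
    "(\<lambda>j. (- a1 ((1 / c j) *\<^sub>R x) - - a1 x) / (c j - 1)) \<longlonglongrightarrow> norm x * radial_deriv a x" if x: "x \<in> \<Omega>" for x
    using dilation_quotient_tendsto[OF sff(1)[OF x] c] dilation_quotient_tendsto[OF sh(1)[OF x] c]
      dilation_quotient_tendsto[OF neg(1)[OF x] c] mem[OF x less_imp_le[OF c(2)]] x neg(2)[OF x]
    by (simp_all add: f1_def h1_def a1_def)
  have nonneg: "0 \<le> s" "0 \<le> q + 1" using p q sf by auto
  have Mneg: "\<bar>- a1 x\<bar> \<le> M" for x using M(3)[of x] by simp
  have F: "AE x in lborel. x \<in> \<Omega> \<longrightarrow> - (norm x * radial_deriv f x) \<noteq> 0 \<longrightarrow> u' x = 0"
    by (rule weight_Fatou[OF meas(1) _ M(1) fin[OF nonneg(1)] u0 mono(1) c(2) quot(1) P(3)]) auto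
  have H: "AE x in lborel. x \<in> \<Omega> \<longrightarrow> - (norm x * radial_deriv h x) \<noteq> 0 \<longrightarrow> u' x = 0"
    by (rule weight_Fatou[OF meas(2) _ M(2) fin[OF nonneg(2)] u0 mono(2) c(2) quot(2) P(4)]) auto
  have A: "AE x in lborel. x \<in> \<Omega> \<longrightarrow> norm x * radial_deriv a x \<noteq> 0 \<longrightarrow> u' x = 0"
    by (rule weight_Fatou[OF _ _ Mneg fin[of p] u0 mono(3) c(2) quot(3) P(5)]) (use p in auto)
  \<comment> \<open>The origin, excluded in the strict inequalities, is a null set.\<close>
  have nz: "AE x in lborel. x \<noteq> (0 :: real^'n)" by (rule AE_lborel_singleton)
  \<comment> \<open>A strict sign of \<open>a\<close> or \<open>h\<close> uses the vanishing of
    \<open>A\<close> or \<open>H\<close>; a strict radial derivative uses the limits of the weight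
    increments through \<open>weight_Fatou\<close>.\<close>
  have "AE x in lborel. x \<in> \<Omega> \<longrightarrow> u' x = 0"
    using strict
  proof (elim disjE)
    assume *: "\<forall>x\<in>\<Omega> - {0}. a x > 0"
    show ?thesis using P(2) nz by eventually_elim (use * in \<open>force simp: a1_def\<close>)
  next
    assume *: "\<forall>x\<in>\<Omega> - {0}. radial_deriv a x > 0"
    show ?thesis using A nz by eventually_elim (use * in force)
  next
    assume *: "\<forall>x\<in>\<Omega> - {0}. radial_deriv f x < 0"
    show ?thesis using F nz by eventually_elim (use * in force)
  next
    assume *: "\<forall>x\<in>\<Omega> - {0}. h x < 0"
    show ?thesis using P(1) nz by eventually_elim (use * in \<open>force simp: h1_def\<close>)
  next
    assume *: "\<forall>x\<in>\<Omega> - {0}. radial_deriv h x < 0"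
    show ?thesis using H nz by eventually_elim (use * in force)
  qed
  then have "AE x in lebesgue. x \<in> \<Omega> \<longrightarrow> u' x = 0" by (rule AE_completion)
  then have "AE x in lebesgue_on \<Omega>. u' x = 0" using \<Omega>(2) by (subst AE_restrict_space_iff) auto
  with ae show ?thesis by eventually_elim simp
qed

theorem proposition3:
  fixes \<Omega> :: "(real^'n) set"
    and a f h :: "real^'n \<Rightarrow> real"
    and p q :: real
  assumes "CARD('n) \<ge> 3"
    and "bounded \<Omega>" and "smooth_domain \<Omega>" and "star_shaped_wrt 0 \<Omega>"
    and "1 < p" and "p < real CARD('n)"
    and "p - 1 < q" and "q < crit_exp CARD('n) p - 1"
    and "smooth_up_to (closure \<Omega>) a"
    and "smooth_up_to (closure \<Omega>) f"
    and "smooth_up_to (closure \<Omega>) h"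
    and "\<forall>x\<in>\<Omega>. a x \<ge> 0"
    and "\<forall>x\<in>\<Omega>. radial_deriv a x \<ge> 0"
    and "\<forall>x\<in>\<Omega>. radial_deriv f x \<le> 0"
    and "\<forall>x\<in>\<Omega>. h x \<le> 0"
    and "\<forall>x\<in>\<Omega>. radial_deriv h x \<le> 0"
    and "(\<forall>x\<in>\<Omega> - {0}. a x > 0) \<or>
         (\<forall>x\<in>\<Omega> - {0}. radial_deriv a x > 0) \<or>
         (\<forall>x\<in>\<Omega> - {0}. radial_deriv f x < 0) \<or>
         (\<forall>x\<in>\<Omega> - {0}. h x < 0) \<or>
         (\<forall>x\<in>\<Omega> - {0}. radial_deriv h x < 0)"
  shows "\<not> (\<exists>u. is_solution \<Omega> p q a f h u \<and> changes_sign \<Omega> u)"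
proof
  assume "\<exists>u. is_solution \<Omega> p q a f h u \<and> changes_sign \<Omega> u"
  then obtain u where u: "is_solution \<Omega> p q a f h u" "changes_sign \<Omega> u" by blast
  have "AE x in lebesgue_on \<Omega>. u x = 0"
    using assms u(1) by (intro solution_vanishes[of \<Omega> p q a f h u]) (auto simp: smooth_domain_def)
  then have "AE x in lebesgue_on \<Omega>. u x \<ge> 0" by eventually_elim simp
  with u(2) show False by (simp add: changes_sign_def)
qed

end
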